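(* Let $N=(G,+,<)$ be elementarily equivalent to an archimedean ordered abelian group with small quotients, and let $M$ be a reduct (but not necessarily a $0$-reduct) of $N$ that expands $(G,+)$. Let $\mathcal{N}=(\mathcal{G},+,<)$ be a monster model for $\operatorname{Th}(N)$, and let $\mathcal{M}$ be the reduct of $\mathcal{N}$ to the language of $M$. Then the following are equivalent: (1) $M$ is stable. (2) Every unary subset $D\subseteq G$ that is definable in $M$ is also definable in $(G,+)$. (3) Every unary subset $\mathcal{D}\subseteq\mathcal{G}$ that is definable in $\mathcal{M}$ is also definable in $(\mathcal{G},+)$.
   Context: "Definable" without a specified parameter set means definable with parameters from the structure. For structures $M,N$ with the same universe and a subset $A$ of that universe, $M$ is an $A$-reduct of $N$ (equivalently $N$ is an $A$-expansion of $M$) if every $X\subseteq M^k$ (any $k$) that is $\emptyset$-definable in $M$ is $A$-definable in $N$. When $A$ is the whole universe one says reduct/expansion; when $A=\emptyset$ one says $0$-reduct/$0$-expansion. A structure expands $(G,+)$ if it is an expansion of the structure $(G,+)$. An ordered abelian group is an abelian group with a linear order $<$ such that $a<b$ implies $a+c<b+c$. It is archimedean if for every $a,b\in G$ with $a\neq 0$ there is $n\in\mathbb{Z}$ with $b<na$. An abelian group $(G,+)$ has small quotients if for all $1\le n<\omega$ the index $[G:nG]$ is finite. A monster model $\mathcal{N}$ for $\operatorname{Th}(N)$ is a sufficiently saturated and strongly homogeneous elementary extension of $N$ (more saturated than $|G|$ and the sizes of the languages involved). The reduct $\mathcal{M}$ of $\mathcal{N}$ to the language of $M$ is obtained as follows: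 each symbol of the language of $M$ is defined in $N$ by some formula with parameters from $G$, and it is interpreted in $\mathcal{G}$ by the same formula evaluated in $\mathcal{N}$; thus $\mathcal{M}$ is an elementary extension of $M$. *)

theory Defs
  imports Main
begin

unbundle cardinal_syntax

section \<open>First-order structures\<close>

datatype 'f fo_term = Var nat | App 'f "'f fo_term list"

datatype ('f, 'r) fo_formula =
    Eq "'f fo_term" "'f fo_term"
  | Rel 'r "'f fo_term list"
  | Neg "('f, 'r) fo_formula"
  | Conj "('f, 'r) fo_formula" "('f, 'r) fo_formula"
  | Ex nat "('f, 'r) fo_formula"

text \<open>
  A structure carries its language: the symbols are the elements of the domains of the two arity
  maps. The universe is the whole type \<^typ>\<open>'a\<close>. The values of the interpretation maps at a symbol
  outside the language, or at a list of the wrong length, are irrelevant.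
\<close>

record ('f, 'r, 'a) fo_struct =
  fn_arity :: "'f \<rightharpoonup> nat"
  rel_arity :: "'r \<rightharpoonup> nat"
  fn_int :: "'f \<Rightarrow> 'a list \<Rightarrow> 'a"
  rel_int :: "'r \<Rightarrow> 'a list \<Rightarrow> bool"

definition same_language :: "('f, 'r, 'a) fo_struct \<Rightarrow> ('f, 'r, 'b) fo_struct \<Rightarrow> bool" where
  "same_language M N \<longleftrightarrow> fn_arity M = fn_arity N \<and> rel_arity M = rel_arity N"

fun fv_term :: "'f fo_term \<Rightarrow> nat set" where
  "fv_term (Var i) = {i}"
| "fv_term (App f ts) = (\<Union>t\<in>set ts. fv_term t)"

fun fv :: "('f, 'r) fo_formula \<Rightarrow> nat set" where
  "fv (Eq s t) = fv_term s \<union> fv_term t"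
| "fv (Rel r ts) = (\<Union>t\<in>set ts. fv_term t)"
| "fv (Neg \<phi>) = fv \<phi>"
| "fv (Conj \<phi> \<psi>) = fv \<phi> \<union> fv \<psi>"
| "fv (Ex i \<phi>) = fv \<phi> - {i}"

fun wf_term :: "('f, 'r, 'a) fo_struct \<Rightarrow> 'f fo_term \<Rightarrow> bool" where
  "wf_term M (Var i) \<longleftrightarrow> True"
| "wf_term M (App f ts) \<longleftrightarrow> fn_arity M f = Some (length ts) \<and> (\<forall>t\<in>set ts. wf_term M t)"

fun wf_formula :: "('f, 'r, 'a) fo_struct \<Rightarrow> ('f, 'r) fo_formula \<Rightarrow> bool" where
  "wf_formula M (Eq s t) \<longleftrightarrow> wf_term M s \<and> wf_term M t"
| "wf_formula M (Rel r ts) \<longleftrightarrow> rel_arity M r = Some (length ts) \<and> (\<forall>t\<in>set ts. wf_term M t)"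
| "wf_formula M (Neg \<phi>) \<longleftrightarrow> wf_formula M \<phi>"
| "wf_formula M (Conj \<phi> \<psi>) \<longleftrightarrow> wf_formula M \<phi> \<and> wf_formula M \<psi>"
| "wf_formula M (Ex i \<phi>) \<longleftrightarrow> wf_formula M \<phi>"

fun eval :: "('f, 'r, 'a) fo_struct \<Rightarrow> (nat \<Rightarrow> 'a) \<Rightarrow> 'f fo_term \<Rightarrow> 'a" where
  "eval M e (Var i) = e i"
| "eval M e (App f ts) = fn_int M f (map (eval M e) ts)"

fun sat :: "('f, 'r, 'a) fo_struct \<Rightarrow> (nat \<Rightarrow> 'a) \<Rightarrow> ('f, 'r) fo_formula \<Rightarrow> bool" where
  "sat M e (Eq s t) \<longleftrightarrow> eval M e s = eval M e t"
| "sat M e (Rel r ts) \<longleftrightarrow> rel_int M r (map (eval M e) ts)"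
| "sat M e (Neg \<phi>) \<longleftrightarrow> \<not> sat M e \<phi>"
| "sat M e (Conj \<phi> \<psi>) \<longleftrightarrow> sat M e \<phi> \<and> sat M e \<psi>"
| "sat M e (Ex i \<phi>) \<longleftrightarrow> (\<exists>a. sat M (e(i := a)) \<phi>)"

definition is_formula :: "('f, 'r, 'a) fo_struct \<Rightarrow> nat \<Rightarrow> ('f, 'r) fo_formula \<Rightarrow> bool" where
  "is_formula M n \<phi> \<longleftrightarrow> wf_formula M \<phi> \<and> fv \<phi> \<subseteq> {..<n}"

text \<open>
  Only used for formulas in the variables \<^term>\<open>{..<length as}\<close>, so that the value
  of \<^term>\<open>nth as\<close> beyond the end of the list plays no role.
\<close>

definition holds :: "('f, 'r, 'a) fo_struct \<Rightarrow> ('f, 'r) fo_formula \<Rightarrow> 'a list \<Rightarrow> bool" where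
  "holds M \<phi> as \<longleftrightarrow> sat M (nth as) \<phi>"


section \<open>Definability and reducts\<close>

definition solutions ::
    "('f, 'r, 'a) fo_struct \<Rightarrow> nat \<Rightarrow> ('f, 'r) fo_formula \<Rightarrow> 'a list \<Rightarrow> 'a list set" where
  "solutions M k \<phi> bs = {as. length as = k \<and> holds M \<phi> (as @ bs)}"

definition definable :: "('f, 'r, 'a) fo_struct \<Rightarrow> 'a set \<Rightarrow> nat \<Rightarrow> 'a list set \<Rightarrow> bool" where
  "definable M A k X \<longleftrightarrow>
     (\<exists>\<phi> bs. set bs \<subseteq> A \<and> is_formula M (k + length bs) \<phi> \<and> X = solutions M k \<phi> bs)"

definition definable_unary :: "('f, 'r, 'a) fo_struct \<Rightarrow> 'a set \<Rightarrow> bool" where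
  "definable_unary M D \<longleftrightarrow> definable M UNIV 1 ((\<lambda>x. [x]) ` D)"

definition reduct_over ::
    "'a set \<Rightarrow> ('f, 'r, 'a) fo_struct \<Rightarrow> ('g, 's, 'a) fo_struct \<Rightarrow> bool" where
  "reduct_over A M N \<longleftrightarrow> (\<forall>k X. definable M {} k X \<longrightarrow> definable N A k X)"

abbreviation reduct :: "('f, 'r, 'a) fo_struct \<Rightarrow> ('g, 's, 'a) fo_struct \<Rightarrow> bool" where
  "reduct M N \<equiv> reduct_over UNIV M N"

abbreviation expands :: "('f, 'r, 'a) fo_struct \<Rightarrow> ('g, 's, 'a) fo_struct \<Rightarrow> bool" where
  "expands N M \<equiv> reduct M N"


section \<open>Elementary equivalence, monster models, stability\<close>

definition elementarily_equivalent ::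
    "('f, 'r, 'a) fo_struct \<Rightarrow> ('f, 'r, 'b) fo_struct \<Rightarrow> bool" where
  "elementarily_equivalent M N \<longleftrightarrow> same_language M N \<and>
     (\<forall>\<phi>. is_formula M 0 \<phi> \<longrightarrow> (holds M \<phi> [] \<longleftrightarrow> holds N \<phi> []))"

text \<open>
  Since universes are types, an elementary extension of \<open>M\<close> is given by an elementary embedding
  of \<open>M\<close> into it.
\<close>

definition elementary_embedding ::
    "('a \<Rightarrow> 'b) \<Rightarrow> ('f, 'r, 'a) fo_struct \<Rightarrow> ('f, 'r, 'b) fo_struct \<Rightarrow> bool" where
  "elementary_embedding j M N \<longleftrightarrow> same_language M N \<and>
     (\<forall>\<phi> as. is_formula M (length as) \<phi> \<longrightarrow> (holds M \<phi> as \<longleftrightarrow> holds N \<phi> (map j as)))"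

text \<open>
  A pair \<open>(\<phi>, bs)\<close> stands for the formula \<open>\<phi>\<close> in the variable \<open>x\<^sub>0\<close> with the parameters \<open>bs\<close>
  substituted for \<open>x\<^sub>1, x\<^sub>2, \<dots>\<close>.
\<close>

definition saturated :: "'k rel \<Rightarrow> ('f, 'r, 'a) fo_struct \<Rightarrow> bool" where
  "saturated \<kappa> N \<longleftrightarrow>
     (\<forall>A p. |A| <o \<kappa> \<longrightarrow>
        (\<forall>(\<phi>, bs)\<in>p. set bs \<subseteq> A \<and> is_formula N (1 + length bs) \<phi>) \<longrightarrow>
        (\<forall>q\<subseteq>p. finite q \<longrightarrow> (\<exists>x. \<forall>(\<phi>, bs)\<in>q. holds N \<phi> (x # bs))) \<longrightarrow>
        (\<exists>x. \<forall>(\<phi>, bs)\<in>p. holds N \<phi> (x # bs)))"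

definition partial_elementary :: "('f, 'r, 'a) fo_struct \<Rightarrow> 'a set \<Rightarrow> ('a \<Rightarrow> 'a) \<Rightarrow> bool" where
  "partial_elementary N A h \<longleftrightarrow>
     (\<forall>\<phi> as. set as \<subseteq> A \<longrightarrow> is_formula N (length as) \<phi> \<longrightarrow>
        (holds N \<phi> as \<longleftrightarrow> holds N \<phi> (map h as)))"

definition automorphism :: "('f, 'r, 'a) fo_struct \<Rightarrow> ('a \<Rightarrow> 'a) \<Rightarrow> bool" where
  "automorphism N \<sigma> \<longleftrightarrow> bij \<sigma> \<and>
     (\<forall>f as. fn_arity N f = Some (length as) \<longrightarrow> \<sigma> (fn_int N f as) = fn_int N f (map \<sigma> as)) \<and>
     (\<forall>r as. rel_arity N r = Some (length as) \<longrightarrow> (rel_int N r as \<longleftrightarrow> rel_int N r (map \<sigma> as)))"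

definition strongly_homogeneous :: "'k rel \<Rightarrow> ('f, 'r, 'a) fo_struct \<Rightarrow> bool" where
  "strongly_homogeneous \<kappa> N \<longleftrightarrow>
     (\<forall>A h. |A| <o \<kappa> \<longrightarrow> partial_elementary N A h \<longrightarrow>
        (\<exists>\<sigma>. automorphism N \<sigma> \<and> (\<forall>a\<in>A. \<sigma> a = h a)))"

definition monster_model ::
    "'k rel \<Rightarrow> ('a \<Rightarrow> 'b) \<Rightarrow> ('f, 'r, 'a) fo_struct \<Rightarrow> ('f, 'r, 'b) fo_struct \<Rightarrow> bool" where
  "monster_model \<kappa> j N NN \<longleftrightarrow>
     elementary_embedding j N NN \<and> saturated \<kappa> NN \<and> strongly_homogeneous \<kappa> NN"

text \<open>
  \<open>\<kappa>\<close> exceeds the size of the universe and of the language of \<open>M\<close>; the latter counts formulas,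
  hence is at least \<open>\<aleph>\<^sub>0\<close>.
\<close>

definition exceeds_size :: "'k rel \<Rightarrow> ('f, 'r, 'a) fo_struct \<Rightarrow> bool" where
  "exceeds_size \<kappa> M \<longleftrightarrow> Card_order \<kappa> \<and> natLeq <o \<kappa> \<and> |UNIV :: 'a set| <o \<kappa> \<and>
     |dom (fn_arity M)| <o \<kappa> \<and> |dom (rel_arity M)| <o \<kappa>"

text \<open>
  \<open>MM\<close> is the structure in the language of \<open>M\<close> obtained by choosing, for each symbol, a formula
  with parameters that defines it in \<open>N\<close>, and evaluating this formula in the elementary
  extension \<open>NN\<close> of \<open>N\<close>. Function symbols are treated through their graphs.
\<close>

definition extended_reduct ::
    "('f, 'r, 'a) fo_struct \<Rightarrow> ('g, 's, 'a) fo_struct \<Rightarrow> ('a \<Rightarrow> 'b) \<Rightarrow> ('g, 's, 'b) fo_struct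
      \<Rightarrow> ('f, 'r, 'b) fo_struct \<Rightarrow> bool" where
  "extended_reduct M N j NN MM \<longleftrightarrow> same_language M MM \<and>
     (\<forall>r k. rel_arity M r = Some k \<longrightarrow>
        (\<exists>\<phi> bs. is_formula N (k + length bs) \<phi> \<and>
           {as. length as = k \<and> rel_int M r as} = solutions N k \<phi> bs \<and>
           {as. length as = k \<and> rel_int MM r as} = solutions NN k \<phi> (map j bs))) \<and>
     (\<forall>f k. fn_arity M f = Some k \<longrightarrow>
        (\<exists>\<phi> bs. is_formula N (Suc k + length bs) \<phi> \<and>
           {as @ [fn_int M f as] |as. length as = k} = solutions N (Suc k) \<phi> bs \<and>
           {as @ [fn_int MM f as] |as. length as = k} = solutions NN (Suc k) \<phi> (map j bs)))"

text \<open>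
  The formula \<open>\<phi>(x; y)\<close>, with \<open>k\<close> variables \<open>x\<close> and \<open>l\<close> variables \<open>y\<close>, has the order property
  in the theory of \<open>M\<close>. The finite form, with arbitrarily long ladders, is expressed by a set of
  sentences and so depends only on the theory of \<open>M\<close>; an infinite ladder is only to be expected
  in a sufficiently saturated model of this theory.
\<close>

definition order_property ::
    "('f, 'r, 'a) fo_struct \<Rightarrow> nat \<Rightarrow> nat \<Rightarrow> ('f, 'r) fo_formula \<Rightarrow> bool" where
  "order_property M k l \<phi> \<longleftrightarrow>
     (\<forall>n. \<exists>(a :: nat \<Rightarrow> 'a list) (b :: nat \<Rightarrow> 'a list). 
        (\<forall>i<n. length (a i) = k \<and> length (b i) = l) \<and>
        (\<forall>i<n. \<forall>i'<n. holds M \<phi> (a i @ b i') \<longleftrightarrow> i < i'))"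

definition is_stable :: "('f, 'r, 'a) fo_struct \<Rightarrow> bool" where
  "is_stable M \<longleftrightarrow> (\<forall>k l \<phi>. is_formula M (k + l) \<phi> \<longrightarrow> \<not> order_property M k l \<phi>)"


section \<open>Ordered abelian groups\<close>

datatype plus_symbol = Plus
datatype less_symbol = Less

fun plus_int :: "plus_symbol \<Rightarrow> 'a list \<Rightarrow> 'a::ab_group_add" where
  "plus_int Plus [x, y] = x + y"
| "plus_int Plus _ = 0"

fun less_int :: "less_symbol \<Rightarrow> 'a::linorder list \<Rightarrow> bool" where
  "less_int Less [x, y] \<longleftrightarrow> x < y"
| "less_int Less _ \<longleftrightarrow> False"

definition group_struct :: "(plus_symbol, less_symbol, 'a::ab_group_add) fo_struct" where
  "group_struct = \<lparr>fn_arity = [Plus \<mapsto> 2], rel_arity = Map.empty,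
     fn_int = plus_int, rel_int = (\<lambda>_ _. False)\<rparr>"

definition ordered_group_struct ::
    "(plus_symbol, less_symbol, 'a::linordered_ab_group_add) fo_struct" where
  "ordered_group_struct = \<lparr>fn_arity = [Plus \<mapsto> 2], rel_arity = [Less \<mapsto> 2],
     fn_int = plus_int, rel_int = less_int\<rparr>"

definition int_multiple :: "int \<Rightarrow> 'a \<Rightarrow> 'a::ab_group_add" where
  "int_multiple n a = (if 0 \<le> n then \<Sum>i<nat n. a else - (\<Sum>i<nat (- n). a))"

definition archimedean_group :: "'a::linordered_ab_group_add itself \<Rightarrow> bool" where
  "archimedean_group _ \<longleftrightarrow> (\<forall>a b :: 'a. a \<noteq> 0 \<longrightarrow> (\<exists>n. b < int_multiple n a))"

definition small_quotients :: "'a::ab_group_add itself \<Rightarrow> bool" where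
  "small_quotients _ \<longleftrightarrow>
     (\<forall>n\<ge>1. finite ((UNIV :: 'a set) // {(x, y). x - y \<in> range (int_multiple n)}))"

end

theory Submission
  imports Defs "HOL.Modules" "HOL-Library.FuncSet" "HOL-Library.Ramsey"
begin

text \<open>
  Call a set \<open>D\<close> of group elements coset-like if for some \<open>n \<ge> 1\<close> it
  contains almost all or almost none of every coset of \<open>nG\<close>. As the quotients
  \<open>G/nG\<close> are finite, quantifier elimination for torsion-free groups shows that the unary sets
  definable in \<open>(G,+)\<close> are exactly the coset-like ones
  (\<open>definable_unary_imp_coset_like\<close>, \<open>coset_like_imp_definable_unary\<close>). The
  hinge of the proof is a uniform version: every family of unary sets definable in \<open>M\<close> is
  coset-like with one \<open>n\<close> and one bound \<open>K\<close> on the number of exceptions in a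
  coset (\<open>uniformly_coset_like\<close>). The equivalence follows from the chain: stability implies
  (2), (2) implies the uniform version, the uniform version implies stability and (3), and (3) implies
  (2). The last two steps are transfers along the elementary embedding: with \<open>n\<close> and
  \<open>K\<close> fixed, the bound is a first-order statement about the parameters.

  The ordered group enters through quantifier elimination in the language of linear inequalities and
  congruences. What this needs from the archimedean group is first-order (\<open>regular_group\<close>),
  hence holds in \<open>G\<close>. It follows that a definable family of unary sets is, on every coset of
  a fixed \<open>nG\<close>, cut into a bounded number of convex pieces by cuts of the form \<open>{x. s <
  kx}\<close> or \<open>{x. s \<le> kx}\<close> (\<open>qf_controlled\<close>), and no such cut is
  invariant under a translation (\<open>cut_approximable\<close>).

  Stability implies (2): if \<open>D\<close> is not coset-like, then an affine preimage of
  \<open>D\<close>, changed by a finite set, jumps at some cut: an infinite convex piece outside is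
  followed by an infinite one inside, or conversely (\<open>exists_jump\<close>). Elements
  \<open>a\<^sub>i\<close> and \<open>b\<^sub>j\<close> that are multiples of a small
  \<open>\<epsilon>\<close> away from this cut make \<open>x + y \<in> D\<close> an order
  (\<open>jump_ladder\<close>).

  (2) implies uniformity: by (2) the pieces are finite or cofinite, and only their sizes could be
  unbounded. Passing to symmetric differences with translates leaves a definable family of finite sets. In
  a dense group the convex pieces of a finite set are points. If there is a least positive element and the
  sizes are unbounded, then intersecting members of the family with translates of themselves isolates
  intervals of unboundedly many lengths; the set of these lengths is definable, infinite and positive, so
  it is not coset-like (\<open>runs_bounded\<close>).

  Uniformity implies stability: induction on the number of variables on the left of the formula. Given
  long ladders for a formula with one more variable \<open>x\<close>, Ramsey's theorem makes the generic
  truth value of the formula, for almost all \<open>x\<close> in a fixed coset, depend only on the order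
  of the indices. If it differs on the two sides, then it is a ladder with fewer variables. Otherwise
  \<open>x\<close> lies in a definable set of at most \<open>K\<close> exceptions, and such a variable is
  removed by induction on \<open>K\<close> (\<open>no_ladders_algebraic\<close>).
\<close>

section \<open>Multiples and congruences in abelian groups\<close>

lemma int_multiple_0 [simp]: "int_multiple 0 a = 0"
  by (simp add: int_multiple_def)

lemma int_multiple_Suc: "int_multiple (k + 1) a = int_multiple k a + a"
proof (cases "0 \<le> k")
  case True
  then have "nat (k + 1) = Suc (nat k)" by simp
  then show ?thesis using True by (simp add: int_multiple_def)
next
  case False
  then obtain m where m: "k = - int (Suc m)"
    by (metis int_cases2 nat_int negative_zless_0 not_less of_nat_0_le_iff old.nat.exhaust minus_zero of_nat_0)
  show ?thesis
  proof (cases m)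
    case 0 then show ?thesis using m by (simp add: int_multiple_def)
  next
    case (Suc m')
    then have "nat (- k) = Suc (nat (- (k + 1)))" "\<not> 0 \<le> k + 1" "\<not> 0 \<le> k" using m by auto
    then show ?thesis by (simp add: int_multiple_def)
  qed
qed

lemma int_multiple_diff1: "int_multiple (k - 1) a = int_multiple k a - a"
  using int_multiple_Suc[of "k - 1" a] by (simp add: algebra_simps)

lemma int_multiple_add_left: "int_multiple (k + l) a = int_multiple k a + int_multiple l a"
proof (induction l rule: int_induct[where k = 0])
  case base show ?case by simp
next
  case (step1 i)
  then show ?case using int_multiple_Suc[of "k + i" a] int_multiple_Suc[of i a]
    by (simp add: algebra_simps)
next
  case (step2 i)
  have "k + (i - 1) = (k + i) - 1" by simp
  then have "int_multiple (k + (i - 1)) a = int_multiple (k + i) a - a"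
    by (simp only: int_multiple_diff1)
  also have "\<dots> = int_multiple k a + (int_multiple i a - a)"
    by (simp only: step2.IH add_diff_eq)
  finally show ?case by (simp only: int_multiple_diff1)
qed

lemma int_multiple_add_right: "int_multiple k (a + b) = int_multiple k a + int_multiple k b"
  by (induction k rule: int_induct[where k = 0])
    (simp_all add: int_multiple_Suc int_multiple_diff1 algebra_simps)

lemma int_multiple_1 [simp]: "int_multiple 1 a = a"
  using int_multiple_Suc[of 0 a] by simp

interpretation zmod: module "int_multiple :: int \<Rightarrow> 'a \<Rightarrow> 'a::ab_group_add"
proof
  fix k l :: int and a b :: 'a
  have minus: "int_multiple (- k) a = - int_multiple k a" for k and a :: 'a
    using int_multiple_add_left[of k "- k" a] by (simp add: eq_neg_iff_add_eq_0 add.commute)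
  show "int_multiple k (a + b) = int_multiple k a + int_multiple k b"
    by (rule int_multiple_add_right)
  show "int_multiple (k + l) a = int_multiple k a + int_multiple l a"
    by (rule int_multiple_add_left)
  show "int_multiple k (int_multiple l a) = int_multiple (k * l) a"
  proof (induction k rule: int_induct[where k = 0])
    case (step2 i)
    have "(i - 1) * l = i * l + (- l)" by (simp add: algebra_simps)
    then have "int_multiple ((i - 1) * l) a = int_multiple (i * l) a + int_multiple (- l) a"
      by (simp only: int_multiple_add_left)
    also have "\<dots> = int_multiple i (int_multiple l a) - int_multiple l a"
      by (simp only: step2.IH minus diff_conv_add_uminus)
    finally show ?case by (simp only: int_multiple_diff1)
  qed (simp_all add: int_multiple_Suc algebra_simps int_multiple_add_left)
  show "int_multiple 1 a = a" by simp
qed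

lemmas zmod_simps = zmod.scale_left_distrib zmod.scale_right_distrib zmod.scale_left_diff_distrib
  zmod.scale_right_diff_distrib zmod.scale_minus_left zmod.scale_minus_right zmod.scale_scale

lemma int_multiple_pos:
  fixes a :: "'a::linordered_ab_group_add"
  assumes "0 < a" "0 < k" shows "a \<le> int_multiple k a" "0 < int_multiple k a"
proof -
  have "a \<le> int_multiple k a"
    using assms(2)
  proof (induction k rule: int_gr_induct)
    case base then show ?case by simp
  next
    case (step i)
    then show ?case using assms(1) by (simp add: int_multiple_Suc add_increasing)
  qed
  then show "a \<le> int_multiple k a" "0 < int_multiple k a" using assms(1) by auto
qed

lemma int_multiple_mono_iff:
  fixes a b :: "'a::linordered_ab_group_add"
  assumes "0 < k"
  shows "int_multiple k a < int_multiple k b \<longleftrightarrow> a < b"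
    and "int_multiple k a \<le> int_multiple k b \<longleftrightarrow> a \<le> b"
    and "int_multiple k a = int_multiple k b \<longleftrightarrow> a = b"
proof -
  have less: "int_multiple k a < int_multiple k b" if "a < b" for a b :: 'a
    using int_multiple_pos(2)[of "b - a" k] that assms by (simp add: zmod_simps)
  show "int_multiple k a < int_multiple k b \<longleftrightarrow> a < b"
    using less[of a b] less[of b a] by (metis less_irrefl less_trans linorder_neqE)
  show "int_multiple k a \<le> int_multiple k b \<longleftrightarrow> a \<le> b"
    using less[of a b] less[of b a] by (metis less_le not_less order_refl)
  show "int_multiple k a = int_multiple k b \<longleftrightarrow> a = b"
    using less[of a b] less[of b a] by (metis less_irrefl linorder_neqE)
qed

lemma int_multiple_mono_left:
  fixes a :: "'a::linordered_ab_group_add"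
  assumes "0 < a"
  shows "int_multiple k a < int_multiple l a \<longleftrightarrow> k < l"
    and "int_multiple k a \<le> int_multiple l a \<longleftrightarrow> k \<le> l"
    and "int_multiple k a = int_multiple l a \<longleftrightarrow> k = l"
proof -
  have less: "int_multiple k a < int_multiple l a" if "k < l" for k l
    using int_multiple_pos(2)[of a "l - k"] that assms by (simp add: zmod_simps)
  show "int_multiple k a < int_multiple l a \<longleftrightarrow> k < l"
    using less[of k l] less[of l k] by (metis less_irrefl less_trans linorder_neqE)
  show "int_multiple k a \<le> int_multiple l a \<longleftrightarrow> k \<le> l"
    using less[of k l] less[of l k] by (metis less_le not_less order_refl)
  show "int_multiple k a = int_multiple l a \<longleftrightarrow> k = l"
    using less[of k l] less[of l k] by (metis less_irrefl linorder_neqE)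
qed

text \<open>
  The relation \<open>x \<in> y + nG\<close>, written with an existential quantifier so that it reads as a
  formula.
\<close>

definition cgr :: "int \<Rightarrow> 'a \<Rightarrow> 'a::ab_group_add \<Rightarrow> bool" where
  "cgr n x y \<longleftrightarrow> (\<exists>z. x = y + int_multiple n z)"

lemma cgr_iff_range: "cgr n x y \<longleftrightarrow> x - y \<in> range (int_multiple n)"
  unfolding cgr_def image_iff by (auto simp: algebra_simps)

lemma cgr_refl [simp]: "cgr n x x"
  unfolding cgr_def by (rule exI[of _ 0]) simp

lemma cgr_add: "cgr n x y \<Longrightarrow> cgr n x' y' \<Longrightarrow> cgr n (x + x') (y + y')"
proof -
  assume "cgr n x y" "cgr n x' y'"
  then obtain z z' where "x = y + int_multiple n z" "x' = y' + int_multiple n z'"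
    unfolding cgr_def by auto
  then have "x + x' = (y + y') + int_multiple n (z + z')" by (simp add: zmod_simps algebra_simps)
  then show ?thesis unfolding cgr_def by blast
qed

lemma cgr_minus: "cgr n x y \<Longrightarrow> cgr n (- x) (- y)"
proof -
  assume "cgr n x y"
  then obtain z where "x = y + int_multiple n z" unfolding cgr_def by auto
  then have "- x = - y + int_multiple n (- z)" by (simp add: zmod_simps algebra_simps)
  then show ?thesis unfolding cgr_def by blast
qed

lemma cgr_sym: "cgr n x y \<Longrightarrow> cgr n y x"
  using cgr_add[of n "- x" "- y" "x + y" "x + y"] cgr_minus[of n x y] by simp

lemma cgr_trans: "cgr n x y \<Longrightarrow> cgr n y z \<Longrightarrow> cgr n x z"
  using cgr_add[of n x y y z] cgr_add[of n "x + y" "y + z" "- y" "- y"] by (simp add: algebra_simps)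

lemma cgr_scale: "cgr n x y \<Longrightarrow> cgr n (int_multiple k x) (int_multiple k y)"
proof -
  assume "cgr n x y"
  then obtain z where "x = y + int_multiple n z" unfolding cgr_def by auto
  then have "int_multiple k x = int_multiple k y + int_multiple n (int_multiple k z)"
    by (simp add: zmod_simps algebra_simps)
  then show ?thesis unfolding cgr_def by blast
qed

lemma cgr_diff_iff: "cgr n (x - y) z \<longleftrightarrow> cgr n x (y + z)"
  unfolding cgr_def by (auto simp: algebra_simps)

lemma cgr_dvd: assumes "cgr (k * n) x y" shows "cgr n x y" "cgr k x y"
proof -
  from assms obtain z where z: "x = y + int_multiple (k * n) z" unfolding cgr_def by auto
  have "int_multiple (k * n) z = int_multiple n (int_multiple k z)"
    "int_multiple (k * n) z = int_multiple k (int_multiple n z)" by (simp_all add: mult.commute)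
  then show "cgr n x y" "cgr k x y" unfolding cgr_def z by metis+
qed

lemma cgr_mult_iff: "cgr (k * n) (int_multiple k x) (int_multiple k y)" if "cgr n x y"
proof -
  from that obtain z where "x = y + int_multiple n z" unfolding cgr_def by auto
  then have "int_multiple k x = int_multiple k y + int_multiple (k * n) z"
    by (simp add: zmod_simps algebra_simps)
  then show ?thesis unfolding cgr_def by blast
qed

text \<open>
  Finite index of every \<open>nG\<close>, in terms of representatives; for a fixed number of them this is
  first-order.
\<close>

definition small_index :: "'a::ab_group_add itself \<Rightarrow> bool" where
  "small_index _ \<longleftrightarrow> (\<forall>n\<ge>1. \<exists>R :: 'a set. finite R \<and> (\<forall>x. \<exists>r\<in>R. cgr n x r))"

lemma small_quotients_imp_small_index:
  assumes "small_quotients TYPE('a::ab_group_add)" shows "small_index TYPE('a)"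
  unfolding small_index_def
proof (intro allI impI)
  fix n :: int assume "1 \<le> n"
  define E where "E = {(x, y :: 'a). x - y \<in> range (int_multiple n)}"
  define R where "R = (\<lambda>C. SOME c. c \<in> C) ` (UNIV // E)"
  have E: "E `` {x} = {y. cgr n x y}" for x
    by (auto simp: E_def cgr_iff_range)
  have "\<exists>r\<in>R. cgr n x r" for x
  proof
    have "cgr n x (SOME c. cgr n x c)" using cgr_refl by (rule someI)
    then show "cgr n x (SOME c. c \<in> E `` {x})" by (simp add: E)
    show "(SOME c. c \<in> E `` {x}) \<in> R" unfolding R_def by (intro imageI quotientI) simp
  qed
  moreover have "finite R"
    using assms \<open>1 \<le> n\<close> unfolding R_def E_def small_quotients_def by (intro finite_imageI) blast
  ultimately show "\<exists>R :: 'a set. finite R \<and> (\<forall>x. \<exists>r\<in>R. cgr n x r)" by blast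
qed

text \<open>
  Cosets of \<open>nG\<close> are unbounded in a nontrivial ordered group, as \<open>z \<le> nz\<close>
  for positive \<open>z\<close>.
\<close>

lemma exists_congruent_above:
  fixes b :: "'a::linordered_ab_group_add"
  assumes "0 < (g :: 'a)" "1 \<le> n" shows "\<exists>y>b. cgr n y r"
proof -
  define m where "m = max 0 (b - r)"
  define z where "z = m + g"
  have m: "0 \<le> m" "b - r \<le> m" unfolding m_def by (rule max.cobounded1, rule max.cobounded2)
  have "m < z" using assms(1) unfolding z_def by (simp only: less_add_same_cancel1)
  then have "0 < z" "b - r < z" using m by (metis le_less_trans)+
  moreover have "z \<le> int_multiple n z" using int_multiple_pos(1)[of z n] assms(2) \<open>0 < z\<close> by simp
  ultimately have "b - r < int_multiple n z" by (metis less_le_trans)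
  then have "b < r + int_multiple n z" by (simp add: algebra_simps)
  then show ?thesis unfolding cgr_def by blast
qed

lemma exists_congruent_below:
  fixes b :: "'a::linordered_ab_group_add"
  assumes "0 < (g :: 'a)" "1 \<le> n" shows "\<exists>y<b. cgr n y r"
proof -
  obtain y where "y > - b" "cgr n y (- r)" using exists_congruent_above[OF assms] by blast
  then have "- y < b" "cgr n (- y) r" using cgr_minus[of n y "- r"] by (auto simp: minus_less_iff)
  then show ?thesis by blast
qed

section \<open>Predicates defined by one formula in two structures\<close>

fun subst_term :: "(nat \<Rightarrow> 'f fo_term) \<Rightarrow> 'f fo_term \<Rightarrow> 'f fo_term" where
  "subst_term s (Var i) = s i"
| "subst_term s (App f ts) = App f (map (subst_term s) ts)"

lemma eval_subst_term: "eval M e (subst_term s t) = eval M (\<lambda>i. eval M e (s i)) t"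
  by (induction t) (auto intro: arg_cong[where f = "fn_int M _"])

lemma wf_subst_term: "wf_term M t \<Longrightarrow> (\<And>i. wf_term M (s i)) \<Longrightarrow> wf_term M (subst_term s t)"
  by (induction t) auto

lemma eval_cong: "(\<And>i. i \<in> fv_term t \<Longrightarrow> e i = e' i) \<Longrightarrow> eval M e t = eval M e' t"
proof (induction t)
  case (App f ts)
  have "map (eval M e) ts = map (eval M e') ts"
  proof (rule map_cong[OF refl])
    fix t assume t: "t \<in> set ts"
    show "eval M e t = eval M e' t"
    proof (rule App.IH[OF t])
      fix i assume "i \<in> fv_term t"
      with t have "i \<in> fv_term (App f ts)" by auto
      then show "e i = e' i" by (rule App.prems)
    qed
  qed
  then show ?case by (simp only: eval.simps)
qed simp

lemma sat_cong: "(\<And>i. i \<in> fv \<phi> \<Longrightarrow> e i = e' i) \<Longrightarrow> sat M e \<phi> \<longleftrightarrow> sat M e' \<phi>"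
proof (induction \<phi> arbitrary: e e')
  case (Eq s t)
  have "eval M e s = eval M e' s" "eval M e t = eval M e' t"
    by (rule eval_cong, simp add: Eq)+
  then show ?case by simp
next
  case (Rel r ts)
  have "map (eval M e) ts = map (eval M e') ts"
  proof (rule map_cong[OF refl])
    fix t assume t: "t \<in> set ts"
    show "eval M e t = eval M e' t"
    proof (rule eval_cong)
      fix i assume "i \<in> fv_term t"
      with t have "i \<in> fv (Rel r ts)" by auto
      then show "e i = e' i" by (rule Rel)
    qed
  qed
  then show ?case by (simp only: sat.simps)
next
  case (Neg \<phi>)
  have "sat M e \<phi> \<longleftrightarrow> sat M e' \<phi>" by (rule Neg.IH) (simp add: Neg.prems)
  then show ?case by simp
next
  case (Conj \<phi> \<psi>)
  have "sat M e \<phi> \<longleftrightarrow> sat M e' \<phi>" by (rule Conj.IH(1)) (simp add: Conj.prems)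
  moreover have "sat M e \<psi> \<longleftrightarrow> sat M e' \<psi>" by (rule Conj.IH(2)) (simp add: Conj.prems)
  ultimately show ?case by simp
next
  case (Ex i \<phi>)
  have "sat M (e(i := a)) \<phi> \<longleftrightarrow> sat M (e'(i := a)) \<phi>" for a
    using Ex.prems by (intro Ex.IH) simp
  then show ?case by simp
qed

lemma finite_fv_term: "finite (fv_term t)"
  by (induction t) auto

lemma finite_fv: "finite (fv \<phi>)"
  by (induction \<phi>) (auto simp: finite_fv_term)

text \<open>
  Bound variables are included: renaming is sound only if it is injective on these, too.
\<close>

fun vars :: "('f, 'r) fo_formula \<Rightarrow> nat set" where
  "vars (Eq s t) = fv_term s \<union> fv_term t"
| "vars (Rel r ts) = (\<Union>t\<in>set ts. fv_term t)"
| "vars (Neg \<phi>) = vars \<phi>"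
| "vars (Conj \<phi> \<psi>) = vars \<phi> \<union> vars \<psi>"
| "vars (Ex i \<phi>) = insert i (vars \<phi>)"

lemma finite_vars: "finite (vars \<phi>)"
  by (induction \<phi>) (auto simp: finite_fv_term)

lemma fv_subset_vars: "fv \<phi> \<subseteq> vars \<phi>"
  by (induction \<phi>) auto

fun rename :: "(nat \<Rightarrow> nat) \<Rightarrow> ('f, 'r) fo_formula \<Rightarrow> ('f, 'r) fo_formula" where
  "rename f (Eq s t) = Eq (subst_term (Var \<circ> f) s) (subst_term (Var \<circ> f) t)"
| "rename f (Rel r ts) = Rel r (map (subst_term (Var \<circ> f)) ts)"
| "rename f (Neg \<phi>) = Neg (rename f \<phi>)"
| "rename f (Conj \<phi> \<psi>) = Conj (rename f \<phi>) (rename f \<psi>)"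
| "rename f (Ex i \<phi>) = Ex (f i) (rename f \<phi>)"

lemma wf_rename: "wf_formula M \<phi> \<Longrightarrow> wf_formula M (rename f \<phi>)"
  by (induction \<phi>) (auto intro!: wf_subst_term)

lemma sat_rename: "inj_on f (vars \<phi>) \<Longrightarrow> sat M e (rename f \<phi>) \<longleftrightarrow> sat M (\<lambda>i. e (f i)) \<phi>"
proof (induction \<phi> arbitrary: e)
  case (Rel r ts)
  show ?case by (simp add: eval_subst_term o_def)
next
  case (Conj \<phi> \<psi>)
  then show ?case by (simp add: inj_on_Un)
next
  case (Ex i \<phi>)
  have inj: "inj_on f (vars \<phi>)" using Ex.prems by simp
  have "sat M (\<lambda>k. (e(f i := a)) (f k)) \<phi> \<longleftrightarrow> sat M ((\<lambda>k. e (f k))(i := a)) \<phi>" for a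
  proof (rule sat_cong)
    fix k assume "k \<in> fv \<phi>"
    then have "k \<in> vars \<phi>" using fv_subset_vars by blast
    then have "f k = f i \<longleftrightarrow> k = i" using Ex.prems by (auto simp: inj_on_def)
    then show "(e(f i := a)) (f k) = ((\<lambda>k. e (f k))(i := a)) k" by simp
  qed
  then show ?case using Ex.IH[OF inj] by simp
qed (simp_all add: eval_subst_term)

text \<open>
  A pair of functions, or of predicates, on environments that one term, or one formula, defines in two
  structures. With equal structures this is definability; for a structure and an extension of it, it is
  what elementarity transfers. Working with predicates instead of formulas makes the closure rules below
  usable as introduction rules.
\<close>

definition same_term where
  "same_term M M' f f' \<longleftrightarrow> (\<exists>t. wf_term M t \<and> f = (\<lambda>e. eval M e t) \<and> f' = (\<lambda>e. eval M' e t))"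

definition same_formula where
  "same_formula M M' P P' \<longleftrightarrow> (\<exists>\<phi>. wf_formula M \<phi> \<and> P = (\<lambda>e. sat M e \<phi>) \<and> P' = (\<lambda>e. sat M' e \<phi>))"

lemma same_termI: "wf_term M t \<Longrightarrow> same_term M M' (\<lambda>e. eval M e t) (\<lambda>e. eval M' e t)"
  unfolding same_term_def by blast

lemma same_formulaI: "wf_formula M \<phi> \<Longrightarrow> same_formula M M' (\<lambda>e. sat M e \<phi>) (\<lambda>e. sat M' e \<phi>)"
  unfolding same_formula_def by blast

lemma term_var: "same_term M M' (\<lambda>e. e i) (\<lambda>e. e i)"
  using same_termI[of M "Var i" M'] by simp

lemma term_app:
  assumes "fn_arity M g = Some k" and "\<And>i. i < k \<Longrightarrow> same_term M M' (f i) (f' i)"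
  shows "same_term M M' (\<lambda>e. fn_int M g (map (\<lambda>i. f i e) [0..<k])) (\<lambda>e. fn_int M' g (map (\<lambda>i. f' i e) [0..<k]))"
proof -
  obtain T where "\<And>i. i < k \<Longrightarrow> wf_term M (T i) \<and> f i = (\<lambda>e. eval M e (T i)) \<and> f' i = (\<lambda>e. eval M' e (T i))"
    using assms(2) unfolding same_term_def by metis
  then have T: "wf_term M (App g (map T [0..<k]))"
    "(\<lambda>e. fn_int M g (map (\<lambda>i. f i e) [0..<k])) = (\<lambda>e. eval M e (App g (map T [0..<k])))"
    "(\<lambda>e. fn_int M' g (map (\<lambda>i. f' i e) [0..<k])) = (\<lambda>e. eval M' e (App g (map T [0..<k])))"
    using assms(1) by (auto intro!: ext arg_cong[where f = "fn_int _ g"])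
  show ?thesis unfolding T(2,3) by (rule same_termI[OF T(1)])
qed

lemma term_subst:
  assumes "same_term M M' f f'" and "\<And>i. same_term M M' (t i) (t' i)"
  shows "same_term M M' (\<lambda>e. f (\<lambda>i. t i e)) (\<lambda>e. f' (\<lambda>i. t' i e))"
proof -
  obtain T where T: "\<And>i. wf_term M (T i) \<and> t i = (\<lambda>e. eval M e (T i)) \<and> t' i = (\<lambda>e. eval M' e (T i))"
    using assms(2) unfolding same_term_def by metis
  obtain s where s: "wf_term M s" "f = (\<lambda>e. eval M e s)" "f' = (\<lambda>e. eval M' e s)"
    using assms(1) unfolding same_term_def by auto
  have eq: "(\<lambda>e. f (\<lambda>i. t i e)) = (\<lambda>e. eval M e (subst_term T s))"
    "(\<lambda>e. f' (\<lambda>i. t' i e)) = (\<lambda>e. eval M' e (subst_term T s))"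
    using T by (simp_all add: s eval_subst_term)
  show ?thesis unfolding eq using T s(1) by (intro same_termI wf_subst_term) auto
qed

lemma term_shift: "same_term M M' f f' \<Longrightarrow> same_term M M' (\<lambda>e. f (\<lambda>i. e (s i))) (\<lambda>e. f' (\<lambda>i. e (s i)))"
  by (rule term_subst[where t = "\<lambda>i e. e (s i)" and t' = "\<lambda>i e. e (s i)"]) (assumption, rule term_var)

lemma term_case_nat:
  assumes "same_term M M' f f'" "\<And>i. same_term M M' (\<lambda>e. g e i) (\<lambda>e. g' e i)"
  shows "same_term M M' (\<lambda>e. case_nat (f e) (g e) i) (\<lambda>e. case_nat (f' e) (g' e) i)"
  by (cases i) (simp_all add: assms(1) assms(2))

lemma term_fun_upd:
  assumes "same_term M M' f f'" "\<And>i. same_term M M' (\<lambda>e. g e i) (\<lambda>e. g' e i)"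
  shows "same_term M M' (\<lambda>e. ((g e)(k := f e)) i) (\<lambda>e. ((g' e)(k := f' e)) i)"
  by (cases "i = k") (simp_all add: assms(1) assms(2))

lemma term_if:
  assumes "same_term M M' f f'" "same_term M M' g g'"
  shows "same_term M M' (\<lambda>e. if b then f e else g e) (\<lambda>e. if b then f' e else g' e)"
  by (cases b) (simp_all add: assms(1) assms(2))

lemma formula_eq:
  assumes "same_term M M' s s'" "same_term M M' t t'"
  shows "same_formula M M' (\<lambda>e. s e = t e) (\<lambda>e. s' e = t' e)"
proof -
  from assms obtain S T where "wf_term M S" "s = (\<lambda>e. eval M e S)" "s' = (\<lambda>e. eval M' e S)"
    "wf_term M T" "t = (\<lambda>e. eval M e T)" "t' = (\<lambda>e. eval M' e T)" unfolding same_term_def by auto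
  then show ?thesis using same_formulaI[of M "Eq S T" M'] by simp
qed

lemma formula_rel:
  assumes "rel_arity M r = Some k" and "\<And>i. i < k \<Longrightarrow> same_term M M' (f i) (f' i)"
  shows "same_formula M M' (\<lambda>e. rel_int M r (map (\<lambda>i. f i e) [0..<k])) (\<lambda>e. rel_int M' r (map (\<lambda>i. f' i e) [0..<k]))"
proof -
  obtain T where "\<And>i. i < k \<Longrightarrow> wf_term M (T i) \<and> f i = (\<lambda>e. eval M e (T i)) \<and> f' i = (\<lambda>e. eval M' e (T i))"
    using assms(2) unfolding same_term_def by metis
  then have T: "wf_formula M (Rel r (map T [0..<k]))"
    "(\<lambda>e. rel_int M r (map (\<lambda>i. f i e) [0..<k])) = (\<lambda>e. sat M e (Rel r (map T [0..<k])))"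
    "(\<lambda>e. rel_int M' r (map (\<lambda>i. f' i e) [0..<k])) = (\<lambda>e. sat M' e (Rel r (map T [0..<k])))"
    using assms(1) by (auto intro!: ext arg_cong[where f = "rel_int _ r"])
  show ?thesis unfolding T(2,3) by (rule same_formulaI[OF T(1)])
qed

lemma formula_not: "same_formula M M' P P' \<Longrightarrow> same_formula M M' (\<lambda>e. \<not> P e) (\<lambda>e. \<not> P' e)"
  unfolding same_formula_def by (metis sat.simps(3) wf_formula.simps(3))

lemma formula_conj:
  assumes "same_formula M M' P P'" "same_formula M M' Q Q'"
  shows "same_formula M M' (\<lambda>e. P e \<and> Q e) (\<lambda>e. P' e \<and> Q' e)"
proof -
  from assms obtain \<phi> \<psi> where "wf_formula M \<phi>" "P = (\<lambda>e. sat M e \<phi>)" "P' = (\<lambda>e. sat M' e \<phi>)"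
    "wf_formula M \<psi>" "Q = (\<lambda>e. sat M e \<psi>)" "Q' = (\<lambda>e. sat M' e \<psi>)" unfolding same_formula_def by auto
  then show ?thesis using same_formulaI[of M "Conj \<phi> \<psi>" M'] by simp
qed

lemma formula_disj: "same_formula M M' P P' \<Longrightarrow> same_formula M M' Q Q' \<Longrightarrow> same_formula M M' (\<lambda>e. P e \<or> Q e) (\<lambda>e. P' e \<or> Q' e)"
  using formula_not[OF formula_conj[OF formula_not formula_not]] by simp

lemma formula_imp: "same_formula M M' P P' \<Longrightarrow> same_formula M M' Q Q' \<Longrightarrow> same_formula M M' (\<lambda>e. P e \<longrightarrow> Q e) (\<lambda>e. P' e \<longrightarrow> Q' e)"
  unfolding imp_conv_disj by (intro formula_disj formula_not)

lemma formula_iff: "same_formula M M' P P' \<Longrightarrow> same_formula M M' Q Q' \<Longrightarrow> same_formula M M' (\<lambda>e. P e = Q e) (\<lambda>e. P' e = Q' e)"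
  unfolding iff_conv_conj_imp by (intro formula_conj formula_imp)

lemma formula_const: "same_formula M M' (\<lambda>e. b) (\<lambda>e. b)"
proof -
  have t: "same_formula M M' (\<lambda>e. e 0 = e 0) (\<lambda>e. e 0 = e 0)" by (intro formula_eq term_var)
  show ?thesis using t formula_not[OF t] by (cases b) simp_all
qed

lemma formula_ex_named: "same_formula M M' P P' \<Longrightarrow> same_formula M M' (\<lambda>e. \<exists>x. P (e(i := x))) (\<lambda>e. \<exists>x. P' (e(i := x)))"
proof -
  assume "same_formula M M' P P'"
  then obtain \<phi> where "wf_formula M \<phi>" "P = (\<lambda>e. sat M e \<phi>)" "P' = (\<lambda>e. sat M' e \<phi>)"
    unfolding same_formula_def by auto
  then show ?thesis using same_formulaI[of M "Ex i \<phi>" M'] by simp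
qed

text \<open>
  De Bruijn index 0 becomes the fresh name \<open>m\<close>, and the other indices go down by one.
\<close>

lemma sat_unshift:
  assumes m: "\<And>i. i \<in> vars \<phi> \<Longrightarrow> i < m"
  shows "sat M (e(m := x)) (rename (\<lambda>i. case i of 0 \<Rightarrow> m | Suc j \<Rightarrow> j) \<phi>) \<longleftrightarrow> sat M (case_nat x e) \<phi>"
proof -
  let ?f = "\<lambda>i. case i of 0 \<Rightarrow> m | Suc j \<Rightarrow> j"
  have "inj_on ?f (vars \<phi>)"
  proof (rule inj_onI)
    fix i k assume "i \<in> vars \<phi>" "k \<in> vars \<phi>" "?f i = ?f k"
    moreover have "i < m" "k < m" using m calculation by auto
    ultimately show "i = k" by (auto split: nat.splits)
  qed
  then have "sat M (e(m := x)) (rename ?f \<phi>) \<longleftrightarrow> sat M (\<lambda>i. (e(m := x)) (?f i)) \<phi>"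
    by (rule sat_rename)
  also have "\<dots> \<longleftrightarrow> sat M (case_nat x e) \<phi>"
  proof (rule sat_cong)
    fix i assume "i \<in> fv \<phi>"
    then have "i < m" using m fv_subset_vars by blast
    then show "(e(m := x)) (?f i) = case_nat x e i" by (auto split: nat.splits)
  qed
  finally show ?thesis .
qed

text \<open>
  The bound variable is index 0 in the premise and the other variables move up by one. So the rule matches
  any quantified predicate by higher-order pattern unification.
\<close>

lemma formula_ex:
  assumes "same_formula M M' (\<lambda>e. P (e 0) (\<lambda>i. e (Suc i))) (\<lambda>e. P' (e 0) (\<lambda>i. e (Suc i)))"
  shows "same_formula M M' (\<lambda>e. \<exists>x. P x e) (\<lambda>e. \<exists>x. P' x e)"
proof -
  obtain \<phi> where \<phi>: "wf_formula M \<phi>" and P: "\<And>e. P (e 0) (\<lambda>i. e (Suc i)) \<longleftrightarrow> sat M e \<phi>"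
    and P': "\<And>e. P' (e 0) (\<lambda>i. e (Suc i)) \<longleftrightarrow> sat M' e \<phi>"
    using assms unfolding same_formula_def by meson
  obtain m where m: "\<And>i. i \<in> vars \<phi> \<Longrightarrow> i < m"
    using finite_vars[of \<phi>] finite_nat_set_iff_bounded by meson
  define f where "f i = (case i of 0 \<Rightarrow> m | Suc j \<Rightarrow> j)" for i
  note * = sat_unshift[of \<phi> m M, OF m, folded f_def] sat_unshift[of \<phi> m M', OF m, folded f_def]
  have "P x e \<longleftrightarrow> sat M (case_nat x e) \<phi>" for x e
    using P[of "case_nat x e"] by simp
  moreover have "P' x e \<longleftrightarrow> sat M' (case_nat x e) \<phi>" for x e
    using P'[of "case_nat x e"] by simp
  ultimately have "(\<lambda>e. \<exists>x. P x e) = (\<lambda>e. sat M e (Ex m (rename f \<phi>)))"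
    "(\<lambda>e. \<exists>x. P' x e) = (\<lambda>e. sat M' e (Ex m (rename f \<phi>)))"
    using * by simp_all
  then show ?thesis using \<phi> same_formulaI[of M "Ex m (rename f \<phi>)" M'] by (simp add: wf_rename)
qed

lemma formula_all:
  assumes "same_formula M M' (\<lambda>e. P (e 0) (\<lambda>i. e (Suc i))) (\<lambda>e. P' (e 0) (\<lambda>i. e (Suc i)))"
  shows "same_formula M M' (\<lambda>e. \<forall>x. P x e) (\<lambda>e. \<forall>x. P' x e)"
proof -
  have "same_formula M M' (\<lambda>e. \<exists>x. \<not> P x e) (\<lambda>e. \<exists>x. \<not> P' x e)"
    by (rule formula_ex) (rule formula_not[OF assms])
  from formula_not[OF this] show ?thesis by simp
qed

lemma map_conv_nth: "map f ts = map (\<lambda>i. f (ts ! i)) [0..<length ts]"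
  by (rule nth_equalityI) auto

lemma term_eval_subst:
  assumes "wf_term M s" "\<And>i. same_term M M' (t i) (t' i)"
  shows "same_term M M' (\<lambda>e. eval M (\<lambda>k. t k e) s) (\<lambda>e. eval M' (\<lambda>k. t' k e) s)"
  by (rule term_subst[where f = "\<lambda>e. eval M e s" and f' = "\<lambda>e. eval M' e s",
        OF same_termI[OF assms(1)] assms(2)])

text \<open>
  The quantifier case renames through \<open>formula_ex\<close> before it substitutes, hence no variable
  is captured.
\<close>

lemma formula_sat_subst:
  assumes "wf_formula M \<phi>" "\<And>i. same_term M M' (t i) (t' i)"
  shows "same_formula M M' (\<lambda>e. sat M (\<lambda>i. t i e) \<phi>) (\<lambda>e. sat M' (\<lambda>i. t' i e) \<phi>)"
  using assms
proof (induction \<phi> arbitrary: t t')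
  case (Eq s u)
  have "wf_term M s" "wf_term M u" using Eq.prems(1) by simp_all
  show ?case unfolding sat.simps
    by (intro formula_eq term_eval_subst) (fact \<open>wf_term M s\<close> \<open>wf_term M u\<close> Eq.prems(2))+
next
  case (Rel r ts)
  have arity: "rel_arity M r = Some (length ts)" using Rel.prems(1) by simp
  have "same_formula M M' (\<lambda>e. rel_int M r (map (\<lambda>i. eval M (\<lambda>k. t k e) (ts ! i)) [0..<length ts]))
      (\<lambda>e. rel_int M' r (map (\<lambda>i. eval M' (\<lambda>k. t' k e) (ts ! i)) [0..<length ts]))"
  proof (rule formula_rel[OF arity, where f = "\<lambda>i e. eval M (\<lambda>k. t k e) (ts ! i)"
          and f' = "\<lambda>i e. eval M' (\<lambda>k. t' k e) (ts ! i)"])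
    fix i assume "i < length ts"
    then have "wf_term M (ts ! i)" using Rel.prems(1) by simp
    then show "same_term M M' (\<lambda>e. eval M (\<lambda>k. t k e) (ts ! i)) (\<lambda>e. eval M' (\<lambda>k. t' k e) (ts ! i))"
      by (rule term_eval_subst) (rule Rel.prems(2))
  qed
  then show ?case unfolding sat.simps map_conv_nth[of _ ts] .
next
  case (Neg \<phi>)
  have "wf_formula M \<phi>" using Neg.prems(1) by simp
  then show ?case unfolding sat.simps by (intro formula_not Neg.IH Neg.prems(2))
next
  case (Conj \<phi> \<psi>)
  have "wf_formula M \<phi>" "wf_formula M \<psi>" using Conj.prems(1) by simp_all
  then show ?case unfolding sat.simps by (intro formula_conj Conj.IH Conj.prems(2))
next
  case (Ex k \<phi>)
  have "wf_formula M \<phi>" using Ex.prems(1) by simp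
  moreover have "same_term M M' (\<lambda>e. ((\<lambda>j. t j (\<lambda>i. e (Suc i)))(k := e 0)) j)
      (\<lambda>e. ((\<lambda>j. t' j (\<lambda>i. e (Suc i)))(k := e 0)) j)" for j
    by (rule term_fun_upd, rule term_var, rule term_shift, rule Ex.prems(2))
  ultimately have "same_formula M M' (\<lambda>e. sat M (\<lambda>j. ((\<lambda>j. t j (\<lambda>i. e (Suc i)))(k := e 0)) j) \<phi>)
    (\<lambda>e. sat M' (\<lambda>j. ((\<lambda>j. t' j (\<lambda>i. e (Suc i)))(k := e 0)) j) \<phi>)"
    by (rule Ex.IH[where t = "\<lambda>j e. ((\<lambda>j. t j (\<lambda>i. e (Suc i)))(k := e 0)) j"
          and t' = "\<lambda>j e. ((\<lambda>j. t' j (\<lambda>i. e (Suc i)))(k := e 0)) j"])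
  then have "same_formula M M' (\<lambda>e. \<exists>x. sat M ((\<lambda>j. t j e)(k := x)) \<phi>)
    (\<lambda>e. \<exists>x. sat M' ((\<lambda>j. t' j e)(k := x)) \<phi>)"
    by (rule formula_ex[where P = "\<lambda>x e. sat M ((\<lambda>j. t j e)(k := x)) \<phi>"
          and P' = "\<lambda>x e. sat M' ((\<lambda>j. t' j e)(k := x)) \<phi>"])
  then show ?case unfolding sat.simps .
qed

lemma formula_subst:
  assumes "same_formula M M' P P'" and t: "\<And>i. same_term M M' (t i) (t' i)"
  shows "same_formula M M' (\<lambda>e. P (\<lambda>i. t i e)) (\<lambda>e. P' (\<lambda>i. t' i e))"
proof -
  obtain \<phi> where \<phi>: "wf_formula M \<phi>" and P: "P = (\<lambda>e. sat M e \<phi>)" "P' = (\<lambda>e. sat M' e \<phi>)"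
    using assms(1) unfolding same_formula_def by auto
  show ?thesis unfolding P by (rule formula_sat_subst[OF \<phi> t])
qed

lemma formula_bounded:
  assumes "same_formula M M' P P'"
  shows "\<exists>m. (\<forall>e e'. (\<forall>i<m. e i = e' i) \<longrightarrow> P e = P e') \<and> (\<forall>e e'. (\<forall>i<m. e i = e' i) \<longrightarrow> P' e = P' e')"
proof -
  obtain \<phi> where \<phi>: "P = (\<lambda>e. sat M e \<phi>)" "P' = (\<lambda>e. sat M' e \<phi>)"
    using assms unfolding same_formula_def by auto
  obtain m where m: "\<And>i. i \<in> fv \<phi> \<Longrightarrow> i < m"
    using finite_fv[of \<phi>] finite_nat_set_iff_bounded by meson
  then show ?thesis unfolding \<phi> by (intro exI[of _ m] conjI allI impI sat_cong) simp_all
qed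

lemma formula_ball: "finite I \<Longrightarrow> (\<And>i. i \<in> I \<Longrightarrow> same_formula M M' (P i) (P' i)) \<Longrightarrow>
    same_formula M M' (\<lambda>e. \<forall>i\<in>I. P i e) (\<lambda>e. \<forall>i\<in>I. P' i e)"
  by (induction I rule: finite_induct) (auto intro: formula_const formula_conj)

lemma ex_agree_from:
  "(\<exists>x e'. (\<forall>i\<ge>k. e' i = (e(k := x)) i) \<and> Q e') \<longleftrightarrow> (\<exists>e'. (\<forall>i\<ge>Suc k. e' i = e i) \<and> Q e')"
proof
  assume "\<exists>e'. (\<forall>i\<ge>Suc k. e' i = e i) \<and> Q e'"
  then obtain e' where e': "\<forall>i\<ge>Suc k. e' i = e i" "Q e'" by blast
  have "e' i = (e(k := e' k)) i" if "i \<ge> k" for i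
    using e'(1) that by (cases "i = k") auto
  then show "\<exists>x e'. (\<forall>i\<ge>k. e' i = (e(k := x)) i) \<and> Q e'" using e'(2) by blast
next
  assume "\<exists>x e'. (\<forall>i\<ge>k. e' i = (e(k := x)) i) \<and> Q e'"
  then obtain x e' where "\<forall>i\<ge>k. e' i = (e(k := x)) i" "Q e'" by blast
  then show "\<exists>e'. (\<forall>i\<ge>Suc k. e' i = e i) \<and> Q e'" by (intro exI[of _ e']) auto
qed

lemma ex_agree_all: "(\<exists>e'. (\<forall>i. e' i = e i) \<and> Q e') \<longleftrightarrow> Q e"
  by (auto simp flip: fun_eq_iff)

lemma ex_agree_above:
  assumes "\<forall>e e'. (\<forall>i<m. e i = e' i) \<longrightarrow> P e = P e'"
  shows "(\<exists>e'. (\<forall>i\<ge>m. e' i = c) \<and> P (case_nat (e' m) e')) \<longleftrightarrow> (\<exists>e'. P (case_nat c e'))"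
proof
  assume "\<exists>e'. P (case_nat c e')"
  then obtain e' where "P (case_nat c e')" by blast
  moreover have "P (case_nat c e') \<longleftrightarrow> P (case_nat c (\<lambda>i. if i < m then e' i else c))"
    by (rule assms[rule_format]) (auto split: nat.splits)
  ultimately show "\<exists>e'. (\<forall>i\<ge>m. e' i = c) \<and> P (case_nat (e' m) e')"
    by (intro exI[of _ "\<lambda>i. if i < m then e' i else c"]) simp
qed auto

text \<open>
  A formula has finitely many variables, so quantifying over the entire environment except for variable 0
  amounts to a finite block of quantifiers.
\<close>

lemma formula_ex_env:
  assumes "same_formula M M' P P'"
  shows "same_formula M M' (\<lambda>e. \<exists>e'. P (case_nat (e 0) e')) (\<lambda>e. \<exists>e'. P' (case_nat (e 0) e'))"
proof -
  obtain m where m: "\<forall>e e'. (\<forall>i<m. e i = e' i) \<longrightarrow> P e = P e'"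
    "\<forall>e e'. (\<forall>i<m. e i = e' i) \<longrightarrow> P' e = P' e'"
    using formula_bounded[OF assms] by auto
  \<comment> \<open>Variable 0 is moved out of the way to position \<open>m\<close>; then all variables below \<open>m\<close> are
    quantified, one by one.\<close>
  define Q where "Q k e = (\<exists>e'. (\<forall>i\<ge>k. e' i = e i) \<and> P (case_nat (e' m) e'))" for k e
  define Q' where "Q' k e = (\<exists>e'. (\<forall>i\<ge>k. e' i = e i) \<and> P' (case_nat (e' m) e'))" for k e
  have "same_formula M M' (Q k) (Q' k)" for k
  proof (induction k)
    case 0
    have "same_formula M M' (\<lambda>e. P (\<lambda>i. case_nat (e m) e i)) (\<lambda>e. P' (\<lambda>i. case_nat (e m) e i))"
      by (rule formula_subst[OF assms]) (intro term_case_nat term_var)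
    moreover have "Q 0 e = P (\<lambda>i. case_nat (e m) e i)" "Q' 0 e' = P' (\<lambda>i. case_nat (e' m) e' i)" for e e'
      unfolding Q_def Q'_def by (simp_all add: ex_agree_all)
    ultimately show ?case by presburger
  next
    case (Suc k)
    have "Q (Suc k) e = (\<exists>x. Q k (e(k := x)))" "Q' (Suc k) e' = (\<exists>x. Q' k (e'(k := x)))" for e e'
      unfolding Q_def Q'_def ex_agree_from by (rule refl)+
    then show ?case using formula_ex_named[OF Suc, of k] by presburger
  qed
  then have "same_formula M M' (\<lambda>e. Q m (\<lambda>i. e 0)) (\<lambda>e. Q' m (\<lambda>i. e 0))"
    by (rule formula_subst) (rule term_var)
  then show ?thesis
    unfolding Q_def Q'_def ex_agree_above[of m P, OF m(1)] ex_agree_above[of m P', OF m(2)] .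
qed

section \<open>Interpretations and parameters\<close>

text \<open>
  The symbols of \<open>A\<close> are definable in \<open>B\<close>, function symbols through their
  graphs, and the same formulas define the symbols of \<open>A'\<close> in \<open>B'\<close>.
\<close>

definition interprets where
  "interprets A A' B B' \<longleftrightarrow>
     (\<forall>f k. fn_arity A f = Some k \<longrightarrow>
        same_formula B B' (\<lambda>e. e 0 = fn_int A f (map (\<lambda>i. e (Suc i)) [0..<k]))
                 (\<lambda>e. e 0 = fn_int A' f (map (\<lambda>i. e (Suc i)) [0..<k]))) \<and>
     (\<forall>r k. rel_arity A r = Some k \<longrightarrow>
        same_formula B B' (\<lambda>e. rel_int A r (map (\<lambda>i. e i) [0..<k])) (\<lambda>e. rel_int A' r (map (\<lambda>i. e i) [0..<k])))"

lemma case_nat_eta: "case_nat (e 0) (\<lambda>i. e (Suc i)) = e"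
  by (rule ext) (simp split: nat.split)

lemma case_nat_nth:
  "case_nat (f t) (\<lambda>i. if i < length ts then f (ts ! i) else e (i - length ts)) =
     (\<lambda>i. if i < Suc (length ts) then f ((t # ts) ! i) else e (i - Suc (length ts)))"
  by (rule ext) (simp split: nat.split)

text \<open>
  Values of terms are only given by their graphs. They are fed into \<open>R\<close> one by one, each
  through a quantified variable; the values occupy the first indices of the environment.
\<close>

lemma formula_eval_list:
  assumes "\<And>t. t \<in> set ts \<Longrightarrow>
      same_formula B B' (\<lambda>e. e 0 = eval A (\<lambda>i. e (Suc i)) t) (\<lambda>e. e 0 = eval A' (\<lambda>i. e (Suc i)) t)"
    and "same_formula B B' R R'"
  shows "same_formula B B'
      (\<lambda>e. R (\<lambda>i. if i < length ts then eval A (\<lambda>j. e (Suc j)) (ts ! i) else e (i - length ts)))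
      (\<lambda>e. R' (\<lambda>i. if i < length ts then eval A' (\<lambda>j. e (Suc j)) (ts ! i) else e (i - length ts)))"
  using assms
proof (induction ts arbitrary: R R')
  case Nil
  then show ?case by simp
next
  case (Cons t ts)
  define R1 where "R1 e = (\<exists>y. y = eval A (\<lambda>j. e (length ts + Suc j)) t \<and> R (case_nat y e))" for e
  define R1' where "R1' e = (\<exists>y. y = eval A' (\<lambda>j. e (length ts + Suc j)) t \<and> R' (case_nat y e))" for e
  have graph: "same_formula B B' (\<lambda>e. e 0 = eval A (\<lambda>i. e (Suc i)) t) (\<lambda>e. e 0 = eval A' (\<lambda>i. e (Suc i)) t)"
    by (rule Cons.prems(1)) simp
  have "same_formula B B' (\<lambda>e. e 0 = eval A (\<lambda>j. e (Suc (length ts + Suc j))) t)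
      (\<lambda>e. e 0 = eval A' (\<lambda>j. e (Suc (length ts + Suc j))) t)"
    using formula_subst[OF graph, where t = "\<lambda>i e. case_nat (e 0) (\<lambda>j. e (Suc (length ts + Suc j))) i"
        and t' = "\<lambda>i e. case_nat (e 0) (\<lambda>j. e (Suc (length ts + Suc j))) i", OF term_case_nat,
        OF term_var term_var] unfolding nat.case .
  from formula_conj[OF this Cons.prems(2)] have "same_formula B B' R1 R1'"
    unfolding R1_def[abs_def] R1'_def[abs_def] by (intro formula_ex) (simp only: case_nat_eta)
  then have "same_formula B B'
      (\<lambda>e. R1 (\<lambda>i. if i < length ts then eval A (\<lambda>j. e (Suc j)) (ts ! i) else e (i - length ts)))
      (\<lambda>e. R1' (\<lambda>i. if i < length ts then eval A' (\<lambda>j. e (Suc j)) (ts ! i) else e (i - length ts)))"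
    by (intro Cons.IH Cons.prems(1)) simp_all
  then show ?case unfolding R1_def R1'_def by (simp add: case_nat_nth cong: if_cong)
qed

lemma map_if_nth:
  "map (\<lambda>i. if i < length ts then eval M e (ts ! i) else e' i) [0..<length ts] = map (eval M e) ts"
  by (rule nth_equalityI) simp_all

lemma interprets_graph:
  assumes "interprets A A' B B'" "wf_term A t"
  shows "same_formula B B' (\<lambda>e. e 0 = eval A (\<lambda>i. e (Suc i)) t) (\<lambda>e. e 0 = eval A' (\<lambda>i. e (Suc i)) t)"
  using assms(2)
proof (induction t)
  case (Var i)
  show ?case unfolding eval.simps by (intro formula_eq term_var)
next
  case (App f ts)
  let ?k = "length ts"
  have "fn_arity A f = Some ?k" using App.prems by simp
  then have "same_formula B B' (\<lambda>e. e 0 = fn_int A f (map (\<lambda>i. e (Suc i)) [0..<?k]))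
      (\<lambda>e. e 0 = fn_int A' f (map (\<lambda>i. e (Suc i)) [0..<?k]))"
    using assms(1) unfolding interprets_def by blast
  from formula_subst[OF this, where t = "\<lambda>i e. case_nat (e ?k) (\<lambda>j. e j) i"
        and t' = "\<lambda>i e. case_nat (e ?k) (\<lambda>j. e j) i", OF term_case_nat, OF term_var term_var]
  have *: "same_formula B B' (\<lambda>e. e ?k = fn_int A f (map (\<lambda>i. e i) [0..<?k]))
      (\<lambda>e. e ?k = fn_int A' f (map (\<lambda>i. e i) [0..<?k]))"
    unfolding nat.case .
  have "same_formula B B' (\<lambda>e. e 0 = eval A (\<lambda>i. e (Suc i)) t) (\<lambda>e. e 0 = eval A' (\<lambda>i. e (Suc i)) t)"
    if "t \<in> set ts" for t
    using App.IH[OF that] App.prems that by simp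
  from formula_eval_list[of ts, OF this *] show ?case
    by (simp add: map_if_nth)
qed

lemma interprets_formula:
  assumes "interprets A A' B B'" "same_formula A A' P P'"
  shows "same_formula B B' P P'"
proof -
  obtain \<phi> where "wf_formula A \<phi>" and P: "P = (\<lambda>e. sat A e \<phi>)" "P' = (\<lambda>e. sat A' e \<phi>)"
    using assms(2) unfolding same_formula_def by auto
  from this(1) show ?thesis unfolding P
  proof (induction \<phi>)
    case (Eq s t)
    have wf: "wf_term A s" "wf_term A t" using Eq by simp_all
    have "same_formula B B' (\<lambda>e. \<exists>y. y = eval A e s \<and> y = eval A e t) (\<lambda>e. \<exists>y. y = eval A' e s \<and> y = eval A' e t)"
      by (intro formula_ex formula_conj interprets_graph[OF assms(1)] wf)
    then show ?case by simp
  next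
    case (Rel r ts)
    let ?k = "length ts"
    have "rel_arity A r = Some ?k" using Rel by simp
    then have *: "same_formula B B' (\<lambda>e. rel_int A r (map (\<lambda>i. e i) [0..<?k])) (\<lambda>e. rel_int A' r (map (\<lambda>i. e i) [0..<?k]))"
      using assms(1) unfolding interprets_def by blast
    have "same_formula B B' (\<lambda>e. e 0 = eval A (\<lambda>i. e (Suc i)) t) (\<lambda>e. e 0 = eval A' (\<lambda>i. e (Suc i)) t)"
      if "t \<in> set ts" for t
      using interprets_graph[OF assms(1)] Rel that by simp
    from formula_eval_list[of ts, OF this *]
    have "same_formula B B' (\<lambda>e. rel_int A r (map (eval A (\<lambda>i. e (Suc i))) ts))
        (\<lambda>e. rel_int A' r (map (eval A' (\<lambda>i. e (Suc i))) ts))"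
      by (simp add: map_if_nth)
    from formula_subst[OF this, where t = "\<lambda>i e. e (i - 1)" and t' = "\<lambda>i e. e (i - 1)", OF term_var]
    show ?case by simp
  next
    case (Neg \<phi>)
    then show ?case by (simp add: formula_not)
  next
    case (Conj \<phi> \<psi>)
    then show ?case by (simp add: formula_conj)
  next
    case (Ex i \<phi>)
    then have "same_formula B B' (\<lambda>e. sat A e \<phi>) (\<lambda>e. sat A' e \<phi>)" by simp
    from formula_ex_named[OF this] show ?case by simp
  qed
qed

text \<open>
  Naming the elements of the universe turns parameters into terms. In an extension along \<open>j\<close>
  the same constants name the images, so \<open>\<kappa> = id\<close> and \<open>\<kappa> = j\<close> are
  the two cases of interest.
\<close>

definition with_constants :: "('c \<Rightarrow> 'a) \<Rightarrow> ('f, 'r, 'a) fo_struct \<Rightarrow> ('f + 'c, 'r, 'a) fo_struct" where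
  "with_constants \<kappa> M = \<lparr>fn_arity = case_sum (fn_arity M) (\<lambda>_. Some 0), rel_arity = rel_arity M,
     fn_int = case_sum (fn_int M) (\<lambda>c _. \<kappa> c), rel_int = rel_int M\<rparr>"

definition with_plus :: "('f, 'r, 'a::plus) fo_struct \<Rightarrow> ('f option, 'r, 'a) fo_struct" where
  "with_plus M = \<lparr>fn_arity = case_option (Some 2) (fn_arity M), rel_arity = rel_arity M,
     fn_int = case_option (\<lambda>as. as ! 0 + as ! 1) (fn_int M), rel_int = rel_int M\<rparr>"

abbreviation enriched :: "('c \<Rightarrow> 'a::plus) \<Rightarrow> ('f, 'r, 'a) fo_struct \<Rightarrow> (('f + 'c) option, 'r, 'a) fo_struct" where
  "enriched \<kappa> M \<equiv> with_plus (with_constants \<kappa> M)"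

lemma with_constants_sel [simp]:
  "fn_arity (with_constants \<kappa> M) (Inl f) = fn_arity M f"
  "fn_arity (with_constants \<kappa> M) (Inr c) = Some 0"
  "rel_arity (with_constants \<kappa> M) = rel_arity M"
  "fn_int (with_constants \<kappa> M) (Inl f) = fn_int M f"
  "fn_int (with_constants \<kappa> M) (Inr c) as = \<kappa> c"
  "rel_int (with_constants \<kappa> M) = rel_int M"
  by (simp_all add: with_constants_def)

lemma with_plus_sel [simp]:
  "fn_arity (with_plus M) (Some f) = fn_arity M f"
  "fn_arity (with_plus M) None = Some 2"
  "rel_arity (with_plus M) = rel_arity M"
  "fn_int (with_plus M) (Some f) = fn_int M f"
  "fn_int (with_plus M) None as = as ! 0 + as ! 1"
  "rel_int (with_plus M) = rel_int M"
  by (simp_all add: with_plus_def)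

lemma term_const: "same_term (enriched \<kappa> M) (enriched \<kappa>' M') (\<lambda>e. \<kappa> c) (\<lambda>e. \<kappa>' c)"
  using same_termI[of "enriched \<kappa> M" "App (Some (Inr c)) []" "enriched \<kappa>' M'"] by simp

lemma term_id: "same_term (enriched id M) (enriched id M') (\<lambda>e. c) (\<lambda>e. c)"
  using term_const[of id M id M' c] by simp

lemma term_plus:
  assumes "same_term (with_plus M) (with_plus M') f f'" "same_term (with_plus M) (with_plus M') g g'"
  shows "same_term (with_plus M) (with_plus M') (\<lambda>e. f e + g e) (\<lambda>e. f' e + g' e)"
proof -
  obtain s t where "wf_term (with_plus M) s" "f = (\<lambda>e. eval (with_plus M) e s)" "f' = (\<lambda>e. eval (with_plus M') e s)"
    "wf_term (with_plus M) t" "g = (\<lambda>e. eval (with_plus M) e t)" "g' = (\<lambda>e. eval (with_plus M') e t)"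
    using assms unfolding same_term_def by auto
  then show ?thesis using same_termI[of "with_plus M" "App None [s, t]" "with_plus M'"] by simp
qed

lemma term_mult:
  assumes plus: "\<And>f f' g g'. same_term M M' f f' \<Longrightarrow> same_term M M' g g' \<Longrightarrow> same_term M M' (\<lambda>e. f e + g e) (\<lambda>e. f' e + g' e)"
    and f: "same_term M M' f f'" and "1 \<le> n"
  shows "same_term M M' (\<lambda>e. int_multiple n (f e)) (\<lambda>e. int_multiple n (f' e))"
  using \<open>1 \<le> n\<close>
proof (induction n rule: int_ge_induct)
  case base
  then show ?case using f by simp
next
  case (step i)
  then show ?case unfolding int_multiple_Suc by (intro plus f)
qed

lemma formula_cgr:
  assumes plus: "\<And>f f' g g'. same_term M M' f f' \<Longrightarrow> same_term M M' g g' \<Longrightarrow> same_term M M' (\<lambda>e. f e + g e) (\<lambda>e. f' e + g' e)"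
    and "1 \<le> n" and s: "same_term M M' s s'" and t: "same_term M M' t t'"
  shows "same_formula M M' (\<lambda>e. cgr n (s e) (t e)) (\<lambda>e. cgr n (s' e) (t' e))"
  unfolding cgr_def
  by (intro formula_ex formula_eq plus term_mult[OF plus term_var \<open>1 \<le> n\<close>] term_shift[OF s, of Suc] term_shift[OF t, of Suc])

fun elim_term :: "('c \<Rightarrow> nat) \<Rightarrow> ('f + 'c) fo_term \<Rightarrow> 'f fo_term" where
  "elim_term h (Var i) = Var i"
| "elim_term h (App f ts) = (case f of Inl f \<Rightarrow> App f (map (elim_term h) ts) | Inr c \<Rightarrow> Var (h c))"

fun elim_constants :: "('c \<Rightarrow> nat) \<Rightarrow> ('f + 'c, 'r) fo_formula \<Rightarrow> ('f, 'r) fo_formula" where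
  "elim_constants h (Eq s t) = Eq (elim_term h s) (elim_term h t)"
| "elim_constants h (Rel r ts) = Rel r (map (elim_term h) ts)"
| "elim_constants h (Neg \<phi>) = Neg (elim_constants h \<phi>)"
| "elim_constants h (Conj \<phi> \<psi>) = Conj (elim_constants h \<phi>) (elim_constants h \<psi>)"
| "elim_constants h (Ex i \<phi>) = Ex i (elim_constants h \<phi>)"

fun term_constants :: "('f + 'c) fo_term \<Rightarrow> 'c set" where
  "term_constants (Var i) = {}"
| "term_constants (App f ts) = (case f of Inl _ \<Rightarrow> {} | Inr c \<Rightarrow> {c}) \<union> (\<Union>t\<in>set ts. term_constants t)"

fun constants :: "('f + 'c, 'r) fo_formula \<Rightarrow> 'c set" where
  "constants (Eq s t) = term_constants s \<union> term_constants t"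
| "constants (Rel r ts) = (\<Union>t\<in>set ts. term_constants t)"
| "constants (Neg \<phi>) = constants \<phi>"
| "constants (Conj \<phi> \<psi>) = constants \<phi> \<union> constants \<psi>"
| "constants (Ex i \<phi>) = constants \<phi>"

lemma finite_term_constants: "finite (term_constants t)"
  by (induction t) (auto split: sum.split)

lemma finite_constants: "finite (constants \<phi>)"
  by (induction \<phi>) (auto simp: finite_term_constants)

lemma wf_elim_term: "wf_term (with_constants \<kappa> M) t \<Longrightarrow> wf_term M (elim_term h t)"
  by (induction t) (auto split: sum.split)

lemma wf_elim_constants: "wf_formula (with_constants \<kappa> M) \<phi> \<Longrightarrow> wf_formula M (elim_constants h \<phi>)"
  by (induction \<phi>) (auto simp: wf_elim_term)

lemma fv_elim_term: "fv_term (elim_term h t) \<subseteq> fv_term t \<union> h ` term_constants t"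
proof (induction t)
  case (App f ts)
  show ?case
  proof (cases f)
    case (Inl g)
    have "(\<Union>t\<in>set ts. fv_term (elim_term h t)) \<subseteq> (\<Union>t\<in>set ts. fv_term t \<union> h ` term_constants t)"
      by (intro UN_mono App.IH subset_refl)
    then show ?thesis by (simp add: Inl image_UN UN_Un_distrib)
  qed simp
qed simp

lemma fv_elim_constants: "fv (elim_constants h \<phi>) \<subseteq> fv \<phi> \<union> h ` constants \<phi>"
proof (induction \<phi>)
  case (Eq s t)
  then show ?case using fv_elim_term[of h s] fv_elim_term[of h t] by auto
next
  case (Rel r ts)
  have "(\<Union>t\<in>set ts. fv_term (elim_term h t)) \<subseteq> (\<Union>t\<in>set ts. fv_term t \<union> h ` term_constants t)"
    by (intro UN_mono fv_elim_term subset_refl)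
  then show ?case by (simp add: image_UN UN_Un_distrib)
qed auto

lemma eval_elim_term:
  "(\<And>i. i \<in> fv_term t \<Longrightarrow> e' i = e i) \<Longrightarrow> (\<And>c. c \<in> term_constants t \<Longrightarrow> e' (h c) = \<kappa> c) \<Longrightarrow>
    eval M e' (elim_term h t) = eval (with_constants \<kappa> M) e t"
proof (induction t)
  case (App f ts)
  show ?case
  proof (cases f)
    case (Inl g)
    have "map (\<lambda>t. eval M e' (elim_term h t)) ts = map (eval (with_constants \<kappa> M) e) ts"
    proof (rule map_cong[OF refl])
      fix t assume t: "t \<in> set ts"
      show "eval M e' (elim_term h t) = eval (with_constants \<kappa> M) e t"
      proof (rule App.IH[OF t])
        show "e' i = e i" if "i \<in> fv_term t" for i using App.prems(1)[of i] t that by auto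
        show "e' (h c) = \<kappa> c" if "c \<in> term_constants t" for c using App.prems(2)[of c] t that by auto
      qed
    qed
    then show ?thesis by (simp add: Inl o_def del: map_eq_conv)
  next
    case (Inr c)
    then show ?thesis using App.prems(2)[of c] by simp
  qed
qed simp

lemma sat_elim_constants:
  "(\<And>i. i \<in> fv \<phi> \<Longrightarrow> e' i = e i) \<Longrightarrow> (\<And>c. c \<in> constants \<phi> \<Longrightarrow> e' (h c) = \<kappa> c \<and> h c \<notin> vars \<phi>) \<Longrightarrow>
    sat M e' (elim_constants h \<phi>) \<longleftrightarrow> sat (with_constants \<kappa> M) e \<phi>"
proof (induction \<phi> arbitrary: e e')
  case (Eq s t)
  have "eval M e' (elim_term h s) = eval (with_constants \<kappa> M) e s"
    "eval M e' (elim_term h t) = eval (with_constants \<kappa> M) e t"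
    by (rule eval_elim_term; simp add: Eq)+
  then show ?case by simp
next
  case (Rel r ts)
  have "map (\<lambda>t. eval M e' (elim_term h t)) ts = map (eval (with_constants \<kappa> M) e) ts"
  proof (rule map_cong[OF refl])
    fix t assume t: "t \<in> set ts"
    show "eval M e' (elim_term h t) = eval (with_constants \<kappa> M) e t"
    proof (rule eval_elim_term)
      show "e' i = e i" if "i \<in> fv_term t" for i using Rel(1)[of i] t that by auto
      show "e' (h c) = \<kappa> c" if "c \<in> term_constants t" for c using Rel(2)[of c] t that by auto
    qed
  qed
  then show ?case by (simp add: o_def del: map_eq_conv)
next
  case (Neg \<phi>)
  have "sat M e' (elim_constants h \<phi>) \<longleftrightarrow> sat (with_constants \<kappa> M) e \<phi>"
    by (rule Neg.IH; use Neg.prems in simp)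
  then show ?case by simp
next
  case (Conj \<phi> \<psi>)
  have "sat M e' (elim_constants h \<phi>) \<longleftrightarrow> sat (with_constants \<kappa> M) e \<phi>"
    "sat M e' (elim_constants h \<psi>) \<longleftrightarrow> sat (with_constants \<kappa> M) e \<psi>"
    using Conj.prems by (intro Conj.IH; simp)+
  then show ?case by simp
next
  case (Ex i \<phi>)
  have "sat M (e'(i := x)) (elim_constants h \<phi>) \<longleftrightarrow> sat (with_constants \<kappa> M) (e(i := x)) \<phi>" for x
  proof (rule Ex.IH)
    show "(e'(i := x)) k = (e(i := x)) k" if "k \<in> fv \<phi>" for k using Ex.prems(1)[of k] that by simp
    show "(e'(i := x)) (h c) = \<kappa> c \<and> h c \<notin> vars \<phi>" if "c \<in> constants \<phi>" for c
      using Ex.prems(2)[of c] that by auto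
  qed
  then show ?case by simp
qed

text \<open>
  Constants are replaced by fresh variables, whose values are appended to the list of parameters.
\<close>

lemma constants_to_parameters:
  fixes \<kappa> :: "'c \<Rightarrow> 'a" and \<kappa>' :: "'c \<Rightarrow> 'b"
  assumes "same_formula (with_constants \<kappa> M) (with_constants \<kappa>' M') P P'"
    and "\<forall>e e'. (\<forall>i<k. e i = e' i) \<longrightarrow> P e = P e'"
    and "\<forall>e e'. (\<forall>i<k. e i = e' i) \<longrightarrow> P' e = P' e'"
  shows "\<exists>\<phi> cs. is_formula M (k + length cs) \<phi> \<and>
     (\<forall>as. length as = k \<longrightarrow> (P (nth as) \<longleftrightarrow> holds M \<phi> (as @ map \<kappa> cs))) \<and>
     (\<forall>as. length as = k \<longrightarrow> (P' (nth as) \<longleftrightarrow> holds M' \<phi> (as @ map \<kappa>' cs)))"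
proof -
  from assms(1) obtain \<phi> where wf: "wf_formula (with_constants \<kappa> M) \<phi>"
    and P: "P = (\<lambda>e. sat (with_constants \<kappa> M) e \<phi>)" "P' = (\<lambda>e. sat (with_constants \<kappa>' M') e \<phi>)"
    unfolding same_formula_def by (elim exE conjE)
  obtain m0 where m0: "\<And>i. i \<in> vars \<phi> \<Longrightarrow> i < m0"
    using finite_vars[of \<phi>] unfolding finite_nat_set_iff_bounded by blast
  define m where "m = max m0 k"
  from finite_list[OF finite_constants[of \<phi>]] obtain ds where ds: "set ds = constants \<phi>" ..
  define idx where "idx c = (LEAST i. i < length ds \<and> ds ! i = c)" for c
  have idx: "idx c < length ds \<and> ds ! idx c = c" if "c \<in> constants \<phi>" for c
  proof -
    have "c \<in> set ds" unfolding ds by (rule that)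
    then have "\<exists>i. i < length ds \<and> ds ! i = c" unfolding in_set_conv_nth .
    then show ?thesis unfolding idx_def by (rule LeastI_ex)
  qed
  define h where "h c = m + idx c" for c
  \<comment> \<open>The parameters in the positions \<open>k, \<dots>, m - 1\<close> are padding: they keep the constants away
    from all variables that occur in \<open>\<phi>\<close>.\<close>
  define cs where "cs = replicate (m - k) undefined @ ds"
  have len: "k + length cs = m + length ds" by (simp add: cs_def m_def)
  have h_notin: "h c \<notin> vars \<phi>" for c using m0[of "h c"] by (auto simp: h_def m_def)
  have const: "(as @ map \<mu> cs) ! h c = \<mu> c" if "c \<in> constants \<phi>" "length as = k"
    for as c and \<mu> :: "'c \<Rightarrow> 'w"
  proof -
    have "h c - length as = (m - k) + idx c" "\<not> h c < length as" using that by (auto simp: h_def m_def)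
    then show ?thesis using idx[OF that(1)] by (simp add: nth_append cs_def)
  qed
  have "fv (elim_constants h \<phi>) \<subseteq> {..<k + length cs}"
  proof
    fix i assume "i \<in> fv (elim_constants h \<phi>)"
    then have "i \<in> fv \<phi> \<or> i \<in> h ` constants \<phi>" using fv_elim_constants[of h \<phi>] by blast
    then consider "i \<in> fv \<phi>" | c where "c \<in> constants \<phi>" "i = h c" by blast
    then show "i \<in> {..<k + length cs}"
    proof cases
      case 1
      then have "i < m0" using m0 fv_subset_vars by blast
      then show ?thesis unfolding len by (simp add: m_def)
    next
      case 2
      then show ?thesis unfolding len using idx[of c] by (simp add: h_def)
    qed
  qed
  then have "is_formula M (k + length cs) (elim_constants h \<phi>)"
    using wf_elim_constants[OF wf] unfolding is_formula_def by blast
  moreover have "P (nth as) \<longleftrightarrow> holds M (elim_constants h \<phi>) (as @ map \<kappa> cs)" if "length as = k" for as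
  proof -
    have "holds M (elim_constants h \<phi>) (as @ map \<kappa> cs) \<longleftrightarrow> P (nth (as @ map \<kappa> cs))"
      unfolding holds_def P by (rule sat_elim_constants) (rule refl, simp only: const[OF _ that] h_notin simp_thms)
    also have "\<dots> \<longleftrightarrow> P (nth as)" using that by (intro assms(2)[rule_format]) (simp only: nth_append if_True)
    finally show ?thesis by (rule sym)
  qed
  moreover have "P' (nth as) \<longleftrightarrow> holds M' (elim_constants h \<phi>) (as @ map \<kappa>' cs)" if "length as = k" for as
  proof -
    have "holds M' (elim_constants h \<phi>) (as @ map \<kappa>' cs) \<longleftrightarrow> P' (nth (as @ map \<kappa>' cs))"
      unfolding holds_def P by (rule sat_elim_constants) (rule refl, simp only: const[OF _ that] h_notin simp_thms)
    also have "\<dots> \<longleftrightarrow> P' (nth as)" using that by (intro assms(3)[rule_format]) (simp only: nth_append if_True)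
    finally show ?thesis by (rule sym)
  qed
  ultimately show ?thesis
    by (intro exI[of _ "elim_constants h \<phi>"] exI[of _ cs] conjI allI impI)
qed

section \<open>Definable sets and the structures of the theorem\<close>

lemma interprets_enriched_self: "interprets M M' (enriched \<kappa> M) (enriched \<kappa>' M')"
  unfolding interprets_def
proof (intro conjI allI impI)
  fix f k assume "fn_arity M f = Some k"
  then have "fn_arity (enriched \<kappa> M) (Some (Inl f)) = Some k" by simp
  from term_app[OF this term_var, where M' = "enriched \<kappa>' M'"]
  have "same_term (enriched \<kappa> M) (enriched \<kappa>' M') (\<lambda>e. fn_int M f (map (\<lambda>i. e (Suc i)) [0..<k]))
     (\<lambda>e. fn_int M' f (map (\<lambda>i. e (Suc i)) [0..<k]))" by simp
  then show "same_formula (enriched \<kappa> M) (enriched \<kappa>' M') (\<lambda>e. e 0 = fn_int M f (map (\<lambda>i. e (Suc i)) [0..<k]))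
     (\<lambda>e. e 0 = fn_int M' f (map (\<lambda>i. e (Suc i)) [0..<k]))"
    by (rule formula_eq[OF term_var])
next
  fix r k assume "rel_arity M r = Some k"
  then have "rel_arity (enriched \<kappa> M) r = Some k" by simp
  from formula_rel[OF this term_var, where M' = "enriched \<kappa>' M'"]
  show "same_formula (enriched \<kappa> M) (enriched \<kappa>' M') (\<lambda>e. rel_int M r (map (\<lambda>i. e i) [0..<k]))
     (\<lambda>e. rel_int M' r (map (\<lambda>i. e i) [0..<k]))" by simp
qed

lemma interprets_with_constants_self: "interprets M M' (with_constants \<kappa> M) (with_constants \<kappa>' M')"
  unfolding interprets_def
proof (intro conjI allI impI)
  fix f k assume "fn_arity M f = Some k"
  then have "fn_arity (with_constants \<kappa> M) (Inl f) = Some k" by simp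
  from term_app[OF this term_var, where M' = "with_constants \<kappa>' M'"]
  have "same_term (with_constants \<kappa> M) (with_constants \<kappa>' M') (\<lambda>e. fn_int M f (map (\<lambda>i. e (Suc i)) [0..<k]))
     (\<lambda>e. fn_int M' f (map (\<lambda>i. e (Suc i)) [0..<k]))" by simp
  then show "same_formula (with_constants \<kappa> M) (with_constants \<kappa>' M') (\<lambda>e. e 0 = fn_int M f (map (\<lambda>i. e (Suc i)) [0..<k]))
     (\<lambda>e. e 0 = fn_int M' f (map (\<lambda>i. e (Suc i)) [0..<k]))"
    by (rule formula_eq[OF term_var])
next
  fix r k assume "rel_arity M r = Some k"
  then have "rel_arity (with_constants \<kappa> M) r = Some k" by simp
  from formula_rel[OF this term_var, where M' = "with_constants \<kappa>' M'"]
  show "same_formula (with_constants \<kappa> M) (with_constants \<kappa>' M') (\<lambda>e. rel_int M r (map (\<lambda>i. e i) [0..<k]))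
     (\<lambda>e. rel_int M' r (map (\<lambda>i. e i) [0..<k]))" by simp
qed

lemma term_with_constants: "same_term (with_constants \<kappa> M) (with_constants \<kappa>' M') (\<lambda>e. \<kappa> c) (\<lambda>e. \<kappa>' c)"
  using same_termI[of "with_constants \<kappa> M" "App (Inr c) []" "with_constants \<kappa>' M'"] by simp

lemma interprets_enriched:
  assumes "interprets M M' B B'" and "\<And>c. same_term B B' (\<lambda>e. \<kappa> c) (\<lambda>e. \<kappa>' c)"
    and plus: "same_formula B B' (\<lambda>e. e 0 = e 1 + e 2) (\<lambda>e. e 0 = e 1 + e 2)"
  shows "interprets (enriched \<kappa> M) (enriched \<kappa>' M') B B'"
  unfolding interprets_def
proof (intro conjI allI impI)
  fix f k assume f: "fn_arity (enriched \<kappa> M) f = Some k"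
  show "same_formula B B' (\<lambda>e. e 0 = fn_int (enriched \<kappa> M) f (map (\<lambda>i. e (Suc i)) [0..<k]))
     (\<lambda>e. e 0 = fn_int (enriched \<kappa>' M') f (map (\<lambda>i. e (Suc i)) [0..<k]))"
  proof (cases f)
    case None
    then have "k = 2" using f by simp
    then show ?thesis using plus by (simp add: None numeral_2_eq_2)
  next
    case (Some g)
    show ?thesis
    proof (cases g)
      case (Inl h)
      then show ?thesis using f assms(1) Some by (simp add: interprets_def)
    next
      case (Inr c)
      show ?thesis unfolding Some Inr with_plus_sel with_constants_sel by (rule formula_eq[OF term_var assms(2)])
    qed
  qed
next
  fix r k assume "rel_arity (enriched \<kappa> M) r = Some k"
  then show "same_formula B B' (\<lambda>e. rel_int (enriched \<kappa> M) r (map (\<lambda>i. e i) [0..<k]))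
     (\<lambda>e. rel_int (enriched \<kappa>' M') r (map (\<lambda>i. e i) [0..<k]))"
    using assms(1) by (simp add: interprets_def)
qed

lemma formula_wf: "interprets M M' B B' \<Longrightarrow> wf_formula M \<phi> \<Longrightarrow> same_formula B B' (\<lambda>e. sat M e \<phi>) (\<lambda>e. sat M' e \<phi>)"
  by (rule interprets_formula[OF _ same_formulaI])

lemma formula_holds:
  assumes "interprets M M' B B'" and const: "\<And>c. same_term B B' (\<lambda>e. \<kappa> c) (\<lambda>e. \<kappa>' c)"
    and \<phi>: "is_formula M (k + length bs) \<phi>"
  shows "same_formula B B' (\<lambda>e. holds M \<phi> (map (\<lambda>i. e i) [0..<k] @ map \<kappa> bs))
     (\<lambda>e. holds M' \<phi> (map (\<lambda>i. e i) [0..<k] @ map \<kappa>' bs))"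
proof -
  have "same_formula B B' (\<lambda>e. sat M e \<phi>) (\<lambda>e. sat M' e \<phi>)"
    using formula_wf[OF assms(1)] \<phi> unfolding is_formula_def by blast
  then have "same_formula B B' (\<lambda>e. sat M (\<lambda>i. (if k \<le> i \<and> i < k + length bs then \<kappa> (bs ! (i - k)) else e i)) \<phi>)
     (\<lambda>e. sat M' (\<lambda>i. (if k \<le> i \<and> i < k + length bs then \<kappa>' (bs ! (i - k)) else e i)) \<phi>)"
    by (rule formula_subst) (intro term_if term_var const)
  moreover have "sat M (\<lambda>i. (if k \<le> i \<and> i < k + length bs then \<kappa> (bs ! (i - k)) else e i)) \<phi> \<longleftrightarrow>
      holds M \<phi> (map (\<lambda>i. e i) [0..<k] @ map \<kappa> bs)" for e
    unfolding holds_def using \<phi> by (intro sat_cong) (auto simp: is_formula_def nth_append)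
  moreover have "sat M' (\<lambda>i. (if k \<le> i \<and> i < k + length bs then \<kappa>' (bs ! (i - k)) else e i)) \<phi> \<longleftrightarrow>
      holds M' \<phi> (map (\<lambda>i. e i) [0..<k] @ map \<kappa>' bs)" for e
    unfolding holds_def using \<phi> by (intro sat_cong) (auto simp: is_formula_def nth_append)
  ultimately show ?thesis by simp
qed

lemma definable_imp_formula:
  assumes "interprets M M B B" and const: "\<And>c. same_term B B (\<lambda>e. c) (\<lambda>e. c)" and "definable M A k X"
  shows "same_formula B B (\<lambda>e. map (\<lambda>i. e i) [0..<k] \<in> X) (\<lambda>e. map (\<lambda>i. e i) [0..<k] \<in> X)"
proof -
  obtain \<phi> bs where \<phi>: "is_formula M (k + length bs) \<phi>" "X = solutions M k \<phi> bs"
    using assms(3) unfolding definable_def by blast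
  have "same_formula B B (\<lambda>e. holds M \<phi> (map (\<lambda>i. e i) [0..<k] @ map id bs))
     (\<lambda>e. holds M \<phi> (map (\<lambda>i. e i) [0..<k] @ map id bs))"
    by (rule formula_holds[OF assms(1) _ \<phi>(1)]) (simp add: const)
  then show ?thesis unfolding \<phi>(2) solutions_def by simp
qed

lemma definable_unary_imp_formula:
  assumes "definable_unary M D"
  shows "same_formula (enriched id M) (enriched id M) (\<lambda>e. e 0 \<in> D) (\<lambda>e. e 0 \<in> D)"
proof -
  have "definable M UNIV 1 ((\<lambda>x. [x]) ` D)" using assms unfolding definable_unary_def .
  from definable_imp_formula[OF interprets_enriched_self term_id this]
  show ?thesis by (simp add: image_iff)
qed

lemma formula_imp_definable_unary_constants:
  fixes M :: "('f, 'r, 'a) fo_struct"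
  assumes "same_formula (with_constants id M) (with_constants id M) (\<lambda>e. e 0 \<in> D) (\<lambda>e. e 0 \<in> D)"
  shows "definable_unary M D"
proof -
  have dep: "\<forall>e e' :: nat \<Rightarrow> 'a. (\<forall>i<1. e i = e' i) \<longrightarrow> (e 0 \<in> D) = (e' 0 \<in> D)"
    by simp
  obtain \<phi> cs where \<phi>: "is_formula M (1 + length cs) \<phi>"
    "\<forall>as. length as = 1 \<longrightarrow> (as ! 0 \<in> D \<longleftrightarrow> holds M \<phi> (as @ map id cs))"
    using constants_to_parameters[OF assms dep dep] by blast
  have "(\<lambda>x. [x]) ` D = solutions M 1 \<phi> cs"
  proof (rule set_eqI)
    fix as :: "'a list"
    show "as \<in> (\<lambda>x. [x]) ` D \<longleftrightarrow> as \<in> solutions M 1 \<phi> cs"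
    proof (cases "length as = 1")
      case True
      then obtain x where "as = [x]" by (auto simp: length_Suc_conv)
      then show ?thesis using \<phi>(2)[rule_format, of "[x]"] by (simp add: solutions_def image_iff)
    qed (auto simp: solutions_def)
  qed
  then show ?thesis using \<phi>(1) unfolding definable_unary_def definable_def by blast
qed

text \<open>
  Addition is definable in \<open>M\<close>, since its graph is definable in the group without parameters.
\<close>

lemma group_plus_formula:
  assumes "expands M (group_struct :: (plus_symbol, less_symbol, 'a::ab_group_add) fo_struct)"
  shows "same_formula (with_constants id M) (with_constants id M) (\<lambda>e. e 0 = e 1 + (e 2 :: 'a)) (\<lambda>e. e 0 = e 1 + e 2)"
proof -
  define \<phi> :: "(plus_symbol, less_symbol) fo_formula" where
    "\<phi> = Eq (Var 0) (App Plus [Var 1, Var 2])"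
  define G :: "(plus_symbol, less_symbol, 'a) fo_struct" where "G = group_struct"
  have "is_formula G 3 \<phi>" by (auto simp: is_formula_def G_def group_struct_def \<phi>_def)
  then have "definable G {} 3 (solutions G 3 \<phi> [])"
    unfolding definable_def by (intro exI[of _ \<phi>] exI[of _ "[]"]) simp
  then have "definable M UNIV 3 (solutions G 3 \<phi> [])"
    using assms unfolding reduct_over_def G_def by blast
  from definable_imp_formula[OF interprets_with_constants_self term_with_constants[of id M id M, simplified] this]
  show ?thesis
    by (simp add: solutions_def holds_def \<phi>_def G_def group_struct_def numeral_2_eq_2)
qed

lemma expands_refl: "expands M M"
proof -
  have "definable M {} k X \<Longrightarrow> definable M UNIV k X" for k X
    unfolding definable_def by blast
  then show ?thesis unfolding reduct_over_def by blast
qed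

lemma formula_imp_definable_unary:
  assumes "expands M (group_struct :: (plus_symbol, less_symbol, 'a::ab_group_add) fo_struct)"
    and "same_formula (enriched id M) (enriched id M) (\<lambda>e. e 0 \<in> D) (\<lambda>e. e 0 \<in> (D :: 'a set))"
  shows "definable_unary M D"
proof (rule formula_imp_definable_unary_constants)
  have "interprets (enriched id M) (enriched id M) (with_constants id M) (with_constants id M)"
    using group_plus_formula[OF assms(1)] term_with_constants[of id M id M]
    by (intro interprets_enriched interprets_with_constants_self) simp_all
  from interprets_formula[OF this assms(2)]
  show "same_formula (with_constants id M) (with_constants id M) (\<lambda>e. e 0 \<in> D) (\<lambda>e. e 0 \<in> D)" .
qed

lemma term_ordered_group_plus:
  fixes f :: "(nat \<Rightarrow> 'a::linordered_ab_group_add) \<Rightarrow> 'a" and f' :: "(nat \<Rightarrow> 'b::linordered_ab_group_add) \<Rightarrow> 'b"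
  assumes "same_term ordered_group_struct ordered_group_struct f f'" "same_term ordered_group_struct ordered_group_struct g g'"
  shows "same_term ordered_group_struct ordered_group_struct (\<lambda>e. f e + g e) (\<lambda>e. f' e + g' e)"
proof -
  obtain s t where st: "wf_term (ordered_group_struct :: (_, _, 'a) fo_struct) s" "f = (\<lambda>e. eval ordered_group_struct e s)" "f' = (\<lambda>e. eval ordered_group_struct e s)"
    "wf_term (ordered_group_struct :: (_, _, 'a) fo_struct) t" "g = (\<lambda>e. eval ordered_group_struct e t)" "g' = (\<lambda>e. eval ordered_group_struct e t)"
    using assms unfolding same_term_def by auto
  then have "wf_term (ordered_group_struct :: (_, _, 'a) fo_struct) (App Plus [s, t])"
    by (simp add: ordered_group_struct_def)
  from same_termI[OF this, of "ordered_group_struct :: (_, _, 'b) fo_struct"] show ?thesis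
    unfolding st by (simp add: ordered_group_struct_def)
qed

lemma formula_ordered_group_less:
  fixes s :: "(nat \<Rightarrow> 'a::linordered_ab_group_add) \<Rightarrow> 'a" and s' :: "(nat \<Rightarrow> 'b::linordered_ab_group_add) \<Rightarrow> 'b"
  assumes "same_term ordered_group_struct ordered_group_struct s s'" "same_term ordered_group_struct ordered_group_struct t t'"
  shows "same_formula ordered_group_struct ordered_group_struct (\<lambda>e. s e < t e) (\<lambda>e. s' e < t' e)"
proof -
  obtain u v where st: "wf_term (ordered_group_struct :: (_, _, 'a) fo_struct) u" "s = (\<lambda>e. eval ordered_group_struct e u)" "s' = (\<lambda>e. eval ordered_group_struct e u)"
    "wf_term (ordered_group_struct :: (_, _, 'a) fo_struct) v" "t = (\<lambda>e. eval ordered_group_struct e v)" "t' = (\<lambda>e. eval ordered_group_struct e v)"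
    using assms unfolding same_term_def by auto
  then have "wf_formula (ordered_group_struct :: (_, _, 'a) fo_struct) (Rel Less [u, v])"
    by (simp add: ordered_group_struct_def)
  from same_formulaI[OF this, of "ordered_group_struct :: (_, _, 'b) fo_struct"] show ?thesis
    unfolding st by (simp add: ordered_group_struct_def)
qed

text \<open>
  A formula with constant truth value keeps this value when all its free variables are quantified, and
  then it is a sentence.
\<close>

lemma sentence_transfer:
  assumes "elementarily_equivalent M M'" "same_formula M M' (\<lambda>e. S) (\<lambda>e. S')"
  shows "S \<longleftrightarrow> S'"
proof -
  from assms(2) obtain \<phi> where \<phi>: "wf_formula M \<phi>" "\<And>e. S = sat M e \<phi>" "\<And>e. S' = sat M' e \<phi>"
    unfolding same_formula_def by (metis (no_types, lifting))
  obtain m where m: "\<forall>i\<in>fv \<phi>. i < m"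
    using finite_fv[of \<phi>] unfolding finite_nat_set_iff_bounded by blast
  have wf: "wf_formula M (foldr Ex is \<phi>)" and fv: "fv (foldr Ex is \<phi>) = fv \<phi> - set is" for "is"
    using \<phi>(1) by (induction "is") auto
  have S: "sat M e (foldr Ex is \<phi>) \<longleftrightarrow> S" for "is" e
    using \<phi>(2) by (induction "is" arbitrary: e) auto
  have S': "sat M' e (foldr Ex is \<phi>) \<longleftrightarrow> S'" for "is" e
    using \<phi>(3) by (induction "is" arbitrary: e) auto
  have "is_formula M 0 (foldr Ex [0..<m] \<phi>)"
    using wf m unfolding is_formula_def fv by auto
  then have "holds M (foldr Ex [0..<m] \<phi>) [] \<longleftrightarrow> holds M' (foldr Ex [0..<m] \<phi>) []"
    using assms(1) unfolding elementarily_equivalent_def by blast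
  then show ?thesis unfolding holds_def S S' .
qed

lemma elementary_embedding_imp_equivalent:
  "elementary_embedding j M M' \<Longrightarrow> elementarily_equivalent M M'"
  unfolding elementary_embedding_def elementarily_equivalent_def
  by (metis list.map(1) list.size(3))

text \<open>
  Addition and the constants are eliminated, which leaves a formula of the ordered group with parameters;
  the embedding maps these to the parameters on the other side.
\<close>

lemma embedding_transfer:
  fixes N :: "(plus_symbol, less_symbol, 'a::linordered_ab_group_add) fo_struct"
    and NN :: "(plus_symbol, less_symbol, 'b::linordered_ab_group_add) fo_struct"
  assumes N: "N = ordered_group_struct" "NN = ordered_group_struct"
    and emb: "elementary_embedding j N NN" and P: "same_formula (enriched id N) (enriched j NN) P P'"
  shows "P e \<longleftrightarrow> P' (\<lambda>i. j (e i))"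
proof -
  have "same_formula N NN (\<lambda>e. e 0 = e 1 + e 2) (\<lambda>e. e 0 = e 1 + e 2)"
    unfolding N by (intro formula_eq term_ordered_group_plus term_var)
  then have "same_formula (with_constants id N) (with_constants j NN) (\<lambda>e. e 0 = e 1 + e 2) (\<lambda>e. e 0 = e 1 + e 2)"
    by (rule interprets_formula[OF interprets_with_constants_self])
  then have "interprets (enriched id N) (enriched j NN) (with_constants id N) (with_constants j NN)"
    by (intro interprets_enriched interprets_with_constants_self term_with_constants)
  from interprets_formula[OF this P] have P2: "same_formula (with_constants id N) (with_constants j NN) P P'" .
  from formula_bounded[OF this] obtain k where k: "\<forall>e e'. (\<forall>i<k. e i = e' i) \<longrightarrow> P e = P e'"
    "\<forall>e e'. (\<forall>i<k. e i = e' i) \<longrightarrow> P' e = P' e'" by blast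
  obtain \<phi> cs where \<phi>: "is_formula N (k + length cs) \<phi>"
     "\<forall>as. length as = k \<longrightarrow> (P (nth as) \<longleftrightarrow> holds N \<phi> (as @ map id cs))"
     "\<forall>as. length as = k \<longrightarrow> (P' (nth as) \<longleftrightarrow> holds NN \<phi> (as @ map j cs))"
    using constants_to_parameters[OF P2 k(1) k(2)] by blast
  define as where "as = map e [0..<k]"
  have "P e \<longleftrightarrow> P (nth as)" by (rule k(1)[rule_format]) (simp add: as_def)
  also have "\<dots> \<longleftrightarrow> holds N \<phi> (as @ cs)" using \<phi>(2) by (simp add: as_def)
  also have "\<dots> \<longleftrightarrow> holds NN \<phi> (map j (as @ cs))"
    using emb \<phi>(1) unfolding elementary_embedding_def by (simp add: as_def)
  also have "\<dots> \<longleftrightarrow> P' (nth (map j as))" using \<phi>(3) by (simp add: as_def)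
  also have "\<dots> \<longleftrightarrow> P' (\<lambda>i. j (e i))" by (rule k(2)[rule_format]) (simp add: as_def)
  finally show ?thesis .
qed

lemma map_if_less: "map (\<lambda>i. if i < k then f i else c) [0..<k] = map f [0..<k]"
  by (rule nth_equalityI) simp_all

lemma extended_reduct_interprets:
  assumes "extended_reduct M N j NN MM"
  shows "interprets M MM (enriched id N) (enriched j NN)"
  unfolding interprets_def
proof (intro conjI allI impI)
  fix r k assume "rel_arity M r = Some k"
  from assms[unfolded extended_reduct_def, THEN conjunct2, THEN conjunct1, rule_format, OF this]
  obtain \<phi> bs where \<phi>: "is_formula N (k + length bs) \<phi>"
    "{as. length as = k \<and> rel_int M r as} = solutions N k \<phi> bs"
    "{as. length as = k \<and> rel_int MM r as} = solutions NN k \<phi> (map j bs)"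
    by (elim exE conjE)
  have M: "rel_int M r as \<longleftrightarrow> holds N \<phi> (as @ map id bs)" if "length as = k" for as
    using \<phi>(2)[unfolded solutions_def set_eq_iff mem_Collect_eq, rule_format, of as] that by simp
  have MM: "rel_int MM r as \<longleftrightarrow> holds NN \<phi> (as @ map j bs)" if "length as = k" for as
    using \<phi>(3)[unfolded solutions_def set_eq_iff mem_Collect_eq, rule_format, of as] that by simp
  have "same_formula (enriched id N) (enriched j NN) (\<lambda>e. holds N \<phi> (map (\<lambda>i. e i) [0..<k] @ map id bs))
      (\<lambda>e. holds NN \<phi> (map (\<lambda>i. e i) [0..<k] @ map j bs))"
    by (rule formula_holds[OF interprets_enriched_self term_const \<phi>(1)])
  then show "same_formula (enriched id N) (enriched j NN) (\<lambda>e. rel_int M r (map (\<lambda>i. e i) [0..<k]))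
      (\<lambda>e. rel_int MM r (map (\<lambda>i. e i) [0..<k]))"
    by (simp only: M MM length_map length_upt diff_zero)
next
  fix f k assume "fn_arity M f = Some k"
  from assms[unfolded extended_reduct_def, THEN conjunct2, THEN conjunct2, rule_format, OF this]
  obtain \<phi> bs where \<phi>: "is_formula N (Suc k + length bs) \<phi>"
    "{as @ [fn_int M f as] |as. length as = k} = solutions N (Suc k) \<phi> bs"
    "{as @ [fn_int MM f as] |as. length as = k} = solutions NN (Suc k) \<phi> (map j bs)"
    by (elim exE conjE)
  have graph: "as @ [y] \<in> {as @ [fn_int M f as] |as. length as = k} \<longleftrightarrow> as @ [y] \<in> solutions N (Suc k) \<phi> bs"
    for as y unfolding \<phi>(2) by (rule refl)
  have M: "y = fn_int M f as \<longleftrightarrow> holds N \<phi> ((as @ [y]) @ map id bs)" if "length as = k" for as y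
    using that graph[of as y] by (simp add: solutions_def)
  have graph': "as @ [y] \<in> {as @ [fn_int MM f as] |as. length as = k} \<longleftrightarrow> as @ [y] \<in> solutions NN (Suc k) \<phi> (map j bs)"
    for as y unfolding \<phi>(3) by (rule refl)
  have MM: "y = fn_int MM f as \<longleftrightarrow> holds NN \<phi> ((as @ [y]) @ map j bs)" if "length as = k" for as y
    using that graph'[of as y] by (simp add: solutions_def)
  have "same_formula (enriched id N) (enriched j NN) (\<lambda>e. holds N \<phi> (map (\<lambda>i. e i) [0..<Suc k] @ map id bs))
      (\<lambda>e. holds NN \<phi> (map (\<lambda>i. e i) [0..<Suc k] @ map j bs))"
    by (rule formula_holds[OF interprets_enriched_self term_const \<phi>(1)])
  from formula_subst[OF this, where t = "\<lambda>i e. if i < k then e (Suc i) else e 0"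
        and t' = "\<lambda>i e. if i < k then e (Suc i) else e 0", OF term_if, OF term_var term_var]
  have "same_formula (enriched id N) (enriched j NN) (\<lambda>e. holds N \<phi> (map (\<lambda>i. if i < k then e (Suc i) else e 0) [0..<Suc k] @ map id bs))
      (\<lambda>e. holds NN \<phi> (map (\<lambda>i. if i < k then e (Suc i) else e 0) [0..<Suc k] @ map j bs))"
    .
  then show "same_formula (enriched id N) (enriched j NN) (\<lambda>e. e 0 = fn_int M f (map (\<lambda>i. e (Suc i)) [0..<k]))
      (\<lambda>e. e 0 = fn_int MM f (map (\<lambda>i. e (Suc i)) [0..<k]))"
    by (simp add: M MM map_if_less)
qed

section \<open>First-order properties of archimedean groups\<close>

text \<open>
  For \<open>rel\<close> the equality, \<open>A\<close> has at most \<open>q\<close> elements; for a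
  congruence, \<open>A\<close> meets at most \<open>q\<close> cosets. The recursion
  \<open>covered_Suc\<close> shows that both are first-order for fixed \<open>q\<close>.
\<close>

definition covered :: "('a \<Rightarrow> 'a \<Rightarrow> bool) \<Rightarrow> nat \<Rightarrow> ('a \<Rightarrow> bool) \<Rightarrow> bool" where
  "covered rel q A \<longleftrightarrow> (\<exists>R. finite R \<and> card R \<le> q \<and> (\<forall>x. A x \<longrightarrow> (\<exists>r\<in>R. rel x r)))"

lemma covered_0: "covered rel 0 A \<longleftrightarrow> (\<forall>x. \<not> A x)"
  unfolding covered_def by auto

lemma covered_Suc: "covered rel (Suc q) A \<longleftrightarrow> (\<exists>r. covered rel q (\<lambda>x. A x \<and> \<not> rel x r))"
proof
  assume "covered rel (Suc q) A"
  then obtain R where R: "finite R" "card R \<le> Suc q" "\<forall>x. A x \<longrightarrow> (\<exists>r\<in>R. rel x r)"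
    unfolding covered_def by blast
  show "\<exists>r. covered rel q (\<lambda>x. A x \<and> \<not> rel x r)"
  proof (cases "R = {}")
    case True
    then show ?thesis using R(3) unfolding covered_def by (intro exI[of _ undefined] exI[of _ "{}"]) simp
  next
    case False
    then obtain r where "r \<in> R" by blast
    then have "card (R - {r}) \<le> q" using R(1,2) by simp
    moreover have "\<forall>x. A x \<and> \<not> rel x r \<longrightarrow> (\<exists>r\<in>R - {r}. rel x r)" using R(3) by blast
    ultimately show ?thesis using R(1) unfolding covered_def by blast
  qed
next
  assume "\<exists>r. covered rel q (\<lambda>x. A x \<and> \<not> rel x r)"
  then obtain r R where R: "finite R" "card R \<le> q" "\<forall>x. A x \<and> \<not> rel x r \<longrightarrow> (\<exists>r\<in>R. rel x r)"
    unfolding covered_def by blast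
  then have "card (insert r R) \<le> Suc q" by (simp add: card_insert_if)
  moreover have "\<forall>x. A x \<longrightarrow> (\<exists>r\<in>insert r R. rel x r)" using R(3) by blast
  ultimately show "covered rel (Suc q) A" using R(1) unfolding covered_def by blast
qed

lemma formula_covered:
  assumes rel: "same_formula M M' (\<lambda>e. rel (e 0) (e 1)) (\<lambda>e. rel' (e 0) (e 1))"
    and "same_formula M M' (\<lambda>e. A (e 0) (\<lambda>i. e (Suc i))) (\<lambda>e. A' (e 0) (\<lambda>i. e (Suc i)))"
  shows "same_formula M M' (\<lambda>e. covered rel q (\<lambda>x. A x e)) (\<lambda>e. covered rel' q (\<lambda>x. A' x e))"
  using assms(2)
proof (induction q arbitrary: A A')
  case 0
  then show ?case unfolding covered_0 by (intro formula_all formula_not)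
next
  case (Suc q)
  from formula_subst[OF Suc.prems, where t = "\<lambda>i e. case_nat (e 0) (\<lambda>i. e (Suc (Suc i))) i"
      and t' = "\<lambda>i e. case_nat (e 0) (\<lambda>i. e (Suc (Suc i))) i", OF term_case_nat, OF term_var term_var]
  have "same_formula M M' (\<lambda>e. A (e 0) (\<lambda>i. e (Suc (Suc i)))) (\<lambda>e. A' (e 0) (\<lambda>i. e (Suc (Suc i))))"
    unfolding nat.case .
  from formula_conj[OF this formula_not[OF rel]]
  have "same_formula M M' (\<lambda>e. A (e 0) (\<lambda>i. e (Suc (Suc i))) \<and> \<not> rel (e 0) (e (Suc 0)))
     (\<lambda>e. A' (e 0) (\<lambda>i. e (Suc (Suc i))) \<and> \<not> rel' (e 0) (e (Suc 0)))" by simp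
  from Suc.IH[of "\<lambda>x e. A x (\<lambda>i. e (Suc i)) \<and> \<not> rel x (e 0)"
      "\<lambda>x e. A' x (\<lambda>i. e (Suc i)) \<and> \<not> rel' x (e 0)", OF this]
  show ?case unfolding covered_Suc by (rule formula_ex)
qed

lemma term_ordered_group_mult:
  fixes f :: "(nat \<Rightarrow> 'a::linordered_ab_group_add) \<Rightarrow> 'a" and f' :: "(nat \<Rightarrow> 'b::linordered_ab_group_add) \<Rightarrow> 'b"
  assumes "same_term ordered_group_struct ordered_group_struct f f'" "1 \<le> n"
  shows "same_term ordered_group_struct ordered_group_struct (\<lambda>e. int_multiple n (f e)) (\<lambda>e. int_multiple n (f' e))"
  by (rule term_mult) (rule term_ordered_group_plus assms | assumption)+

lemma formula_ordered_group_cgr: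
  fixes s :: "(nat \<Rightarrow> 'a::linordered_ab_group_add) \<Rightarrow> 'a" and s' :: "(nat \<Rightarrow> 'b::linordered_ab_group_add) \<Rightarrow> 'b"
  assumes "1 \<le> n" "same_term ordered_group_struct ordered_group_struct s s'"
    "same_term ordered_group_struct ordered_group_struct t t'"
  shows "same_formula ordered_group_struct ordered_group_struct (\<lambda>e. cgr n (s e) (t e)) (\<lambda>e. cgr n (s' e) (t' e))"
  by (rule formula_cgr) (rule term_ordered_group_plus assms | assumption)+

lemma small_index_transfer:
  fixes H :: "(plus_symbol, less_symbol, 'h::linordered_ab_group_add) fo_struct"
    and N :: "(plus_symbol, less_symbol, 'a::linordered_ab_group_add) fo_struct"
  assumes "H = ordered_group_struct" "N = ordered_group_struct"
    and "elementarily_equivalent N H" "small_index TYPE('h)"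
  shows "small_index TYPE('a)"
  unfolding small_index_def
proof (intro allI impI)
  fix n :: int assume n: "1 \<le> n"
  then obtain R :: "'h set" where "finite R" "\<forall>x. \<exists>r\<in>R. cgr n x r"
    using assms(4) unfolding small_index_def by blast
  then have "covered (cgr n) (card R) (\<lambda>x :: 'h. True)" unfolding covered_def by blast
  moreover have "same_formula N H (\<lambda>e. covered (cgr n) (card R) (\<lambda>x :: 'a. True)) (\<lambda>e. covered (cgr n) (card R) (\<lambda>x :: 'h. True))"
    unfolding assms(1,2)
    by (rule formula_covered[where A = "\<lambda>x e. True" and A' = "\<lambda>x e. True"])
      (intro formula_ordered_group_cgr n term_var formula_const)+
  ultimately have "covered (cgr n) (card R) (\<lambda>x :: 'a. True)"
    using sentence_transfer[OF assms(3)] by blast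
  then show "\<exists>R :: 'a set. finite R \<and> (\<forall>x. \<exists>r\<in>R. cgr n x r)" unfolding covered_def by blast
qed

text \<open>
  The first condition decides when a coset meets an interval: the positive elements of a coset either have
  a least element \<open>\<delta>\<close>, or come arbitrarily close to \<open>0 = \<delta>\<close>. The
  second one says that moving by \<open>\<epsilon>\<close> can cross any prescribed bound \<open>t\<close>
  on \<open>nx\<close>; it rules out definable proper convex subgroups.
\<close>

definition regular_group :: "'a::linordered_ab_group_add itself \<Rightarrow> bool" where
  "regular_group _ \<longleftrightarrow>
     (\<forall>n\<ge>1. \<forall>d :: 'a. \<exists>\<delta>. \<forall>s. (\<exists>y. 0 < y \<and> y < s \<and> cgr n y d) \<longleftrightarrow> \<delta> < s) \<and>
     (\<forall>n\<ge>1. \<forall>t \<epsilon> :: 'a. 0 < \<epsilon> \<longrightarrow> (\<exists>x. \<not> t < int_multiple n x \<and> t < int_multiple n (x + \<epsilon>)))"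

lemma zero_less_iff_double: "0 < y \<longleftrightarrow> y < y + (y :: 'a::linordered_ab_group_add)"
  by simp

lemma regular_group_transfer:
  fixes H :: "(plus_symbol, less_symbol, 'h::linordered_ab_group_add) fo_struct"
    and N :: "(plus_symbol, less_symbol, 'a::linordered_ab_group_add) fo_struct"
  assumes H: "H = ordered_group_struct" and N: "N = ordered_group_struct"
    and equiv: "elementarily_equivalent N H" and "regular_group TYPE('h)"
  shows "regular_group TYPE('a)"
proof -
  note rules = formula_all formula_ex formula_imp formula_iff formula_conj formula_not formula_ordered_group_less
    term_ordered_group_plus term_var
  have "\<exists>\<delta>. \<forall>s. (\<exists>y. 0 < y \<and> y < s \<and> cgr n y d) \<longleftrightarrow> \<delta> < s" if n: "1 \<le> n" for n and d :: 'a
  proof -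
    have "same_formula N H (\<lambda>e. \<forall>d :: 'a. \<exists>\<delta>. \<forall>s. (\<exists>y. 0 < y \<and> y < s \<and> cgr n y d) = (\<delta> < s))
        (\<lambda>e. \<forall>d :: 'h. \<exists>\<delta>. \<forall>s. (\<exists>y. 0 < y \<and> y < s \<and> cgr n y d) = (\<delta> < s))"
      unfolding zero_less_iff_double N H
      by (intro rules formula_ordered_group_cgr n)
    from sentence_transfer[OF equiv this] show ?thesis
      using assms(4) n unfolding regular_group_def by blast
  qed
  moreover have "\<exists>x. \<not> t < int_multiple n x \<and> t < int_multiple n (x + \<epsilon>)"
    if n: "1 \<le> n" and "0 < \<epsilon>" for n and t \<epsilon> :: 'a
  proof -
    have "same_formula N H (\<lambda>e. \<forall>t \<epsilon> :: 'a. 0 < \<epsilon> \<longrightarrow> (\<exists>x. \<not> t < int_multiple n x \<and> t < int_multiple n (x + \<epsilon>)))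
       (\<lambda>e. \<forall>t \<epsilon> :: 'h. 0 < \<epsilon> \<longrightarrow> (\<exists>x. \<not> t < int_multiple n x \<and> t < int_multiple n (x + \<epsilon>)))"
      unfolding zero_less_iff_double N H
      by (intro rules term_ordered_group_mult n)
    from sentence_transfer[OF equiv this] show ?thesis
      using assms(4) that unfolding regular_group_def by blast
  qed
  ultimately show ?thesis unfolding regular_group_def by blast
qed

lemma archimedean_floor:
  assumes "archimedean_group TYPE('h::linordered_ab_group_add)" "0 < (a :: 'h)"
  shows "\<exists>q. int_multiple q a \<le> t \<and> t < int_multiple (q + 1) a"
proof -
  have arch: "\<exists>n. b < int_multiple n a" for b
    using assms unfolding archimedean_group_def by auto
  obtain m where m: "t < int_multiple m a" using arch by blast
  obtain l where "- t < int_multiple l a" using arch by blast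
  then have l: "int_multiple (- l) a < t" by (simp add: zmod_simps minus_less_iff)
  define k where "k = (LEAST k :: nat. t < int_multiple (- l + int k) a)"
  have "int_multiple (- l) a < int_multiple m a" using l m by (rule less_trans)
  then have "- l < m" using int_multiple_mono_left(1)[OF assms(2)] by blast
  then have "- l + int (nat (m + l)) = m" by simp
  then have "t < int_multiple (- l + int (nat (m + l))) a" using m by (simp only:)
  then have k: "t < int_multiple (- l + int k) a" unfolding k_def by (rule LeastI)
  have "k \<noteq> 0"
  proof
    assume "k = 0"
    then have "t < int_multiple (- l) a" using k by (simp only: of_nat_0 add_0_right)
    then show False using l by (rule less_asym)
  qed
  then have "\<not> t < int_multiple (- l + int (k - 1)) a"
    unfolding k_def by (intro not_less_Least) simp
  moreover have "- l + int k = (- l + int (k - 1)) + 1" using \<open>k \<noteq> 0\<close> by simp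
  ultimately have "int_multiple (- l + int (k - 1)) a \<le> t \<and> t < int_multiple ((- l + int (k - 1)) + 1) a"
    using k by (simp only: not_less)
  then show ?thesis by (rule exI)
qed

text \<open>
  Without a least element there are infinitely many positive elements of the coset below one of them. Two
  of these lie in a common interval of length \<open>s\<close>, and their difference \<open>u < s\<close>
  is in \<open>nG\<close>. Reducing an element of the coset modulo \<open>u\<close> makes it smaller than
  \<open>s\<close>.
\<close>

lemma archimedean_congruent_near_zero:
  fixes s :: "'h::linordered_ab_group_add"
  assumes arch: "archimedean_group TYPE('h)" and n: "1 \<le> n" and "0 < s"
    and no_min: "\<And>y. 0 < y \<Longrightarrow> cgr n y d \<Longrightarrow> \<exists>y'. 0 < y' \<and> y' < y \<and> cgr n y' d"
  shows "\<exists>y. 0 < y \<and> y < s \<and> cgr n y d"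
proof -
  obtain y0 where y0: "0 < y0" "cgr n y0 d" using exists_congruent_above[OF \<open>0 < s\<close> n] by blast
  define Q where "Q = {y. 0 < y \<and> y \<le> y0 \<and> cgr n y d}"
  have "y0 \<in> Q" using y0 by (simp add: Q_def)
  have "infinite Q"
  proof
    assume "finite Q"
    then have "Min Q \<in> Q" using \<open>y0 \<in> Q\<close> by (intro Min_in) auto
    then obtain y' where y': "0 < y'" "y' < Min Q" "cgr n y' d" using no_min unfolding Q_def by blast
    then have "y' \<in> Q" using \<open>Min Q \<in> Q\<close> unfolding Q_def by auto
    then show False using Min_le[OF \<open>finite Q\<close>, of y'] y'(2) by simp
  qed
  obtain f where f: "\<And>y. int_multiple (f y) s \<le> y \<and> y < int_multiple (f y + 1) s"
    using archimedean_floor[OF arch \<open>0 < s\<close>] by metis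
  have "f ` Q \<subseteq> {0..f y0}"
  proof
    fix q assume "q \<in> f ` Q"
    then obtain y where y: "q = f y" "y \<in> Q" by blast
    have "0 < y" "y \<le> y0" using y(2) unfolding Q_def by blast+
    have "int_multiple 0 s < int_multiple (f y + 1) s"
      using less_trans[OF \<open>0 < y\<close> conjunct2[OF f]] by (simp only: int_multiple_0)
    then have "0 < f y + 1" using int_multiple_mono_left(1)[OF \<open>0 < s\<close>] by blast
    moreover have "int_multiple (f y) s < int_multiple (f y0 + 1) s"
      using f[of y] f[of y0] \<open>y \<le> y0\<close> by (meson le_less_trans order_trans)
    then have "f y < f y0 + 1" using int_multiple_mono_left(1)[OF \<open>0 < s\<close>] by blast
    ultimately show "q \<in> {0..f y0}" using y(1) by simp
  qed
  then have "finite (f ` Q)" by (rule finite_subset) simp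
  then have "\<not> inj_on f Q" using \<open>infinite Q\<close> by (auto dest: finite_imageD)
  then obtain y1 y2 where y12: "y1 \<in> Q" "y2 \<in> Q" "f y1 = f y2" "y1 \<noteq> y2" unfolding inj_on_def by blast
  then have cong12: "cgr n y1 d" "cgr n y2 d" unfolding Q_def by blast+
  have *: "\<exists>u. 0 < u \<and> u < s \<and> cgr n u 0" if "f a = f b" "a < b" "cgr n a d" "cgr n b d" for a b
  proof (intro exI[of _ "b - a"] conjI)
    show "0 < b - a" using that(2) by simp
    have "b < int_multiple (f a) s + s" using f[of b] that(1) by (simp add: int_multiple_Suc)
    also have "\<dots> \<le> a + s" using f[of a] by simp
    finally show "b - a < s" by (simp only: diff_less_eq add.commute)
    show "cgr n (b - a) 0" using cgr_trans[OF that(4) cgr_sym[OF that(3)]] by (simp add: cgr_diff_iff)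
  qed
  obtain u where u: "0 < u" "u < s" "cgr n u 0"
  proof (cases "y1 < y2")
    case True
    with *[OF y12(3) _ cong12] show ?thesis using that by blast
  next
    case False
    then have "y2 < y1" using y12(4) by simp
    with *[OF y12(3)[symmetric] _ cong12(2,1)] show ?thesis using that by blast
  qed
  obtain k where k: "int_multiple k u \<le> y0" "y0 < int_multiple (k + 1) u"
    using archimedean_floor[OF arch u(1)] by blast
  have cong: "cgr n (y0 - int_multiple l u) d" for l
    using cgr_add[OF y0(2) cgr_minus[OF cgr_scale[OF u(3), of l]]] by simp
  show ?thesis
  proof (cases "int_multiple k u = y0")
    case True
    then have "y0 - int_multiple (k - 1) u = u" by (simp add: int_multiple_diff1)
    then show ?thesis using cong[of "k - 1"] u by auto
  next
    case False
    then have "0 < y0 - int_multiple k u" using k(1) by simp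
    moreover have "y0 - int_multiple k u < s"
    proof -
      have "y0 < int_multiple k u + u" using k(2) by (simp only: int_multiple_Suc)
      then have "y0 - int_multiple k u < u" by (simp only: diff_less_eq add.commute)
      then show ?thesis using u(2) by (rule less_trans)
    qed
    ultimately show ?thesis using cong[of k] by blast
  qed
qed

lemma int_multiple_commute: "int_multiple k (int_multiple l a) = int_multiple l (int_multiple k a)"
  by (simp only: zmod.scale_scale mult.commute)

lemma archimedean_imp_regular:
  assumes arch: "archimedean_group TYPE('h::linordered_ab_group_add)"
  shows "regular_group TYPE('h)"
  unfolding regular_group_def
proof (intro conjI allI impI)
  fix n :: int and d :: 'h assume n: "1 \<le> n"
  show "\<exists>\<delta>. \<forall>s. (\<exists>y. 0 < y \<and> y < s \<and> cgr n y d) = (\<delta> < s)"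
  proof (cases "\<exists>y>0. cgr n y d \<and> (\<forall>y'. 0 < y' \<and> cgr n y' d \<longrightarrow> y \<le> y')")
    case True
    then obtain y where y: "0 < y" "cgr n y d" "\<And>y'. 0 < y' \<Longrightarrow> cgr n y' d \<Longrightarrow> y \<le> y'" by blast
    have "(\<exists>y'. 0 < y' \<and> y' < s \<and> cgr n y' d) = (y < s)" for s
    proof
      assume "\<exists>y'. 0 < y' \<and> y' < s \<and> cgr n y' d"
      then obtain y' where "0 < y'" "y' < s" "cgr n y' d" by blast
      then show "y < s" using y(3)[of y'] by simp
    qed (use y in blast)
    then show ?thesis by blast
  next
    case False
    have no_min: "\<exists>y'. 0 < y' \<and> y' < y \<and> cgr n y' d" if "0 < y" "cgr n y d" for y
    proof (rule ccontr)
      assume "\<not> ?thesis"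
      then have "\<forall>y'. 0 < y' \<and> cgr n y' d \<longrightarrow> y \<le> y'" unfolding not_less[symmetric] by blast
      then show False using False that by blast
    qed
    have "(\<exists>y. 0 < y \<and> y < s \<and> cgr n y d) = (0 < s)" for s
    proof
      assume "\<exists>y. 0 < y \<and> y < s \<and> cgr n y d"
      then show "0 < s" by auto
    next
      assume "0 < s"
      then show "\<exists>y. 0 < y \<and> y < s \<and> cgr n y d"
        by (rule archimedean_congruent_near_zero[OF arch n _ no_min])
    qed
    then show ?thesis by blast
  qed
next
  fix n :: int and t \<epsilon> :: 'h assume n: "1 \<le> n" and "0 < \<epsilon>"
  then have "0 < int_multiple n \<epsilon>" by (intro int_multiple_pos(2)) auto
  from archimedean_floor[OF arch this, of t]
  obtain q where q: "int_multiple q (int_multiple n \<epsilon>) \<le> t" "t < int_multiple (q + 1) (int_multiple n \<epsilon>)" by blast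
  have "int_multiple n (int_multiple q \<epsilon>) = int_multiple q (int_multiple n \<epsilon>)"
    "int_multiple n (int_multiple q \<epsilon> + \<epsilon>) = int_multiple (q + 1) (int_multiple n \<epsilon>)"
    by (simp_all only: int_multiple_add_right int_multiple_add_left int_multiple_1 int_multiple_commute[of n])
  then show "\<exists>x. \<not> t < int_multiple n x \<and> t < int_multiple n (x + \<epsilon>)"
    using q by (intro exI[of _ "int_multiple q \<epsilon>"]) (simp add: not_less)
qed

section \<open>Quantifier elimination\<close>

text \<open>
  Linear forms with integer coefficients and constant terms from the group.
\<close>

inductive lin :: "((nat \<Rightarrow> 'a::ab_group_add) \<Rightarrow> 'a) \<Rightarrow> bool" where
  lin_var: "lin (\<lambda>e. e i)"
| lin_const: "lin (\<lambda>e. c)"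
| lin_add: "lin s \<Longrightarrow> lin t \<Longrightarrow> lin (\<lambda>e. s e + t e)"
| lin_minus: "lin s \<Longrightarrow> lin (\<lambda>e. - s e)"

lemma lin_diff: "lin s \<Longrightarrow> lin t \<Longrightarrow> lin (\<lambda>e. s e - t e)"
  using lin_add[OF _ lin_minus] by simp

lemma lin_scale: "lin s \<Longrightarrow> lin (\<lambda>e. int_multiple k (s e))"
proof (induction k rule: int_induct[where k = 0])
  case base
  show ?case using lin_const[of 0] by simp
next
  case (step1 i)
  then show ?case unfolding int_multiple_Suc by (intro lin_add)
next
  case (step2 i)
  then show ?case unfolding int_multiple_diff1 by (intro lin_diff)
qed

lemma lin_split:
  assumes "lin t"
  shows "\<exists>k u. lin u \<and> (\<forall>e x. t (e(i := x)) = int_multiple k x + u e)"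
  using assms
proof induction
  case (lin_var l)
  show ?case
  proof (cases "l = i")
    case True
    then show ?thesis by (intro exI[of _ 1] exI[of _ "\<lambda>e. 0"]) (simp add: lin_const)
  next
    case False
    then show ?thesis by (intro exI[of _ 0] exI[of _ "\<lambda>e. e l"]) (simp add: lin.lin_var)
  qed
next
  case (lin_const c)
  show ?case by (intro exI[of _ 0] exI[of _ "\<lambda>e. c"]) (simp add: lin.lin_const)
next
  case (lin_add s t)
  then obtain k u l v where "lin u" "\<forall>e x. s (e(i := x)) = int_multiple k x + u e"
    "lin v" "\<forall>e x. t (e(i := x)) = int_multiple l x + v e" by blast
  then show ?case
    by (intro exI[of _ "k + l"] exI[of _ "\<lambda>e. u e + v e"])
      (simp add: lin.lin_add int_multiple_add_left add_ac del: fun_upd_apply)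
next
  case (lin_minus s)
  then obtain k u where "lin u" "\<forall>e x. s (e(i := x)) = int_multiple k x + u e" by blast
  then show ?case
    by (intro exI[of _ "- k"] exI[of _ "\<lambda>e. - u e"]) (simp add: lin.lin_minus zmod.scale_minus_left del: fun_upd_apply)
qed

text \<open>
  The atomic information about a linear form is its class under \<open>cl\<close> and its residues. In the
  ordered group the class is the sign; in the pure group it only records whether the value is 0.
\<close>

inductive qf :: "('a::ab_group_add \<Rightarrow> 'c) \<Rightarrow> ((nat \<Rightarrow> 'a) \<Rightarrow> bool) \<Rightarrow> bool" for cl where
  qf_cl: "lin t \<Longrightarrow> qf cl (\<lambda>e. cl (t e) = c)"
| qf_cgr: "lin t \<Longrightarrow> 1 \<le> n \<Longrightarrow> qf cl (\<lambda>e. cgr n (t e) 0)"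
| qf_not: "qf cl P \<Longrightarrow> qf cl (\<lambda>e. \<not> P e)"
| qf_conj: "qf cl P \<Longrightarrow> qf cl Q \<Longrightarrow> qf cl (\<lambda>e. P e \<and> Q e)"

lemma qf_const: "qf cl (\<lambda>e. b)"
proof -
  have "qf cl (\<lambda>e. cl 0 = cl 0)"
    using qf_cl[where t = "\<lambda>e. 0" and cl = cl and c = "cl 0", OF lin_const] .
  then have t: "qf cl (\<lambda>e. True)" unfolding simp_thms .
  show ?thesis
  proof (cases b)
    case True
    then show ?thesis using t by (simp only:)
  next
    case False
    then show ?thesis using qf_not[where P = "\<lambda>e. True", OF t] by (simp only: not_True_eq_False)
  qed
qed

lemma qf_disj: "qf cl P \<Longrightarrow> qf cl Q \<Longrightarrow> qf cl (\<lambda>e. P e \<or> Q e)"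
  using qf_not[OF qf_conj[OF qf_not qf_not]] by simp

lemma qf_ball: "finite I \<Longrightarrow> (\<And>i. i \<in> I \<Longrightarrow> qf cl (P i)) \<Longrightarrow> qf cl (\<lambda>e. \<forall>i\<in>I. P i e)"
  by (induction I rule: finite_induct) (simp_all add: qf_const qf_conj)

lemma qf_bex: "finite I \<Longrightarrow> (\<And>i. i \<in> I \<Longrightarrow> qf cl (P i)) \<Longrightarrow> qf cl (\<lambda>e. \<exists>i\<in>I. P i e)"
  by (induction I rule: finite_induct) (simp_all add: qf_const qf_disj)

lemma cgr_iff_diff: "cgr n x y \<longleftrightarrow> cgr n (x - y) 0"
  by (simp add: cgr_diff_iff)

lemma qf_cgr2: "lin s \<Longrightarrow> lin t \<Longrightarrow> 1 \<le> n \<Longrightarrow> qf cl (\<lambda>e. cgr n (s e) (t e))"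
  unfolding cgr_iff_diff[of n "s _"] by (intro qf_cgr lin_diff)

text \<open>
  In place of a disjunctive normal form: the truth value is a function of the classes and the residues,
  modulo a common \<open>n\<close>, of finitely many linear forms.
\<close>

lemma qf_determined:
  assumes "qf cl P"
  shows "\<exists>T n. finite T \<and> (\<forall>t\<in>T. lin t) \<and> 1 \<le> n \<and>
    (\<forall>e e'. (\<forall>t\<in>T. cl (t e) = cl (t e') \<and> cgr n (t e) (t e')) \<longrightarrow> P e = P e')"
  using assms
proof induction
  case (qf_cl t c)
  then show ?case by (intro exI[of _ "{t}"] exI[of _ 1]) simp
next
  case (qf_cgr t n)
  then show ?case
    by (intro exI[of _ "{t}"] exI[of _ n]) (auto intro: cgr_trans cgr_sym)
next
  case (qf_not P)
  then show ?case by simp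
next
  case (qf_conj P Q)
  then obtain T n U m where
    T: "finite T" "\<forall>t\<in>T. lin t" "1 \<le> n" "\<forall>e e'. (\<forall>t\<in>T. cl (t e) = cl (t e') \<and> cgr n (t e) (t e')) \<longrightarrow> P e = P e'" and
    U: "finite U" "\<forall>t\<in>U. lin t" "1 \<le> m" "\<forall>e e'. (\<forall>t\<in>U. cl (t e) = cl (t e') \<and> cgr m (t e) (t e')) \<longrightarrow> Q e = Q e'"
    by blast
  have "1 * 1 \<le> n * m" using T(3) U(3) by (intro mult_mono) auto
  moreover have "(P e \<and> Q e) = (P e' \<and> Q e')"
    if *: "\<forall>t\<in>T \<union> U. cl (t e) = cl (t e') \<and> cgr (n * m) (t e) (t e')" for e e'
  proof -
    have "P e = P e'" by (rule T(4)[rule_format]) (use * cgr_dvd(2)[of n m] in blast)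
    moreover have "Q e = Q e'" by (rule U(4)[rule_format]) (use * cgr_dvd(1)[of n m] in blast)
    ultimately show ?thesis by simp
  qed
  ultimately show ?case using T(1,2) U(1,2)
    by (intro exI[of _ "T \<union> U"] exI[of _ "n * m"]) auto
qed

lemma ex_cgr_multiple:
  "(\<exists>y. cgr (K * n) y (int_multiple K q) \<and> Q y) \<longleftrightarrow> (\<exists>x. cgr n x q \<and> Q (int_multiple K x))"
proof
  assume "\<exists>y. cgr (K * n) y (int_multiple K q) \<and> Q y"
  then obtain z where "Q (int_multiple K q + int_multiple (K * n) z)" unfolding cgr_def by blast
  then have "Q (int_multiple K (q + int_multiple n z))" by (simp only: int_multiple_add_right zmod.scale_scale)
  then show "\<exists>x. cgr n x q \<and> Q (int_multiple K x)" unfolding cgr_def by blast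
next
  assume "\<exists>x. cgr n x q \<and> Q (int_multiple K x)"
  then show "\<exists>y. cgr (K * n) y (int_multiple K q) \<and> Q y" using cgr_mult_iff by blast
qed

lemma ball_if_iff:
  "S \<subseteq> T \<Longrightarrow> (\<forall>t\<in>T. if t \<in> S then P t else Q t) \<longleftrightarrow> (\<forall>t\<in>T - S. Q t) \<and> (\<forall>t\<in>S. P t)"
  by auto

text \<open>
  The assumption \<open>elim\<close> eliminates a variable that occurs with coefficient 1; it is what
  remains to be checked for a particular \<open>cl\<close>. Involutive \<open>ng\<close> and invariance
  under positive multiples allow reducing the general case to it.
\<close>

locale elimination =
  fixes cl :: "'a::linordered_ab_group_add \<Rightarrow> 'c::finite" and ng :: "'c \<Rightarrow> 'c"
  assumes cl_scale: "0 < k \<Longrightarrow> cl (int_multiple k v) = cl v"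
    and cl_minus: "cl (- v) = ng (cl v)" and ng_ng: "ng (ng c) = c"
    and index: "small_index TYPE('a)"
    and elim: "\<And>(J :: ((nat \<Rightarrow> 'a) \<Rightarrow> 'a) set) s \<sigma> m q. finite J \<Longrightarrow> (\<And>j. j \<in> J \<Longrightarrow> lin (s j)) \<Longrightarrow> 1 \<le> m \<Longrightarrow>
       qf cl (\<lambda>e. \<exists>y. cgr m y q \<and> (\<forall>j\<in>J. cl (y - s j e) = \<sigma> j))"
begin

text \<open>
  All nonzero coefficients of \<open>x\<close> are made equal to their common multiple \<open>K\<close>,
  up to sign. Then \<open>y = Kx\<close> is the new variable, and \<open>x \<in> q + nG\<close> becomes
  \<open>y \<in> Kq + KnG\<close>.
\<close>

lemma elim_scaled:
  fixes T :: "((nat \<Rightarrow> 'a) \<Rightarrow> 'a) set"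
  assumes T: "finite T" and u: "\<And>t. t \<in> T \<Longrightarrow> lin (u t)" and n: "1 \<le> n"
  shows "qf cl (\<lambda>e. \<exists>x. cgr n x q \<and> (\<forall>t\<in>T. cl (int_multiple (k t) x + u t e) = \<tau> t))"
proof -
  define T1 where "T1 = {t \<in> T. k t \<noteq> 0}"
  define K where "K = (\<Prod>t\<in>T1. \<bar>k t\<bar>)"
  define b where "b t = K div \<bar>k t\<bar>" for t
  have "finite T1" using T by (simp add: T1_def)
  have "0 < K" unfolding K_def by (rule prod_pos) (simp add: T1_def)
  have b: "b t * \<bar>k t\<bar> = K" if "t \<in> T1" for t
    unfolding b_def K_def using that \<open>finite T1\<close> by (intro dvd_div_mult_self dvd_prodI)
  have b_pos: "0 < b t" if "t \<in> T1" for t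
  proof -
    have "0 < b t * \<bar>k t\<bar>" unfolding b[OF that] by (rule \<open>0 < K\<close>)
    moreover have "0 < \<bar>k t\<bar>" using that by (simp add: T1_def)
    ultimately show ?thesis by (rule zero_less_mult_pos2)
  qed
  define s where "s t e = - int_multiple (sgn (k t) * b t) (u t e)" for t e
  define \<sigma> where "\<sigma> t = (if 0 < k t then \<tau> t else ng (\<tau> t))" for t
  have key: "cl (int_multiple K x - s t e) = \<sigma> t \<longleftrightarrow> cl (int_multiple (k t) x + u t e) = \<tau> t"
    if "t \<in> T1" for t x e
  proof (cases "0 < k t")
    case True
    then have bk: "b t * k t = K" and s_eq: "s t e = - int_multiple (b t) (u t e)"
      using b[OF that] by (simp_all add: s_def)
    have "int_multiple K x - s t e = int_multiple (b t) (int_multiple (k t) x + u t e)"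
      unfolding s_eq int_multiple_add_right zmod.scale_scale bk by simp
    then show ?thesis using cl_scale[OF b_pos[OF that]] True by (simp add: \<sigma>_def)
  next
    case False
    then have "k t < 0" using that by (simp add: T1_def)
    then have bk: "b t * k t = - K" and s_eq: "s t e = int_multiple (b t) (u t e)"
      using b[OF that] by (simp_all add: s_def zmod.scale_minus_left)
    have "int_multiple K x - s t e = - int_multiple (b t) (int_multiple (k t) x + u t e)"
      unfolding s_eq int_multiple_add_right zmod.scale_scale bk zmod.scale_minus_left by simp
    then have "cl (int_multiple K x - s t e) = ng (cl (int_multiple (k t) x + u t e))"
      using cl_scale[OF b_pos[OF that]] cl_minus by (simp only:)
    then show ?thesis using False ng_ng unfolding \<sigma>_def by metis
  qed
  have "lin (s t)" if "t \<in> T1" for t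
    unfolding s_def[abs_def] using that u by (intro lin_minus lin_scale) (simp add: T1_def)
  moreover have "1 * 1 \<le> K * n" using \<open>0 < K\<close> n by (intro mult_mono) auto
  then have "1 \<le> K * n" by simp
  ultimately have "qf cl (\<lambda>e. \<exists>y. cgr (K * n) y (int_multiple K q) \<and> (\<forall>t\<in>T1. cl (y - s t e) = \<sigma> t))"
    using elim[OF \<open>finite T1\<close>, where s = s and m = "K * n" and q = "int_multiple K q" and \<sigma> = \<sigma>] by blast
  moreover have "qf cl (\<lambda>e. \<forall>t\<in>T - T1. cl (u t e) = \<tau> t)"
  proof (rule qf_ball)
    fix t assume "t \<in> T - T1"
    then have "lin (u t)" using u by blast
    then show "qf cl (\<lambda>e. cl (u t e) = \<tau> t)" by (rule qf_cl)
  qed (use T in simp)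
  ultimately have "qf cl (\<lambda>e. (\<forall>t\<in>T - T1. cl (u t e) = \<tau> t) \<and>
      (\<exists>y. cgr (K * n) y (int_multiple K q) \<and> (\<forall>t\<in>T1. cl (y - s t e) = \<sigma> t)))"
    by (intro qf_conj)
  moreover have "(\<forall>t\<in>T - T1. cl (u t e) = \<tau> t) \<and>
      (\<exists>y. cgr (K * n) y (int_multiple K q) \<and> (\<forall>t\<in>T1. cl (y - s t e) = \<sigma> t)) \<longleftrightarrow>
    (\<exists>x. cgr n x q \<and> (\<forall>t\<in>T. cl (int_multiple (k t) x + u t e) = \<tau> t))" for e
  proof -
    have split: "(\<forall>t\<in>T. cl (int_multiple (k t) x + u t e) = \<tau> t) \<longleftrightarrow>
      (\<forall>t\<in>T - T1. cl (u t e) = \<tau> t) \<and> (\<forall>t\<in>T1. cl (int_multiple K x - s t e) = \<sigma> t)" for x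
    proof -
      have "cl (int_multiple (k t) x + u t e) = \<tau> t \<longleftrightarrow> (if t \<in> T1 then cl (int_multiple K x - s t e) = \<sigma> t else cl (u t e) = \<tau> t)"
        if "t \<in> T" for t
      proof (cases "t \<in> T1")
        case True
        then show ?thesis by (simp only: key if_True)
      next
        case False
        then have "k t = 0" using that unfolding T1_def by blast
        then show ?thesis using False by simp
      qed
      then have "(\<forall>t\<in>T. cl (int_multiple (k t) x + u t e) = \<tau> t) \<longleftrightarrow>
          (\<forall>t\<in>T. if t \<in> T1 then cl (int_multiple K x - s t e) = \<sigma> t else cl (u t e) = \<tau> t)"
        by (rule ball_cong[OF refl])
      also have "\<dots> \<longleftrightarrow> (\<forall>t\<in>T - T1. cl (u t e) = \<tau> t) \<and> (\<forall>t\<in>T1. cl (int_multiple K x - s t e) = \<sigma> t)"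
        by (rule ball_if_iff) (auto simp: T1_def)
      finally show ?thesis .
    qed
    have aux: "(a \<and> (\<exists>x :: 'a. C x \<and> B x)) = (\<exists>x. C x \<and> (a \<and> B x))" for a B C by blast
    show ?thesis unfolding split ex_cgr_multiple by (rule aux)
  qed
  ultimately show ?thesis by (simp only:)
qed

text \<open>
  The quantified statement is the finite disjunction over the patterns of classes and residues that are
  possible for \<open>P\<close>. For a fixed residue of \<open>x\<close> the residues of the linear forms
  no longer depend on \<open>x\<close>, so that only the classes remain.
\<close>

lemma qf_ex:
  assumes "qf cl P"
  shows "qf cl (\<lambda>e. \<exists>x. P (e(i := x)))"
proof -
  obtain T n where T: "finite T" "\<forall>t\<in>T. lin t" "1 \<le> n"
    "\<forall>e e'. (\<forall>t\<in>T. cl (t e) = cl (t e') \<and> cgr n (t e) (t e')) \<longrightarrow> P e = P e'"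
    using qf_determined[OF assms] by blast
  obtain R :: "'a set" where R: "finite R" "\<forall>x. \<exists>r\<in>R. cgr n x r"
    using index T(3) unfolding small_index_def by blast
  have "\<forall>t\<in>T. \<exists>k u. lin u \<and> (\<forall>e x. t (e(i := x)) = int_multiple k x + u e)"
    using lin_split T(2) by blast
  then obtain k u where u: "\<And>t. t \<in> T \<Longrightarrow> lin (u t)"
    "\<And>t e x. t \<in> T \<Longrightarrow> t (e(i := x)) = int_multiple (k t) x + u t e" by metis
  define matches where "matches \<tau> e = (\<forall>t\<in>T. cl (t e) = fst (\<tau> t) \<and> cgr n (t e) (snd (\<tau> t)))" for \<tau> e
  define \<Theta> where "\<Theta> = {\<tau> \<in> PiE T (\<lambda>_. UNIV \<times> R). \<exists>e. P e \<and> matches \<tau> e}"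
  define G where "G \<rho> \<tau> e = ((\<forall>t\<in>T. cgr n (int_multiple (k t) \<rho> + u t e) (snd (\<tau> t))) \<and>
    (\<exists>x. cgr n x \<rho> \<and> (\<forall>t\<in>T. cl (int_multiple (k t) x + u t e) = fst (\<tau> t))))" for \<rho> \<tau> e
  have "finite \<Theta>" unfolding \<Theta>_def
    by (rule finite_subset[of _ "PiE T (\<lambda>_. UNIV \<times> R)"]) (auto intro!: finite_PiE T(1) finite_cartesian_product R(1))
  moreover have "qf cl (G \<rho> \<tau>)" for \<rho> \<tau>
    unfolding G_def[abs_def]
    by (intro qf_conj qf_ball qf_cgr2 elim_scaled T(1,3) lin_add lin_const u)
  ultimately have "qf cl (\<lambda>e. \<exists>\<rho>\<in>R. \<exists>\<tau>\<in>\<Theta>. G \<rho> \<tau> e)"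
    by (intro qf_bex R(1))
  moreover have "(\<exists>\<rho>\<in>R. \<exists>\<tau>\<in>\<Theta>. G \<rho> \<tau> e) \<longleftrightarrow> (\<exists>x. P (e(i := x)))" for e
  proof
    assume "\<exists>\<rho>\<in>R. \<exists>\<tau>\<in>\<Theta>. G \<rho> \<tau> e"
    then obtain \<rho> \<tau> where \<tau>: "\<tau> \<in> \<Theta>" "G \<rho> \<tau> e" by blast
    then obtain x where x: "cgr n x \<rho>" "\<forall>t\<in>T. cl (int_multiple (k t) x + u t e) = fst (\<tau> t)"
      "\<forall>t\<in>T. cgr n (int_multiple (k t) \<rho> + u t e) (snd (\<tau> t))" unfolding G_def by blast
    have "cgr n (int_multiple (k t) x + u t e) (snd (\<tau> t))" if "t \<in> T" for t
      using cgr_trans[OF cgr_add[OF cgr_scale[OF x(1)] cgr_refl]] x(3) that by blast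
    then have m: "matches \<tau> (e(i := x))" unfolding matches_def using x(2) u(2) by simp
    obtain e' where e': "P e'" "matches \<tau> e'" using \<tau>(1) unfolding \<Theta>_def by blast
    have "P e' = P (e(i := x))"
    proof (rule T(4)[rule_format])
      fix t assume t: "t \<in> T"
      show "cl (t e') = cl (t (e(i := x))) \<and> cgr n (t e') (t (e(i := x)))"
        using m e'(2) t cgr_trans[OF _ cgr_sym] unfolding matches_def by metis
    qed
    then show "\<exists>x. P (e(i := x))" using e'(1) by blast
  next
    assume "\<exists>x. P (e(i := x))"
    then obtain x where x: "P (e(i := x))" ..
    obtain \<rho> where \<rho>: "\<rho> \<in> R" "cgr n x \<rho>" using R(2) by blast
    obtain rep where rep: "\<And>x. rep x \<in> R \<and> cgr n x (rep x)" using R(2) by metis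
    define \<tau> where "\<tau> = restrict (\<lambda>t. (cl (t (e(i := x))), rep (t (e(i := x))))) T"
    have "matches \<tau> (e(i := x))" unfolding matches_def \<tau>_def using rep by simp
    moreover have "\<tau> \<in> PiE T (\<lambda>_. UNIV \<times> R)" unfolding \<tau>_def using rep by auto
    ultimately have "\<tau> \<in> \<Theta>" using x unfolding \<Theta>_def by blast
    moreover have "cgr n (int_multiple (k t) \<rho> + u t e) (snd (\<tau> t))" if "t \<in> T" for t
    proof -
      have "cgr n (int_multiple (k t) x + u t e) (snd (\<tau> t))"
        using \<open>matches \<tau> (e(i := x))\<close> that u(2) unfolding matches_def by simp
      then show ?thesis by (rule cgr_trans[OF cgr_add[OF cgr_scale[OF cgr_sym[OF \<rho>(2)]] cgr_refl]])
    qed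
    moreover have "\<forall>t\<in>T. cl (int_multiple (k t) x + u t e) = fst (\<tau> t)"
      using \<open>matches \<tau> (e(i := x))\<close> u(2) unfolding matches_def by simp
    ultimately have "G \<rho> \<tau> e" unfolding G_def using \<rho>(2) by blast
    then show "\<exists>\<rho>\<in>R. \<exists>\<tau>\<in>\<Theta>. G \<rho> \<tau> e" using \<rho>(1) \<open>\<tau> \<in> \<Theta>\<close> by blast
  qed
  ultimately show ?thesis by simp
qed

end

definition order_class :: "'a::linordered_ab_group_add \<Rightarrow> bool \<times> bool" where
  "order_class v = (0 < v, v < 0)"

lemma qf_less:
  assumes "lin s" "lin t" shows "qf order_class (\<lambda>e. s e < t e)"
proof -
  have "(\<lambda>e. s e < t e) = (\<lambda>e. order_class (t e - s e) = (True, False))"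
    by (rule ext) (auto simp: order_class_def)
  then show ?thesis using qf_cl[OF lin_diff[OF assms(2,1)], of order_class "(True, False)"] by simp
qed

text \<open>
  Translation by \<open>a\<close> reduces the question to the positive elements of a coset, which
  \<open>D\<close> describes.
\<close>

lemma ex_between_iff:
  fixes a b q :: "'a::linordered_ab_group_add"
  assumes "\<And>d s. (\<exists>y. 0 < y \<and> y < s \<and> cgr m y d) \<longleftrightarrow> D d < s" and \<rho>: "cgr m a \<rho>"
  shows "(\<exists>y. cgr m y q \<and> a < y \<and> y < b) \<longleftrightarrow> D (q - \<rho>) < b - a"
  unfolding assms(1)[symmetric]
proof
  assume "\<exists>y. cgr m y q \<and> a < y \<and> y < b"
  then obtain y where y: "cgr m y q" "a < y" "y < b" by blast
  have "cgr m (y - a) (q - \<rho>)" using cgr_add[OF y(1) cgr_minus[OF \<rho>]] by simp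
  then show "\<exists>y. 0 < y \<and> y < b - a \<and> cgr m y (q - \<rho>)" using y by (intro exI[of _ "y - a"]) simp
next
  assume "\<exists>y. 0 < y \<and> y < b - a \<and> cgr m y (q - \<rho>)"
  then obtain y where y: "0 < y" "y < b - a" "cgr m y (q - \<rho>)" by blast
  have "cgr m (y + a) q" using cgr_add[OF y(3) \<rho>] by simp
  moreover have "y + a < b" using y(2) by (simp only: less_diff_eq)
  ultimately show "\<exists>y. cgr m y q \<and> a < y \<and> y < b" using y(1) by (intro exI[of _ "y + a"]) simp
qed

text \<open>
  Only the greatest lower bound and the least upper bound in the two finite sets matter.
\<close>

lemma ex_separating_iff:
  fixes L U :: "'a::linordered_ab_group_add set"
  assumes "finite L" "finite U" "0 < (g :: 'a)" "1 \<le> m"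
  shows "(\<exists>y. cgr m y q \<and> (\<forall>l\<in>L. l < y) \<and> (\<forall>u\<in>U. y < u)) \<longleftrightarrow>
    (\<forall>l\<in>L. \<forall>u\<in>U. \<exists>y. cgr m y q \<and> l < y \<and> y < u)"
proof
  assume *: "\<forall>l\<in>L. \<forall>u\<in>U. \<exists>y. cgr m y q \<and> l < y \<and> y < u"
  consider "L = {}" "U = {}" | "L = {}" "U \<noteq> {}" | "L \<noteq> {}" "U = {}" | "L \<noteq> {}" "U \<noteq> {}" by blast
  then show "\<exists>y. cgr m y q \<and> (\<forall>l\<in>L. l < y) \<and> (\<forall>u\<in>U. y < u)"
  proof cases
    case 1
    then show ?thesis using cgr_refl by blast
  next
    case 2
    obtain y where "y < Min U" "cgr m y q" using exists_congruent_below[OF assms(3,4)] by blast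
    then show ?thesis using 2 assms(2) by (intro exI[of _ y]) simp
  next
    case 3
    obtain y where "y > Max L" "cgr m y q" using exists_congruent_above[OF assms(3,4)] by blast
    then show ?thesis using 3 assms(1) by (intro exI[of _ y]) simp
  next
    case 4
    then obtain y where "cgr m y q" "Max L < y" "y < Min U"
      using * Max_in[OF assms(1)] Min_in[OF assms(2)] by blast
    then show ?thesis using 4 assms(1,2) by (intro exI[of _ y]) simp
  qed
qed blast

lemma order_class_simps:
  "order_class (x - y) = (True, False) \<longleftrightarrow> y < x"
  "order_class (x - y) = (False, True) \<longleftrightarrow> x < y"
  "order_class (x - y) = (False, False) \<longleftrightarrow> x = y"
  "order_class (x - y) \<noteq> (True, True)"
  by (auto simp: order_class_def)

text \<open>
  An equation determines \<open>y\<close>. Otherwise the conditions on \<open>y\<close> are strict bounds,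
  which may be treated in pairs, and whether a coset meets the interval between two bounds depends on
  residues and on one inequality.
\<close>

lemma elimination_order:
  assumes index: "small_index TYPE('a::linordered_ab_group_add)" and reg: "regular_group TYPE('a)"
    and g: "0 < (g :: 'a)"
  shows "elimination (order_class :: 'a \<Rightarrow> _) (\<lambda>(a, b). (b, a))"
proof
  fix k :: int and v :: 'a
  assume "0 < k"
  then show "order_class (int_multiple k v) = order_class v"
    using int_multiple_mono_iff(1)[of k 0 v] int_multiple_mono_iff(1)[of k v 0]
    by (simp add: order_class_def)
next
  fix v :: 'a
  show "order_class (- v) = (case order_class v of (a, b) \<Rightarrow> (b, a))" by (simp add: order_class_def)
next
  fix c :: "bool \<times> bool"
  show "(case case c of (a, b) \<Rightarrow> (b, a) of (a, b) \<Rightarrow> (b, a)) = c" by (cases c) simp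
next
  show "small_index TYPE('a)" by (rule index)
next
  fix J :: "((nat \<Rightarrow> 'a) \<Rightarrow> 'a) set" and s :: "((nat \<Rightarrow> 'a) \<Rightarrow> 'a) \<Rightarrow> (nat \<Rightarrow> 'a) \<Rightarrow> 'a"
    and \<sigma> m and q :: 'a
  assume J: "finite J" and s: "\<And>j. j \<in> J \<Longrightarrow> lin (s j)" and m: "1 \<le> (m :: int)"
  show "qf order_class (\<lambda>e. \<exists>y. cgr m y q \<and> (\<forall>j\<in>J. order_class (y - s j e) = \<sigma> j))"
  proof (cases "\<exists>j0\<in>J. \<sigma> j0 = (False, False)")
    case True
    then obtain j0 where j0: "j0 \<in> J" "\<sigma> j0 = (False, False)" by blast
    have "(\<exists>y. cgr m y q \<and> (\<forall>j\<in>J. order_class (y - s j e) = \<sigma> j)) \<longleftrightarrow>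
        cgr m (s j0 e) q \<and> (\<forall>j\<in>J. order_class (s j0 e - s j e) = \<sigma> j)" for e
      using j0 order_class_simps(3)[of _ "s j0 e"] by metis
    moreover have "qf order_class (\<lambda>e. cgr m (s j0 e) q \<and> (\<forall>j\<in>J. order_class (s j0 e - s j e) = \<sigma> j))"
      by (intro qf_conj qf_cgr2 qf_ball qf_cl lin_diff lin_const s j0(1) J m)
    ultimately show ?thesis by simp
  next
    case no_eq: False
    show ?thesis
    proof (cases "\<exists>j0\<in>J. \<sigma> j0 = (True, True)")
      case True
      then have "(\<lambda>e. \<exists>y. cgr m y q \<and> (\<forall>j\<in>J. order_class (y - s j e) = \<sigma> j)) = (\<lambda>e. False)"
        using order_class_simps(4) by metis
      then show ?thesis using qf_const[of order_class False] by simp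
    next
      case False
      define L where "L = {j \<in> J. \<sigma> j = (True, False)}"
      define U where "U = {j \<in> J. \<sigma> j = (False, True)}"
      have fin: "finite L" "finite U" using J by (simp_all add: L_def U_def)
      have "(\<forall>j\<in>J. order_class (y - s j e) = \<sigma> j) \<longleftrightarrow> (\<forall>l\<in>L. s l e < y) \<and> (\<forall>u\<in>U. y < s u e)" for y e
      proof -
        have "order_class (y - s j e) = \<sigma> j \<longleftrightarrow> (j \<in> L \<longrightarrow> s j e < y) \<and> (j \<in> U \<longrightarrow> y < s j e)" if "j \<in> J" for j
        proof (cases "\<sigma> j = (True, False)")
          case True
          then show ?thesis using that order_class_simps(1) by (simp add: L_def U_def)
        next
          case 2: False
          then have "\<sigma> j = (False, True)" using that no_eq False by (cases "\<sigma> j") auto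
          then show ?thesis using that order_class_simps(2) by (simp add: L_def U_def)
        qed
        then show ?thesis by (auto simp: L_def U_def)
      qed
      then have "(\<exists>y. cgr m y q \<and> (\<forall>j\<in>J. order_class (y - s j e) = \<sigma> j)) \<longleftrightarrow>
          (\<exists>y. cgr m y q \<and> (\<forall>l\<in>(\<lambda>j. s j e) ` L. l < y) \<and> (\<forall>u\<in>(\<lambda>j. s j e) ` U. y < u))" for e
        by simp
      then have eq: "(\<exists>y. cgr m y q \<and> (\<forall>j\<in>J. order_class (y - s j e) = \<sigma> j)) \<longleftrightarrow>
          (\<forall>l\<in>L. \<forall>u\<in>U. \<exists>y. cgr m y q \<and> s l e < y \<and> y < s u e)" for e
        using ex_separating_iff[of "(\<lambda>j. s j e) ` L" "(\<lambda>j. s j e) ` U" g m q] fin g m by simp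
      have "\<forall>d :: 'a. \<exists>\<delta>. \<forall>s. (\<exists>y. 0 < y \<and> y < s \<and> cgr m y d) \<longleftrightarrow> \<delta> < s"
        using reg m unfolding regular_group_def by blast
      then obtain D :: "'a \<Rightarrow> 'a" where D: "\<And>d s. (\<exists>y. 0 < y \<and> y < s \<and> cgr m y d) \<longleftrightarrow> D d < s" by metis
      obtain R :: "'a set" where R: "finite R" "\<forall>x. \<exists>r\<in>R. cgr m x r"
        using index m unfolding small_index_def by blast
      have "(\<exists>y. cgr m y q \<and> a < y \<and> y < b) \<longleftrightarrow> (\<exists>\<rho>\<in>R. cgr m a \<rho> \<and> D (q - \<rho>) < b - a)" for a b
        using ex_between_iff[of m D a _ q b, OF D] R(2) by metis
      then have "(\<lambda>e. \<exists>y. cgr m y q \<and> (\<forall>j\<in>J. order_class (y - s j e) = \<sigma> j)) =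
          (\<lambda>e. \<forall>l\<in>L. \<forall>u\<in>U. \<exists>\<rho>\<in>R. cgr m (s l e) \<rho> \<and> D (q - \<rho>) < s u e - s l e)"
        using eq by simp
      moreover have "qf order_class (\<lambda>e. \<forall>l\<in>L. \<forall>u\<in>U. \<exists>\<rho>\<in>R. cgr m (s l e) \<rho> \<and> D (q - \<rho>) < s u e - s l e)"
        by (intro qf_ball qf_bex qf_conj qf_cgr2 qf_less lin_const lin_diff fin R(1) m s) (simp_all add: L_def U_def)
      ultimately show ?thesis by simp
    qed
  qed
qed

text \<open>
  An equation determines \<open>y\<close>, and finitely many inequations do not exhaust a coset, which is
  infinite.
\<close>

lemma elimination_equality:
  assumes index: "small_index TYPE('a::linordered_ab_group_add)" and g: "0 < (g :: 'a)"
  shows "elimination (\<lambda>v :: 'a. v = 0) id"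
proof
  fix k :: int and v :: 'a
  assume "0 < k"
  then show "(int_multiple k v = 0) = (v = 0)"
    using int_multiple_mono_iff(3)[of k v 0] by simp
next
  fix J :: "((nat \<Rightarrow> 'a) \<Rightarrow> 'a) set" and s :: "((nat \<Rightarrow> 'a) \<Rightarrow> 'a) \<Rightarrow> (nat \<Rightarrow> 'a) \<Rightarrow> 'a"
    and \<sigma> m and q :: 'a
  assume J: "finite J" and s: "\<And>j. j \<in> J \<Longrightarrow> lin (s j)" and m: "1 \<le> (m :: int)"
  show "qf (\<lambda>v. v = 0) (\<lambda>e. \<exists>y. cgr m y q \<and> (\<forall>j\<in>J. (y - s j e = 0) = \<sigma> j))"
  proof (cases "\<exists>j0\<in>J. \<sigma> j0")
    case True
    then obtain j0 where j0: "j0 \<in> J" "\<sigma> j0" by blast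
    have "(\<exists>y. cgr m y q \<and> (\<forall>j\<in>J. (y - s j e = 0) = \<sigma> j)) \<longleftrightarrow>
        cgr m (s j0 e) q \<and> (\<forall>j\<in>J. (s j0 e - s j e = 0) = \<sigma> j)" for e
      using j0 right_minus_eq[of _ "s j0 e"] by metis
    moreover have "qf (\<lambda>v. v = 0) (\<lambda>e. cgr m (s j0 e) q \<and> (\<forall>j\<in>J. (s j0 e - s j e = 0) = \<sigma> j))"
      by (intro qf_conj qf_cgr2 qf_ball qf_cl[where cl = "\<lambda>v. v = 0"] lin_diff lin_const s j0(1) J m)
    ultimately show ?thesis by simp
  next
    case False
    have "\<exists>y. cgr m y q \<and> (\<forall>j\<in>J. (y - s j e = 0) = \<sigma> j)" for e
    proof -
      obtain y where y: "y > Max (insert 0 ((\<lambda>j. s j e) ` J))" "cgr m y q"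
        using exists_congruent_above[OF g m] by blast
      have "y \<noteq> s j e" if "j \<in> J" for j
        using y(1) J that Max_ge[of "insert 0 ((\<lambda>j. s j e) ` J)" "s j e"] by auto
      then show ?thesis using y(2) False by auto
    qed
    then show ?thesis using qf_const[of "\<lambda>v. v = 0" True] by simp
  qed
qed (simp_all add: index)

text \<open>
  Upper sets with an end point in the divisible hull. In general this end point is not in the group.
\<close>

definition cut :: "'a::linordered_ab_group_add set \<Rightarrow> bool" where
  "cut U \<longleftrightarrow> (\<exists>k>0. \<exists>s. U = {x. s < int_multiple k x} \<or> U = {x. s \<le> int_multiple k x})"

definition controls :: "int \<Rightarrow> 'a::ab_group_add set set \<Rightarrow> 'a set \<Rightarrow> bool" where
  "controls n \<U> D \<longleftrightarrow>
     (\<forall>x x'. cgr n x x' \<and> (\<forall>U\<in>\<U>. x \<in> U \<longleftrightarrow> x' \<in> U) \<longrightarrow> (x \<in> D \<longleftrightarrow> x' \<in> D))"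

lemma cgr_1 [simp]: "cgr 1 x y"
  unfolding cgr_def by (rule exI[of _ "x - y"]) simp

text \<open>
  An inequality \<open>kx + u > 0\<close> is a cut or the complement of one, according to the sign of
  \<open>k\<close>. So the number of cuts is bounded by twice the number of atoms, for all values of the
  other variables.
\<close>

lemma qf_controlled:
  assumes "qf order_class P"
  shows "\<exists>n\<ge>1. \<exists>m. \<forall>e. \<exists>\<U>. finite \<U> \<and> card \<U> \<le> m \<and> (\<forall>U\<in>\<U>. cut U) \<and> controls n \<U> {x. P (e(i := x))}"
  using assms
proof induction
  case (qf_cl t c)
  then obtain k u where u: "\<And>e x. t (e(i := x)) = int_multiple k x + u e" using lin_split by blast
  have "\<exists>\<U>. finite \<U> \<and> card \<U> \<le> 2 \<and> (\<forall>U\<in>\<U>. cut U) \<and> controls 1 \<U> {x. order_class (t (e(i := x))) = c}" for e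
  proof -
    consider "k = 0" | "0 < k" | "k < 0" by linarith
    then show ?thesis
    proof cases
      case 1
      then show ?thesis unfolding u by (intro exI[of _ "{}"]) (simp add: controls_def)
    next
      case 2
      let ?U = "{x. - u e < int_multiple k x}" and ?V = "{x. - u e \<le> int_multiple k x}"
      have "order_class (int_multiple k x + u e) = (x \<in> ?U, x \<notin> ?V)" for x
        using diff_less_eq[of 0 "u e" "int_multiple k x"] less_diff_eq[of "int_multiple k x" 0 "u e"]
        unfolding order_class_def mem_Collect_eq not_le by simp
      then have "controls 1 {?U, ?V} {x. order_class (t (e(i := x))) = c}" unfolding u controls_def by simp
      moreover have "cut ?U" "cut ?V" unfolding cut_def using 2 by blast+
      ultimately show ?thesis by (intro exI[of _ "{?U, ?V}"]) (simp add: card_insert_if)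
    next
      case 3
      let ?U = "{x. u e < int_multiple (- k) x}" and ?V = "{x. u e \<le> int_multiple (- k) x}"
      have "order_class (int_multiple k x + u e) = (x \<notin> ?V, x \<in> ?U)" for x
        using diff_less_eq[of 0 "int_multiple k x" "u e"] less_diff_eq[of "u e" 0 "int_multiple k x"]
        unfolding order_class_def mem_Collect_eq not_le zmod.scale_minus_left by (simp add: add.commute)
      then have "controls 1 {?U, ?V} {x. order_class (t (e(i := x))) = c}" unfolding u controls_def by simp
      moreover have "cut ?U" "cut ?V" unfolding cut_def using 3 by (intro exI[of _ "- k"] exI[of _ "u e"]; simp)+
      ultimately show ?thesis by (intro exI[of _ "{?U, ?V}"]) (simp add: card_insert_if)
    qed
  qed
  then show ?case
    by (intro exI[where x = "1 :: int"] conjI exI[where x = "2 :: nat"] allI) (simp_all del: fun_upd_apply)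
next
  case (qf_cgr t n)
  then obtain k u where u: "\<And>e x. t (e(i := x)) = int_multiple k x + u e" using lin_split by blast
  have "cgr n (int_multiple k x + u e) 0 = cgr n (int_multiple k x' + u e) 0" if "cgr n x x'" for x x' e
    using cgr_trans[OF cgr_add[OF cgr_scale[OF that] cgr_refl]]
      cgr_trans[OF cgr_add[OF cgr_scale[OF cgr_sym[OF that]] cgr_refl]] by blast
  then have "controls n {} {x. cgr n (t (e(i := x))) 0}" for e unfolding u controls_def by simp
  then show ?case using qf_cgr(2)
    by (intro exI[where x = n] conjI exI[where x = "0 :: nat"] allI exI[of _ "{}"]) (simp_all del: fun_upd_apply)
next
  case (qf_not P)
  then show ?case by (simp add: controls_def)
next
  case (qf_conj P Q)
  then obtain n m n' m' where n: "1 \<le> n" "1 \<le> n'" and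
    P: "\<And>e. \<exists>\<U>. finite \<U> \<and> card \<U> \<le> m \<and> (\<forall>U\<in>\<U>. cut U) \<and> controls n \<U> {x. P (e(i := x))}" and
    Q: "\<And>e. \<exists>\<U>. finite \<U> \<and> card \<U> \<le> m' \<and> (\<forall>U\<in>\<U>. cut U) \<and> controls n' \<U> {x. Q (e(i := x))}"
    by blast
  have "\<exists>\<U>. finite \<U> \<and> card \<U> \<le> m + m' \<and> (\<forall>U\<in>\<U>. cut U) \<and>
      controls (n * n') \<U> {x. P (e(i := x)) \<and> Q (e(i := x))}" for e
  proof -
    obtain \<U> \<V> where U: "finite \<U>" "card \<U> \<le> m" "\<forall>U\<in>\<U>. cut U" "controls n \<U> {x. P (e(i := x))}"
      and V: "finite \<V>" "card \<V> \<le> m'" "\<forall>U\<in>\<V>. cut U" "controls n' \<V> {x. Q (e(i := x))}"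
      using P[of e] Q[of e] by blast
    have "card (\<U> \<union> \<V>) \<le> m + m'" using card_Un_le[of \<U> \<V>] U(2) V(2) by simp
    moreover have "controls (n * n') (\<U> \<union> \<V>) {x. P (e(i := x)) \<and> Q (e(i := x))}"
      unfolding controls_def
    proof (intro allI impI)
      fix x x' assume *: "cgr (n * n') x x' \<and> (\<forall>U\<in>\<U> \<union> \<V>. (x \<in> U) = (x' \<in> U))"
      have "x \<in> {x. P (e(i := x))} \<longleftrightarrow> x' \<in> {x. P (e(i := x))}"
        by (rule U(4)[unfolded controls_def, rule_format]) (use * cgr_dvd(2)[of n n' x x'] in simp)
      moreover have "x \<in> {x. Q (e(i := x))} \<longleftrightarrow> x' \<in> {x. Q (e(i := x))}"
        by (rule V(4)[unfolded controls_def, rule_format]) (use * cgr_dvd(1)[of n n' x x'] in simp)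
      ultimately show "x \<in> {x. P (e(i := x)) \<and> Q (e(i := x))} \<longleftrightarrow> x' \<in> {x. P (e(i := x)) \<and> Q (e(i := x))}"
        by simp
    qed
    ultimately show ?thesis using U(1,3) V(1,3) by (intro exI[of _ "\<U> \<union> \<V>"]) auto
  qed
  moreover have "1 * 1 \<le> n * n'" using n by (intro mult_mono) auto
  ultimately show ?case by (intro exI[of _ "n * n'"] conjI exI[of _ "m + m'"] allI) (simp_all del: fun_upd_apply)
qed

lemma qf_equality_periodic:
  fixes P :: "(nat \<Rightarrow> 'a::linordered_ab_group_add) \<Rightarrow> bool"
  assumes "qf (\<lambda>v. v = 0) P"
  shows "\<exists>n\<ge>1. \<exists>E. finite E \<and> (\<forall>x x'. cgr n x x' \<and> x \<notin> E \<and> x' \<notin> E \<longrightarrow> P (e(i := x)) = P (e(i := x')))"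
  using assms
proof induction
  case (qf_cl t c)
  then obtain k u where u: "\<And>x. t (e(i := x)) = int_multiple k x + u e" using lin_split by blast
  show ?case
  proof (cases "k = 0")
    case True
    then show ?thesis unfolding u by (intro exI[of _ 1] conjI exI[of _ "{}"]) simp_all
  next
    case False
    have "x = y" if "int_multiple k x + u e = 0" "int_multiple k y + u e = 0" for x y
    proof -
      have "int_multiple k x + u e = int_multiple k y + u e" unfolding that ..
      then have "int_multiple k x = int_multiple k y" by (simp only: add_right_cancel)
      then have "int_multiple \<bar>k\<bar> x = int_multiple \<bar>k\<bar> y"
        by (cases "0 < k") (simp_all add: abs_if zmod.scale_minus_left)
      then show ?thesis using int_multiple_mono_iff(3)[of "\<bar>k\<bar>" x y] False by simp
    qed
    then have "{x. int_multiple k x + u e = 0} \<subseteq> {SOME x. int_multiple k x + u e = 0}"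
      by (auto intro: someI2)
    then have "finite {x. int_multiple k x + u e = 0}" by (rule finite_subset) simp
    then show ?thesis unfolding u by (intro exI[of _ 1] conjI exI[of _ "{x. int_multiple k x + u e = 0}"]) simp_all
  qed
next
  case (qf_cgr t n)
  then obtain k u where u: "\<And>x. t (e(i := x)) = int_multiple k x + u e" using lin_split by blast
  have "cgr n (int_multiple k x + u e) 0 = cgr n (int_multiple k x' + u e) 0" if "cgr n x x'" for x x'
    using cgr_trans[OF cgr_add[OF cgr_scale[OF that] cgr_refl]]
      cgr_trans[OF cgr_add[OF cgr_scale[OF cgr_sym[OF that]] cgr_refl]] by blast
  then show ?case using qf_cgr(2) unfolding u
    by (intro exI[of _ n] conjI exI[of _ "{}"]) simp_all
next
  case (qf_not P)
  then show ?case by simp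
next
  case (qf_conj P Q)
  then obtain n E n' E' where n: "1 \<le> n" "1 \<le> n'" and
    E: "finite E" "\<And>x x'. cgr n x x' \<and> x \<notin> E \<and> x' \<notin> E \<Longrightarrow> P (e(i := x)) = P (e(i := x'))"
    "finite E'" "\<And>x x'. cgr n' x x' \<and> x \<notin> E' \<and> x' \<notin> E' \<Longrightarrow> Q (e(i := x)) = Q (e(i := x'))" by blast
  have "1 * 1 \<le> n * n'" using n by (intro mult_mono) auto
  then have nn: "1 \<le> n * n'" by simp
  have "(P (e(i := x)) \<and> Q (e(i := x))) = (P (e(i := x')) \<and> Q (e(i := x')))"
    if *: "cgr (n * n') x x' \<and> x \<notin> E \<union> E' \<and> x' \<notin> E \<union> E'" for x x'
  proof -
    have "P (e(i := x)) = P (e(i := x'))" by (rule E(2)) (use * cgr_dvd(2)[of n n' x x'] in simp)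
    moreover have "Q (e(i := x)) = Q (e(i := x'))" by (rule E(4)) (use * cgr_dvd(1)[of n n' x x'] in simp)
    ultimately show ?thesis by (simp only:)
  qed
  then have "\<forall>x x'. cgr (n * n') x x' \<and> x \<notin> E \<union> E' \<and> x' \<notin> E \<union> E' \<longrightarrow>
      (P (e(i := x)) \<and> Q (e(i := x))) = (P (e(i := x')) \<and> Q (e(i := x')))" by (intro allI impI)
  with finite_UnI[OF E(1,3)] nn show ?case
    by (intro exI[of _ "n * n'"] exI[of _ "E \<union> E'"] conjI)
qed

section \<open>Cuts and jumps of unary sets\<close>

lemma cut_upward: assumes "cut U" "x \<in> U" "x \<le> y" shows "y \<in> U"
proof -
  obtain k s where k: "0 < k" and U: "U = {x. s < int_multiple k x} \<or> U = {x. s \<le> int_multiple k x}"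
    using assms(1) unfolding cut_def by blast
  have "int_multiple k x \<le> int_multiple k y" using int_multiple_mono_iff(2)[OF k] assms(3) by blast
  then show ?thesis using U assms(2) by (auto intro: less_le_trans order_trans)
qed

lemma cut_linear: "cut U \<Longrightarrow> cut V \<Longrightarrow> U \<subseteq> V \<or> V \<subseteq> U"
  by (meson cut_upward linear subsetI)

lemma cut_affine:
  assumes "cut U" "1 \<le> n" shows "cut {x. r + int_multiple n x \<in> U}"
proof -
  obtain k s where k: "0 < k" and U: "U = {x. s < int_multiple k x} \<or> U = {x. s \<le> int_multiple k x}"
    using assms(1) unfolding cut_def by blast
  have "0 < k * n" using k assms(2) by simp
  have eq: "int_multiple k (r + int_multiple n x) = int_multiple k r + int_multiple (k * n) x" for x
    by (simp only: int_multiple_add_right zmod.scale_scale)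
  have "{x. r + int_multiple n x \<in> U} = {x. s - int_multiple k r < int_multiple (k * n) x} \<or>
      {x. r + int_multiple n x \<in> U} = {x. s - int_multiple k r \<le> int_multiple (k * n) x}"
    using U by (elim disjE) (simp_all add: eq diff_less_eq diff_le_eq add.commute)
  then show ?thesis unfolding cut_def using \<open>0 < k * n\<close> by blast
qed

lemma cut_translate: "cut U \<Longrightarrow> cut {x. x + c \<in> U}"
  using cut_affine[of U 1 c] by (simp add: add.commute)

text \<open>
  This is the second condition of \<open>regular_group\<close>: no cut is closed under subtracting a
  positive \<open>\<epsilon>\<close>.
\<close>

lemma cut_approximable:
  fixes U :: "'a::linordered_ab_group_add set"
  assumes reg: "regular_group TYPE('a)" and "cut U" "0 < \<epsilon>"
  shows "\<exists>x. x \<notin> U \<and> x + \<epsilon> \<in> U"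
proof -
  obtain k s where k: "0 < k" and U: "U = {x. s < int_multiple k x} \<or> U = {x. s \<le> int_multiple k x}"
    using assms(2) unfolding cut_def by blast
  have *: "\<exists>x. \<not> t < int_multiple k x \<and> t < int_multiple k (x + \<epsilon>)" for t
    using reg k \<open>0 < \<epsilon>\<close> unfolding regular_group_def by simp
  show ?thesis using U
  proof
    assume "U = {x. s < int_multiple k x}"
    then show ?thesis using *[of s] by simp
  next
    assume U: "U = {x. s \<le> int_multiple k x}"
    obtain y where y: "\<not> - s < int_multiple k y" "- s < int_multiple k (y + \<epsilon>)" using *[of "- s"] by blast
    have "int_multiple k (- (y + \<epsilon>)) < s" using y(2) unfolding zmod.scale_minus_right by (simp add: minus_less_iff)
    moreover have "s \<le> int_multiple k (- (y + \<epsilon>) + \<epsilon>)"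
      using y(1) by (simp add: not_less zmod.scale_minus_right le_minus_iff)
    ultimately show ?thesis unfolding U by (intro exI[of _ "- (y + \<epsilon>)"]) simp
  qed
qed

lemma exists_least_set:
  assumes "finite \<U>" "\<U> \<noteq> {}" "\<And>U V. U \<in> \<U> \<Longrightarrow> V \<in> \<U> \<Longrightarrow> U \<subseteq> V \<or> V \<subseteq> U"
  shows "\<exists>V\<in>\<U>. \<forall>U\<in>\<U>. V \<subseteq> U"
proof -
  obtain V where "V \<in> \<U>" "\<And>U. U \<in> \<U> \<Longrightarrow> U \<subseteq> V \<Longrightarrow> V = U"
    using finite_has_minimal[OF assms(1,2)] by blast
  then show ?thesis using assms(3) by blast
qed

definition upward :: "'a::order set \<Rightarrow> bool" where
  "upward W \<longleftrightarrow> (\<forall>x\<in>W. \<forall>y. x \<le> y \<longrightarrow> y \<in> W)"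

text \<open>
  At the lower end of \<open>V\<close> the set \<open>D\<close> changes from one side of the partition to
  the other, with infinite convex pieces \<open>W - V\<close> below and \<open>V\<close> above.
\<close>

definition jump :: "'a::linordered_ab_group_add set \<Rightarrow> 'a set \<Rightarrow> 'a set \<Rightarrow> bool" where
  "jump D V W \<longleftrightarrow> cut V \<and> upward W \<and> V \<subseteq> W \<and> infinite V \<and> infinite (W - V) \<and>
     (V \<subseteq> D \<and> (W - V) \<inter> D = {} \<or> V \<inter> D = {} \<and> W - V \<subseteq> D)"

text \<open>
  Among the sets that differ finitely from \<open>D\<close>, one that needs the least number of cuts is
  taken. Its topmost cut \<open>V\<close> cannot be dispensed with, so both pieces next to it are infinite
  and \<open>D'\<close> differs on them.
\<close>

lemma exists_jump:
  fixes D :: "'a::linordered_ab_group_add set"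
  assumes fin: "finite \<U>" and cuts: "\<forall>U\<in>\<U>. cut U" and ctrl: "controls 1 \<U> D"
    and inf: "infinite D" "infinite (- D)"
  shows "\<exists>D' V W. finite (D - D') \<and> finite (D' - D) \<and> jump D' V W"
proof -
  define S where "S k = (\<exists>\<U> D'. finite \<U> \<and> card \<U> = k \<and> (\<forall>U\<in>\<U>. cut U) \<and> controls 1 \<U> D' \<and>
      finite (D - D') \<and> finite (D' - D))" for k
  have "S (card \<U>)" unfolding S_def using fin cuts ctrl by (intro exI[of _ \<U>] exI[of _ D]) simp
  then have "S (LEAST k. S k)" by (rule LeastI)
  then obtain \<V> D' where V: "finite \<V>" "card \<V> = (LEAST k. S k)" "\<forall>U\<in>\<V>. cut U" "controls 1 \<V> D'"
    and D': "finite (D - D')" "finite (D' - D)"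
    unfolding S_def by blast
  have min: "\<not> S k" if "k < card \<V>" for k using that V(2) not_less_Least[of k S] by simp
  have "\<V> \<noteq> {}"
  proof
    assume "\<V> = {}"
    then have "D' = {} \<or> D' = UNIV" using V(4) by (auto simp: controls_def)
    then show False
    proof
      assume "D' = {}" then show False using D'(1) inf(1) by simp
    next
      assume "D' = UNIV" then show False using D'(2) inf(2) by (simp add: Compl_eq_Diff_UNIV)
    qed
  qed
  then obtain V where Vmin: "V \<in> \<V>" "\<And>U. U \<in> \<V> \<Longrightarrow> V \<subseteq> U"
    using exists_least_set[OF V(1)] V(3) cut_linear by meson
  define W where "W = \<Inter> (\<V> - {V})"
  have "V \<subseteq> W" using Vmin unfolding W_def by blast
  have same: "x \<in> D' \<longleftrightarrow> x' \<in> D'" if "\<forall>U\<in>\<V>. (x \<in> U) = (x' \<in> U)" for x x'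
    using V(4) that unfolding controls_def by simp
  have V_const: "V \<subseteq> D' \<or> V \<inter> D' = {}"
  proof -
    have "x \<in> D' \<longleftrightarrow> x' \<in> D'" if "x \<in> V" "x' \<in> V" for x x'
      by (rule same) (use that Vmin(2) in blast)
    then show ?thesis by blast
  qed
  have W_const: "W - V \<subseteq> D' \<or> (W - V) \<inter> D' = {}"
  proof -
    have "x \<in> D' \<longleftrightarrow> x' \<in> D'" if "x \<in> W - V" "x' \<in> W - V" for x x'
      by (rule same) (use that in \<open>auto simp: W_def\<close>)
    then show ?thesis by blast
  qed
  \<comment> \<open>Making the set constant on \<open>W\<close> would save the cut \<open>V\<close>, so this cannot be a finite change.\<close>
  have infinite_change: "\<not> (finite (D' - D2) \<and> finite (D2 - D'))"
    if D2: "D2 = (D' - W) \<union> (if c then W else {})" for c D2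
  proof
    assume D2_fin: "finite (D' - D2) \<and> finite (D2 - D')"
    have "x \<in> D2 \<longleftrightarrow> x' \<in> D2" if *: "\<forall>U\<in>\<V> - {V}. (x \<in> U) = (x' \<in> U)" for x x'
    proof (cases "x \<in> W")
      case True
      then have "x' \<in> W" using * unfolding W_def by blast
      then show ?thesis using True D2 by simp
    next
      case False
      then have "x' \<notin> W" using * unfolding W_def by blast
      then have "x \<notin> V" "x' \<notin> V" using False \<open>V \<subseteq> W\<close> by blast+
      then have "x \<in> D' \<longleftrightarrow> x' \<in> D'" using * by (intro same) blast
      then show ?thesis using False \<open>x' \<notin> W\<close> D2 by simp
    qed
    then have "controls 1 (\<V> - {V}) D2" unfolding controls_def by blast
    moreover have "finite (D - D2)"
      using finite_subset[of "D - D2" "(D - D') \<union> (D' - D2)"] D'(1) D2_fin by blast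
    moreover have "finite (D2 - D)"
      using finite_subset[of "D2 - D" "(D' - D) \<union> (D2 - D')"] D'(2) D2_fin by blast
    ultimately have "S (card (\<V> - {V}))"
      unfolding S_def using V(1,3) by (intro exI[of _ "\<V> - {V}"] exI[of _ D2]) simp
    moreover have "card (\<V> - {V}) < card \<V>" using V(1) Vmin(1) by (rule card_Diff1_less)
    ultimately show False using min by blast
  qed
  have "infinite (W - D')"
  proof
    assume f: "finite (W - D')"
    have eq: "D' - (D' - W \<union> W) = {}" "(D' - W \<union> W) - D' = W - D'" by blast+
    have "\<not> (finite (D' - (D' - W \<union> W)) \<and> finite ((D' - W \<union> W) - D'))"
      by (rule infinite_change[of _ True]) simp
    then show False unfolding eq using f by simp
  qed
  moreover have "infinite (W \<inter> D')"
  proof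
    assume f: "finite (W \<inter> D')"
    have eq: "D' - (D' - W) = W \<inter> D'" "(D' - W) - D' = {}" by blast+
    have "\<not> (finite (D' - (D' - W)) \<and> finite ((D' - W) - D'))"
      by (rule infinite_change[of _ False]) simp
    then show False unfolding eq using f by simp
  qed
  moreover have "W - D' = {} \<or> W \<inter> D' = {} \<or> W - D' = V \<and> W \<inter> D' = W - V \<or> W - D' = W - V \<and> W \<inter> D' = V"
    using V_const W_const \<open>V \<subseteq> W\<close> by blast
  ultimately have "W - D' = V \<and> W \<inter> D' = W - V \<or> W - D' = W - V \<and> W \<inter> D' = V"
    by (metis finite.emptyI)
  then have "infinite V \<and> infinite (W - V) \<and> (V \<subseteq> D' \<and> (W - V) \<inter> D' = {} \<or> V \<inter> D' = {} \<and> W - V \<subseteq> D')"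
  proof
    assume a: "W - D' = V \<and> W \<inter> D' = W - V"
    then have "infinite V" "infinite (W - V)" using \<open>infinite (W - D')\<close> \<open>infinite (W \<inter> D')\<close> by simp_all
    then show ?thesis using a by blast
  next
    assume a: "W - D' = W - V \<and> W \<inter> D' = V"
    then have "infinite V" "infinite (W - V)" using \<open>infinite (W - D')\<close> \<open>infinite (W \<inter> D')\<close> by simp_all
    then show ?thesis using a by blast
  qed
  moreover have "upward W"
    unfolding upward_def W_def using V(3) cut_upward by blast
  ultimately have "jump D' V W"
    unfolding jump_def using V(3) Vmin(1) \<open>V \<subseteq> W\<close> by blast
  then show ?thesis using D' by blast
qed

text \<open>
  The smallest difference between \<open>n + 2\<close> elements serves as \<open>\<epsilon>\<close>.
\<close>

lemma exists_long_progression: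
  fixes A :: "'a::linordered_ab_group_add set"
  assumes "infinite A"
  shows "\<exists>\<epsilon>>0. \<exists>a\<in>A. \<exists>b\<in>A. a + int_multiple (int n) \<epsilon> \<le> b"
proof -
  obtain B where B: "finite B" "card B = Suc (Suc n)" "B \<subseteq> A"
    using infinite_arbitrarily_large[OF assms] by blast
  define G where "G = {y - x |x y. x \<in> B \<and> y \<in> B \<and> x < y}"
  have "G \<subseteq> (\<lambda>(x, y). y - x) ` (B \<times> B)" unfolding G_def by auto
  then have "finite G" by (rule finite_subset) (simp add: B(1))
  obtain x where "x \<in> B" using B(2) by (metis card.empty ex_in_conv nat.distinct(1))
  moreover have "card (B - {x}) \<noteq> 0" using B(1,2) \<open>x \<in> B\<close> by simp
  then obtain y where "y \<in> B - {x}" by (metis card.empty ex_in_conv)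
  ultimately have "G \<noteq> {}"
  proof -
    have "x < y \<or> y < x" using \<open>y \<in> B - {x}\<close> by auto
    then show ?thesis using \<open>x \<in> B\<close> \<open>y \<in> B - {x}\<close> unfolding G_def by blast
  qed
  define \<epsilon> where "\<epsilon> = Min G"
  have "\<epsilon> \<in> G" unfolding \<epsilon>_def using \<open>finite G\<close> \<open>G \<noteq> {}\<close> by (rule Min_in)
  then have "0 < \<epsilon>" unfolding G_def by auto
  have step: "x + \<epsilon> \<le> y" if "x \<in> B" "y \<in> B" "x < y" for x y
  proof -
    have "\<epsilon> \<le> y - x" unfolding \<epsilon>_def using \<open>finite G\<close> by (rule Min_le) (use that in \<open>auto simp: G_def\<close>)
    then show ?thesis by (simp add: le_diff_eq add.commute)
  qed
  have "C \<subseteq> B \<Longrightarrow> C \<noteq> {} \<Longrightarrow> \<exists>a\<in>C. a + int_multiple (int (card C) - 1) \<epsilon> \<le> Max C" if "finite C" for C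
    using that
  proof (induction C rule: finite_linorder_max_induct)
    case (insert b C)
    show ?case
    proof (cases "C = {}")
      case False
      then obtain a where a: "a \<in> C" "a + int_multiple (int (card C) - 1) \<epsilon> \<le> Max C"
        using insert.IH insert.prems by blast
      have "b \<notin> C" using insert.hyps by blast
      then have "int (card (insert b C)) - 1 = (int (card C) - 1) + 1" using insert.hyps(1) by simp
      then have "a + int_multiple (int (card (insert b C)) - 1) \<epsilon> = (a + int_multiple (int (card C) - 1) \<epsilon>) + \<epsilon>"
        by (simp only: int_multiple_Suc add.assoc)
      also have "\<dots> \<le> Max C + \<epsilon>" using a(2) by simp
      also have "\<dots> \<le> b"
        using Max_in[OF insert.hyps(1) False] insert.prems insert.hyps(2) by (intro step) auto
      also have "b = Max (insert b C)"
        using insert.hyps by (intro Max_eqI[symmetric]) (auto intro: less_imp_le)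
      finally show ?thesis using a(1) by blast
    qed simp
  qed simp
  from this[OF B(1) subset_refl] obtain a where a: "a \<in> B" "a + int_multiple (int (card B) - 1) \<epsilon> \<le> Max B"
    using \<open>x \<in> B\<close> by blast
  have "a + int_multiple (int n) \<epsilon> \<le> a + int_multiple (int (card B) - 1) \<epsilon>"
    using int_multiple_mono_left(2)[OF \<open>0 < \<epsilon>\<close>] B(2) by simp
  then have "a + int_multiple (int n) \<epsilon> \<le> Max B" using a(2) by (rule order_trans)
  moreover have "Max B \<in> B" using B(1) a(1) by (intro Max_in) auto
  ultimately show ?thesis using \<open>0 < \<epsilon>\<close> a(1) B(3) by blast
qed

text \<open>
  Near the cut, choose \<open>x \<notin> V\<close> with \<open>x + \<epsilon> \<in> V\<close>. The steps
  \<open>x - k\<epsilon>\<close> with \<open>k < n\<close> stay in \<open>W - V\<close>, as that piece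
  contains a progression with this difference, and the steps \<open>x + k\<epsilon>\<close> with \<open>k
  \<ge> 1\<close> stay in \<open>V\<close>.
\<close>

lemma jump_ladder:
  fixes D :: "'a::linordered_ab_group_add set"
  assumes reg: "regular_group TYPE('a)" and "jump D V W"
  shows "\<exists>a b :: nat \<Rightarrow> 'a. \<forall>i<n. \<forall>j<n. if i < j then a i + b j \<in> W - V else a i + b j \<in> V"
proof -
  have V: "cut V" and W: "upward W" and "infinite (W - V)" using assms(2) unfolding jump_def by blast+
  obtain \<epsilon> c d where \<epsilon>: "0 < \<epsilon>" "c \<in> W - V" "d \<in> W - V" "c + int_multiple (int n) \<epsilon> \<le> d"
    using exists_long_progression[OF \<open>infinite (W - V)\<close>, of n] by blast
  obtain x where x: "x \<notin> V" "x + \<epsilon> \<in> V" using cut_approximable[OF reg V \<epsilon>(1)] by blast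
  have "V \<subseteq> W" using assms(2) unfolding jump_def by blast
  define z where "z k = x + int_multiple k \<epsilon>" for k
  have above: "z k \<in> V" if "1 \<le> k" for k
  proof (rule cut_upward[OF V x(2)])
    show "x + \<epsilon> \<le> z k" unfolding z_def using int_multiple_mono_left(2)[OF \<epsilon>(1), of 1 k] that by simp
  qed
  have below: "z k \<in> W - V" if "- int n \<le> k - 1" "k \<le> 0" for k
  proof
    have "z k \<le> x" unfolding z_def using int_multiple_mono_left(2)[OF \<epsilon>(1), of k 0] that by simp
    then show "z k \<notin> V" using x(1) cut_upward[OF V] by blast
    have "c + int_multiple (int n) \<epsilon> \<notin> V" using \<epsilon>(3,4) cut_upward[OF V] by blast
    then have "c + int_multiple (int n) \<epsilon> < x + \<epsilon>" using x(2) cut_upward[OF V] by (meson not_less)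
    moreover have "c + int_multiple (1 - k) \<epsilon> \<le> c + int_multiple (int n) \<epsilon>"
      using int_multiple_mono_left(2)[OF \<epsilon>(1)] that(1) by simp
    ultimately have "c + int_multiple (1 - k) \<epsilon> < x + \<epsilon>" by (rule le_less_trans[rotated])
    then have "c < z k" by (simp add: z_def zmod.scale_left_diff_distrib algebra_simps)
    then show "z k \<in> W" using W \<epsilon>(2) unfolding upward_def by (meson DiffD1 less_imp_le)
  qed
  have "\<forall>i<n. \<forall>j<n. if i < j then int_multiple (int i) \<epsilon> + (x + int_multiple (1 - int j) \<epsilon>) \<in> W - V
        else int_multiple (int i) \<epsilon> + (x + int_multiple (1 - int j) \<epsilon>) \<in> V"
  proof (intro allI impI)
    fix i j assume "i < n" "j < n"
    have "int_multiple (int i) \<epsilon> + (x + int_multiple (1 - int j) \<epsilon>) = z (int i + (1 - int j))"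
      unfolding z_def int_multiple_add_left by (simp only: add.left_commute)
    then show "if i < j then int_multiple (int i) \<epsilon> + (x + int_multiple (1 - int j) \<epsilon>) \<in> W - V
        else int_multiple (int i) \<epsilon> + (x + int_multiple (1 - int j) \<epsilon>) \<in> V"
      using above[of "int i + (1 - int j)"] below[of "int i + (1 - int j)"] \<open>j < n\<close> by simp
  qed
  then show ?thesis by (intro exI)
qed

definition coset_like :: "'a::ab_group_add set \<Rightarrow> bool" where
  "coset_like D \<longleftrightarrow> (\<exists>n\<ge>1. \<forall>r. finite {x \<in> D. cgr n x r} \<or> finite {x. x \<notin> D \<and> cgr n x r})"

lemma infinite_congruent_class:
  fixes A :: "'a::ab_group_add set"
  assumes "small_index TYPE('a)" "1 \<le> n" "infinite A"
  shows "\<exists>r. infinite {x \<in> A. cgr n x r}"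
proof (rule ccontr)
  assume finite_classes: "\<not> ?thesis"
  obtain R :: "'a set" where R: "finite R" "\<forall>x. \<exists>r\<in>R. cgr n x r"
    using assms(1,2) unfolding small_index_def by blast
  have "finite (\<Union>r\<in>R. {x \<in> A. cgr n x r})" using finite_classes R(1) by simp
  moreover have "A \<subseteq> (\<Union>r\<in>R. {x \<in> A. cgr n x r})" using R(2) by blast
  ultimately show False using assms(3) finite_subset by blast
qed

lemma infinite_congruent_above:
  fixes b :: "'a::linordered_ab_group_add"
  assumes "0 < (g :: 'a)" "1 \<le> n"
  shows "infinite {x. b \<le> x \<and> cgr n x r}"
proof
  assume f: "finite {x. b \<le> x \<and> cgr n x r}"
  obtain y where y: "y > Max (insert b {x. b \<le> x \<and> cgr n x r})" "cgr n y r"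
    using exists_congruent_above[OF assms] by blast
  have "b < y" using y(1) f by simp
  then have "y \<in> {x. b \<le> x \<and> cgr n x r}" using y(2) by simp
  then have "y \<le> Max (insert b {x. b \<le> x \<and> cgr n x r})" using f by (intro Max_ge) auto
  then show False using y(1) by simp
qed

lemma infinite_congruent_below:
  fixes b :: "'a::linordered_ab_group_add"
  assumes "0 < (g :: 'a)" "1 \<le> n"
  shows "infinite {x. x \<le> b \<and> cgr n x r}"
proof
  assume "finite {x. x \<le> b \<and> cgr n x r}"
  then have "finite (uminus ` {x. x \<le> b \<and> cgr n x r})" by (rule finite_imageI)
  moreover have "{x. - b \<le> x \<and> cgr n x (- r)} \<subseteq> uminus ` {x. x \<le> b \<and> cgr n x r}"
  proof
    fix x assume "x \<in> {x. - b \<le> x \<and> cgr n x (- r)}"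
    then have "- x \<le> b" "cgr n (- x) r" using cgr_minus[of n x "- r"] by (auto simp: minus_le_iff)
    then show "x \<in> uminus ` {x. x \<le> b \<and> cgr n x r}" by (intro image_eqI[of _ _ "- x"]) simp_all
  qed
  ultimately show False using infinite_congruent_above[OF assms, of "- b" "- r"] finite_subset by blast
qed

text \<open>
  Some coset meets the lower piece infinitely often, and every coset meets the unbounded upper piece
  infinitely often.
\<close>

lemma jump_not_coset_like:
  fixes D :: "'a::linordered_ab_group_add set"
  assumes index: "small_index TYPE('a)" and g: "0 < (g :: 'a)"
    and fin: "finite (D - D')" "finite (D' - D)" and "jump D' V W"
  shows "\<not> coset_like D"
proof
  assume "coset_like D"
  then obtain n where n: "1 \<le> n" "\<And>r. finite {x \<in> D. cgr n x r} \<or> finite {x. x \<notin> D \<and> cgr n x r}"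
    unfolding coset_like_def by blast
  have V: "cut V" "infinite V" "infinite (W - V)"
    "V \<subseteq> D' \<and> (W - V) \<inter> D' = {} \<or> V \<inter> D' = {} \<and> W - V \<subseteq> D'"
    using assms(5) unfolding jump_def by blast+
  obtain r where r: "infinite {x \<in> W - V. cgr n x r}"
    using infinite_congruent_class[OF index n(1) V(3)] by blast
  obtain v where "v \<in> V" using V(2) by (metis ex_in_conv finite.emptyI)
  then have "{x. v \<le> x \<and> cgr n x r} \<subseteq> {x \<in> V. cgr n x r}" using cut_upward[OF V(1)] by blast
  then have r': "infinite {x \<in> V. cgr n x r}"
    using infinite_congruent_above[OF g n(1)] finite_subset by blast
  have D: "infinite {x \<in> D. cgr n x r}" if "A \<subseteq> D'" "infinite {x \<in> A. cgr n x r}" for A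
  proof
    assume "finite {x \<in> D. cgr n x r}"
    then have "finite ({x \<in> D. cgr n x r} \<union> (D' - D))" using fin by simp
    moreover have "{x \<in> A. cgr n x r} \<subseteq> {x \<in> D. cgr n x r} \<union> (D' - D)" using that(1) by blast
    ultimately show False using that(2) finite_subset by blast
  qed
  have not_D: "infinite {x. x \<notin> D \<and> cgr n x r}" if "A \<inter> D' = {}" "infinite {x \<in> A. cgr n x r}" for A
  proof
    assume "finite {x. x \<notin> D \<and> cgr n x r}"
    then have "finite ({x. x \<notin> D \<and> cgr n x r} \<union> (D - D'))" using fin by simp
    moreover have "{x \<in> A. cgr n x r} \<subseteq> {x. x \<notin> D \<and> cgr n x r} \<union> (D - D')" using that(1) by blast
    ultimately show False using that(2) finite_subset by blast
  qed
  show False using V(4) n(2)[of r] D[OF _ r] D[OF _ r'] not_D[OF _ r] not_D[OF _ r'] by blast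
qed

section \<open>Uniform bounds from unary definability\<close>

abbreviation env_cons :: "'a \<Rightarrow> (nat \<Rightarrow> 'a) \<Rightarrow> nat \<Rightarrow> 'a" (infixr "##" 65) where
  "x ## e \<equiv> case_nat x e"

lemma covered_eq: "covered (=) K A \<longleftrightarrow> finite {x. A x} \<and> card {x. A x} \<le> K"
proof
  assume "covered (=) K A"
  then obtain R where R: "finite R" "card R \<le> K" "{x. A x} \<subseteq> R" unfolding covered_def by blast
  then show "finite {x. A x} \<and> card {x. A x} \<le> K"
    using finite_subset[OF R(3,1)] card_mono[OF R(1,3)] by simp
qed (auto simp: covered_def)

text \<open>
  A predicate stands for the family of the sets \<open>{x. P (x ## e)}\<close> with parameters
  \<open>e\<close>; neither \<open>n\<close> nor the number of exceptions depends on the parameters.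
\<close>

definition uniformly_coset_like :: "((nat \<Rightarrow> 'a::ab_group_add) \<Rightarrow> bool) \<Rightarrow> bool" where
  "uniformly_coset_like P \<longleftrightarrow> (\<exists>n\<ge>1. \<exists>K. \<forall>e r.
     covered (=) K (\<lambda>x. cgr n x r \<and> P (x ## e)) \<or> covered (=) K (\<lambda>x. cgr n x r \<and> \<not> P (x ## e)))"

lemma discrete_interval:
  fixes u :: "'a::linordered_ab_group_add"
  assumes u: "0 < u" "\<And>x. 0 < x \<Longrightarrow> u \<le> x"
  shows "0 \<le> y \<Longrightarrow> y \<le> int_multiple (int \<tau>) u \<Longrightarrow> \<exists>i\<le>\<tau>. y = int_multiple (int i) u"
proof (induction \<tau> arbitrary: y)
  case 0
  then show ?case by simp
next
  case (Suc \<tau>)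
  show ?case
  proof (cases "y = 0")
    case True
    then show ?thesis by (intro exI[of _ 0]) simp
  next
    case False
    then have "0 \<le> y - u" using u(2)[of y] Suc.prems(1) by simp
    moreover have "int (Suc \<tau>) = int \<tau> + 1" by simp
    then have "y - u \<le> int_multiple (int \<tau>) u"
      using Suc.prems(2) by (simp only: int_multiple_Suc diff_le_eq)
    ultimately obtain i where i: "i \<le> \<tau>" "y - u = int_multiple (int i) u" using Suc.IH by blast
    have "int (Suc i) = int i + 1" by simp
    then have "y = int_multiple (int (Suc i)) u" using i(2) by (simp only: int_multiple_Suc diff_eq_eq)
    then show ?thesis using i(1) by blast
  qed
qed

lemma exists_disjoint_translate:
  fixes A :: "'a::linordered_ab_group_add set"
  assumes "finite A" "0 < (g :: 'a)"
  shows "\<exists>c. \<forall>x\<in>A. x + c \<notin> A"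
proof (cases "A = {}")
  case False
  have "x + (Max A - Min A + g) \<notin> A" if "x \<in> A" for x
  proof
    assume "x + (Max A - Min A + g) \<in> A"
    then have "x + (Max A - Min A + g) \<le> Max A" using assms(1) by simp
    moreover have "Min A \<le> x" using assms(1) that by simp
    then have "Max A + g \<le> x + (Max A - Min A + g)" by (simp add: algebra_simps)
    ultimately have "Max A + g \<le> Max A" by (rule order_trans[rotated])
    then show False using assms(2) by simp
  qed
  then show ?thesis by blast
qed simp

text \<open>
  A set of cuts distinguishes at most as many positions as it has subsets.
\<close>

lemma card_le_regions:
  fixes A :: "'a::linordered_ab_group_add set"
  assumes "finite \<U>" "card \<U> \<le> m"
    and "\<And>x y. x \<in> A \<Longrightarrow> y \<in> A \<Longrightarrow> x < y \<Longrightarrow> \<forall>U\<in>\<U>. x \<in> U \<longleftrightarrow> y \<in> U \<Longrightarrow> False"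
  shows "card A \<le> 2 ^ m"
proof -
  have "inj_on (\<lambda>x. {U \<in> \<U>. x \<in> U}) A"
  proof (rule inj_onI)
    fix x y assume xy: "x \<in> A" "y \<in> A" "{U \<in> \<U>. x \<in> U} = {U \<in> \<U>. y \<in> U}"
    then have "\<forall>U\<in>\<U>. x \<in> U \<longleftrightarrow> y \<in> U" by blast
    then show "x = y" using assms(3)[of x y] assms(3)[of y x] xy(1,2) by (metis linorder_neqE)
  qed
  then have "card A \<le> card (Pow \<U>)"
    by (rule card_inj_on_le) (use assms(1) in auto)
  also have "\<dots> \<le> 2 ^ m" using assms(2) by (simp add: card_Pow[OF assms(1)] power_increasing)
  finally show ?thesis .
qed

lemma region_convex:
  assumes "\<forall>U\<in>\<U>. cut U" "\<forall>U\<in>\<U>. x \<in> U \<longleftrightarrow> y \<in> U" "x \<le> z" "z \<le> y"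
  shows "\<forall>U\<in>\<U>. x \<in> U \<longleftrightarrow> z \<in> U"
  using assms cut_upward by meson

text \<open>
  The consequences of quantifier elimination for a structure \<open>M\<close> definable in the ordered
  group. Only nontrivial groups are considered.
\<close>

locale tame =
  fixes M :: "('f, 'r, 'a::linordered_ab_group_add) fo_struct" and g :: 'a
  assumes index: "small_index TYPE('a)" and regular: "regular_group TYPE('a)" and g: "0 < g"
    and controlled: "same_formula (enriched id M) (enriched id M) P P \<Longrightarrow>
      \<exists>n\<ge>1. \<exists>m. \<forall>e. \<exists>\<U>. finite \<U> \<and> card \<U> \<le> m \<and> (\<forall>U\<in>\<U>. cut U) \<and> controls n \<U> {x. P (x ## e)}"
begin

abbreviation definable_rel :: "((nat \<Rightarrow> 'a) \<Rightarrow> bool) \<Rightarrow> bool" where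
  "definable_rel P \<equiv> same_formula (enriched id M) (enriched id M) P P"

lemmas closure_rules = term_var term_id term_plus term_case_nat

lemma controls_affine:
  fixes \<U> :: "'a set set"
  assumes "controls n \<U> D" "1 \<le> n"
  shows "controls 1 ((\<lambda>U. {x. r + int_multiple n x \<in> U}) ` \<U>) {x. r + int_multiple n x \<in> D}"
  unfolding controls_def
proof (intro allI impI)
  fix x x' :: 'a
  assume *: "cgr 1 x x' \<and> (\<forall>U\<in>(\<lambda>U. {x. r + int_multiple n x \<in> U}) ` \<U>. (x \<in> U) = (x' \<in> U))"
  have "cgr n (r + int_multiple n x) (r + int_multiple n x')"
    unfolding cgr_def by (intro exI[of _ "x - x'"]) (simp add: zmod.scale_right_diff_distrib)
  then have "r + int_multiple n x \<in> D \<longleftrightarrow> r + int_multiple n x' \<in> D"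
    using assms(1) * unfolding controls_def by simp
  then show "(x \<in> {x. r + int_multiple n x \<in> D}) = (x' \<in> {x. r + int_multiple n x \<in> D})" by simp
qed

text \<open>
  Inside a coset that \<open>D\<close> splits into two infinite parts, the congruence condition is void;
  so \<open>x \<mapsto> r + nx\<close> pulls \<open>D\<close> back to a set that the cuts alone control.
\<close>

lemma exists_jump_affine:
  assumes "definable_rel (\<lambda>e. e 0 \<in> D)" "\<not> coset_like D"
  shows "\<exists>D' V W. definable_rel (\<lambda>e. e 0 \<in> D') \<and> jump D' V W"
proof -
  obtain n m where n: "1 \<le> n" and ctrl: "\<forall>e. \<exists>\<U>. finite \<U> \<and> card \<U> \<le> m \<and> (\<forall>U\<in>\<U>. cut U) \<and>
      controls n \<U> {x. (x ## e) 0 \<in> D}" using controlled[OF assms(1)] by blast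
  obtain \<U> where U: "finite \<U>" "\<forall>U\<in>\<U>. cut U" "controls n \<U> D"
    using ctrl by auto
  obtain r where r: "infinite {x \<in> D. cgr n x r}" "infinite {x. x \<notin> D \<and> cgr n x r}"
    using assms(2) n unfolding coset_like_def by blast
  define E where "E = {x. r + int_multiple n x \<in> D}"
  have "{x \<in> D. cgr n x r} \<subseteq> (\<lambda>x. r + int_multiple n x) ` E" unfolding E_def cgr_def by blast
  then have "infinite E" using r(1) by (meson finite_imageI finite_subset)
  have "{x. x \<notin> D \<and> cgr n x r} \<subseteq> (\<lambda>x. r + int_multiple n x) ` (- E)" unfolding E_def cgr_def by blast
  then have "infinite (- E)" using r(2) by (meson finite_imageI finite_subset)
  have "finite ((\<lambda>U. {x. r + int_multiple n x \<in> U}) ` \<U>)" using U(1) by simp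
  moreover have "\<forall>U\<in>(\<lambda>U. {x. r + int_multiple n x \<in> U}) ` \<U>. cut U" using U(2) cut_affine[OF _ n] by blast
  moreover have "controls 1 ((\<lambda>U. {x. r + int_multiple n x \<in> U}) ` \<U>) E"
    unfolding E_def by (rule controls_affine[OF U(3) n])
  ultimately obtain D' V W where D': "finite (E - D')" "finite (D' - E)" "jump D' V W"
    using exists_jump \<open>infinite E\<close> \<open>infinite (- E)\<close> by meson
  have mult: "same_term (enriched id M) (enriched id M) (\<lambda>e. int_multiple n (e 0)) (\<lambda>e. int_multiple n (e 0))"
    by (rule term_mult) (rule term_plus term_var n | assumption)+
  have "definable_rel (\<lambda>e. (\<lambda>i. r + int_multiple n (e 0)) 0 \<in> D)"
    by (rule formula_subst[OF assms(1)]) (rule term_plus[OF term_id mult])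
  then have E: "definable_rel (\<lambda>e. e 0 \<in> E)" unfolding E_def mem_Collect_eq .
  have "definable_rel (\<lambda>e. (e 0 \<in> E \<and> (\<forall>a\<in>E - D'. \<not> e 0 = a)) \<or> \<not> (\<forall>b\<in>D' - E. \<not> e 0 = b))"
    by (intro formula_disj formula_conj formula_not formula_ball formula_eq term_var term_id E D'(1,2))
  moreover have "(e 0 \<in> E \<and> (\<forall>a\<in>E - D'. \<not> e 0 = a)) \<or> \<not> (\<forall>b\<in>D' - E. \<not> e 0 = b) \<longleftrightarrow> e 0 \<in> D'" for e :: "nat \<Rightarrow> 'a"
    by blast
  ultimately have "definable_rel (\<lambda>e. e 0 \<in> D')" by simp
  then show ?thesis using D'(3) by blast
qed

end

text \<open>
  Condition (2), given the description of the unary sets definable in the pure group.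
\<close>

locale tame_coset_like = tame M g
  for M :: "('f, 'r, 'a::linordered_ab_group_add) fo_struct" and g :: 'a +
  assumes unary: "\<And>D. definable_rel (\<lambda>e. e 0 \<in> D) \<Longrightarrow> coset_like D"
begin

lemma finite_if_bounded_below:
  assumes "definable_rel (\<lambda>e. e 0 \<in> S)" "\<And>x. x \<in> S \<Longrightarrow> b \<le> x"
  shows "finite S"
proof (rule ccontr)
  assume S: "infinite S"
  obtain n where n: "1 \<le> n" "\<And>r. finite {x \<in> S. cgr n x r} \<or> finite {x. x \<notin> S \<and> cgr n x r}"
    using unary[OF assms(1)] unfolding coset_like_def by blast
  obtain r where r: "infinite {x \<in> S. cgr n x r}" using infinite_congruent_class[OF index n(1) S] by blast
  then have fin: "finite {x. x \<notin> S \<and> cgr n x r}" using n(2)[of r] by blast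
  have "{x. x \<le> b - g \<and> cgr n x r} \<subseteq> {x. x \<notin> S \<and> cgr n x r}"
  proof
    fix x assume x: "x \<in> {x. x \<le> b - g \<and> cgr n x r}"
    have "b - g < b" using g by simp
    then have "x < b" using x by (auto intro: le_less_trans)
    then have "x \<notin> S" using assms(2) by (meson not_less)
    then show "x \<in> {x. x \<notin> S \<and> cgr n x r}" using x by simp
  qed
  then show False using infinite_congruent_below[OF g n(1), of "b - g" r] fin finite_subset by blast
qed

context
  fixes u :: 'a assumes u: "0 < u" and least: "\<And>x. 0 < x \<Longrightarrow> u \<le> x"
begin

text \<open>
  The environment lists \<open>v\<close>, \<open>d\<close>, \<open>l\<close>, \<open>r\<close> and then
  parameters. The predicate says that the intersection \<open>X\<close> of the fibre and its translate by
  \<open>- d\<close> has \<open>l\<close> as its only left end and \<open>r = l + v\<close> as its only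
  right end. For finite \<open>X\<close> this makes \<open>X\<close> the interval from \<open>l\<close> to
  \<open>r\<close>, although the order does not occur in it.
\<close>

definition interval_lengths :: "((nat \<Rightarrow> 'a) \<Rightarrow> bool) \<Rightarrow> (nat \<Rightarrow> 'a) \<Rightarrow> bool" where
  "interval_lengths P e \<longleftrightarrow>
     (let X = (\<lambda>x. P (x ## (\<lambda>i. e (i + 4))) \<and> P ((x + e 1) ## (\<lambda>i. e (i + 4)))) in
        e 3 = e 2 + e 0 \<and> X (e 2) \<and> X (e 3) \<and>
        (\<forall>x. X x \<longrightarrow> X (x + u) \<or> x = e 3) \<and> (\<forall>x. X (x + u) \<longrightarrow> X x \<or> x + u = e 2))"

lemma definable_interval_lengths:
  assumes P: "definable_rel P" shows "definable_rel (interval_lengths P)"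
  unfolding interval_lengths_def[abs_def] Let_def
  by (intro formula_conj formula_all formula_imp formula_disj formula_eq formula_subst[OF P] closure_rules)

definition lengths :: "((nat \<Rightarrow> 'a) \<Rightarrow> bool) \<Rightarrow> 'a set" where
  "lengths P = {v. \<exists>e. interval_lengths P (v ## e)}"

text \<open>
  In a finite set the maximum is a right end. So \<open>r\<close> is the maximum, the length \<open>r -
  l\<close> is not negative, and a coset-like set that is bounded below is finite.
\<close>

lemma finite_lengths:
  assumes "definable_rel P" and fin: "\<And>e. finite {x. P (x ## e)}"
  shows "finite (lengths P)"
proof (rule finite_if_bounded_below)
  show "definable_rel (\<lambda>e. e 0 \<in> lengths P)"
    unfolding lengths_def mem_Collect_eq by (rule formula_ex_env[OF definable_interval_lengths[OF assms(1)]])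
next
  fix v assume "v \<in> lengths P"
  then obtain e where e: "interval_lengths P (v ## e)" unfolding lengths_def by blast
  define d l r where "d = (v ## e) 1" and "l = (v ## e) 2" and "r = (v ## e) 3"
  define f where "f i = (v ## e) (i + 4)" for i
  define X where "X = {x. P (x ## f) \<and> P ((x + d) ## f)}"
  have "r = l + v \<and> l \<in> X \<and> r \<in> X \<and> (\<forall>x. x \<in> X \<longrightarrow> x + u \<in> X \<or> x = r) \<and>
      (\<forall>x. x + u \<in> X \<longrightarrow> x \<in> X \<or> x + u = l)"
    using e unfolding interval_lengths_def Let_def d_def[symmetric] l_def[symmetric] r_def[symmetric]
      f_def[symmetric] X_def mem_Collect_eq nat.case .
  then have X: "r = l + v" "l \<in> X" "r \<in> X" "\<And>x. x \<in> X \<Longrightarrow> x + u \<in> X \<or> x = r" by blast+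
  have "finite X" using fin[of f] unfolding X_def by (rule rev_finite_subset) blast
  have "Max X \<in> X" using \<open>finite X\<close> X(2) by (intro Max_in) auto
  moreover have "Max X + u \<notin> X"
  proof
    assume "Max X + u \<in> X"
    with \<open>finite X\<close> have "Max X + u \<le> Max X" by (rule Max_ge)
    then show False using u by simp
  qed
  ultimately have "Max X = r" using X(4) by blast
  then have "l \<le> r" using \<open>finite X\<close> X(2) by auto
  then show "0 \<le> v" using X(1) by simp
qed

text \<open>
  A finite set whose first and last runs have length at least \<open>\<tau>\<close> meets its translate by
  \<open>\<tau>\<close> less than its diameter in an interval of length exactly \<open>\<tau>\<close>.
\<close>

lemma multiple_in_lengths:
  assumes l: "l = Min {x. P (x ## e)}" and r: "r = Max {x. P (x ## e)}"
    and F: "finite {x. P (x ## e)}" "{x. P (x ## e)} \<noteq> {}"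
    and left: "\<And>i. i \<le> \<tau> \<Longrightarrow> P ((l + int_multiple (int i) u) ## e)"
    and right: "\<And>i. i \<le> \<tau> \<Longrightarrow> P ((r - int_multiple (int i) u) ## e)"
  shows "int_multiple (int \<tau>) u \<in> lengths P"
proof -
  define v where "v = int_multiple (int \<tau>) u"
  define d where "d = r - l - v"
  define X where "X x = (P (x ## e) \<and> P ((x + d) ## e))" for x
  have X_iff: "X x \<longleftrightarrow> (\<exists>i\<le>\<tau>. x = l + int_multiple (int i) u)" for x
  proof
    assume "X x"
    then have "l \<le> x" "x + d \<le> r" unfolding X_def l r using F(1) by simp_all
    then have "0 \<le> x - l" "x - l \<le> v" unfolding d_def by (simp_all add: algebra_simps)
    then obtain i where "i \<le> \<tau>" "x - l = int_multiple (int i) u"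
      using discrete_interval[OF u least] unfolding v_def by blast
    then show "\<exists>i\<le>\<tau>. x = l + int_multiple (int i) u" by (intro exI[of _ i]) (simp add: algebra_simps)
  next
    assume "\<exists>i\<le>\<tau>. x = l + int_multiple (int i) u"
    then obtain i where i: "i \<le> \<tau>" "x = l + int_multiple (int i) u" by blast
    have "x + d = r - (v - int_multiple (int i) u)" unfolding d_def i(2) by simp
    also have "v - int_multiple (int i) u = int_multiple (int (\<tau> - i)) u"
      unfolding v_def using i(1) by (simp add: of_nat_diff zmod.scale_left_diff_distrib)
    finally show "X x" unfolding X_def using left[OF i(1)] right[of "\<tau> - i"] i(2) by simp
  qed
  have Suc: "int_multiple (int i) u + u = int_multiple (int (Suc i)) u" for i
    using int_multiple_Suc[of "int i" u] by (simp add: add.commute)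
  have "X x \<Longrightarrow> X (x + u) \<or> x = l + v" for x
  proof -
    assume "X x"
    then obtain i where i: "i \<le> \<tau>" "x = l + int_multiple (int i) u" using X_iff by blast
    show ?thesis
    proof (cases "i = \<tau>")
      case True
      then show ?thesis using i(2) unfolding v_def by simp
    next
      case False
      then have "x + u = l + int_multiple (int (Suc i)) u" "Suc i \<le> \<tau>" using i Suc by (simp_all add: add.assoc)
      then show ?thesis using X_iff by blast
    qed
  qed
  moreover have "X (x + u) \<Longrightarrow> X x \<or> x + u = l" for x
  proof -
    assume "X (x + u)"
    then obtain i where i: "i \<le> \<tau>" "x + u = l + int_multiple (int i) u" using X_iff by blast
    show ?thesis
    proof (cases i)
      case 0
      then show ?thesis using i(2) by simp
    next
      case (Suc k)
      then have "x + u = (l + int_multiple (int k) u) + u" using i(2) \<open>\<And>i. int_multiple (int i) u + u = _\<close>[of k] by (simp add: add.assoc)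
      then have "x = l + int_multiple (int k) u" by simp
      then show ?thesis using X_iff i(1) Suc by (metis Suc_leD)
    qed
  qed
  moreover have "X l" "X (l + v)" using X_iff by (metis add_0_right bot_nat_0.extremum int_multiple_0 of_nat_0, metis order_refl v_def)
  ultimately have "interval_lengths P (v ## d ## l ## (l + v) ## e)"
    unfolding interval_lengths_def Let_def X_def by (simp add: numeral_2_eq_2 numeral_3_eq_3 eval_nat_numeral)
  then show ?thesis unfolding lengths_def v_def by blast
qed

text \<open>
  Induction on the number \<open>m\<close> of runs. Only finitely many lengths of intervals arise, so in
  every fibre the first or the last run is shorter than some \<open>T\<close>. Keeping only the points
  that start a progression of \<open>T\<close> further points removes this run, and it shortens the others
  by \<open>T\<close>.
\<close>

lemma runs_bounded:
  assumes "definable_rel P" and "\<And>e. finite {x. P (x ## e)}"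
    and "\<And>e. card {x. P (x ## e) \<and> \<not> P ((x + u) ## e)} \<le> m"
  shows "\<exists>K. \<forall>e. card {x. P (x ## e)} \<le> K"
  using assms
proof (induction m arbitrary: P)
  case 0
  have "{x. P (x ## e)} = {}" for e
  proof (rule ccontr)
    assume ne: "{x. P (x ## e)} \<noteq> {}"
    define x where "x = Max {x. P (x ## e)}"
    have "x \<in> {x. P (x ## e)}" unfolding x_def using 0(2) ne by (rule Max_in)
    moreover have "\<not> P ((x + u) ## e)"
    proof
      assume "P ((x + u) ## e)"
      then have "x + u \<le> x" using Max_ge[OF 0(2)[of e], of "x + u"] unfolding x_def by simp
      then show False using u by simp
    qed
    ultimately have "x \<in> {x. P (x ## e) \<and> \<not> P ((x + u) ## e)}" by simp
    moreover have "finite {x. P (x ## e) \<and> \<not> P ((x + u) ## e)}"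
      by (rule finite_subset[OF _ 0(2)[of e]]) blast
    ultimately have "0 < card {x. P (x ## e) \<and> \<not> P ((x + u) ## e)}" unfolding card_gt_0_iff by blast
    then show False using 0(3)[of e] by simp
  qed
  then show ?case by (intro exI[of _ 0]) simp
next
  case (Suc m)
  have "inj (\<lambda>\<tau>. int_multiple (int \<tau>) u)"
    using int_multiple_mono_left(3)[OF u] by (intro injI) simp
  then have "finite ((\<lambda>\<tau>. int_multiple (int \<tau>) u) -` lengths P)"
    using finite_lengths[OF Suc.prems(1,2)] by (rule finite_vimageI[rotated])
  then obtain T where T: "\<And>\<tau>. int_multiple (int \<tau>) u \<in> lengths P \<Longrightarrow> \<tau> < T"
    unfolding finite_nat_set_iff_bounded by auto
  define F where "F e = {x. P (x ## e)}" for e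
  define right_ends where "right_ends e = {x \<in> F e. x + u \<notin> F e}" for e
  \<comment> \<open>The core of the fibre; \<open>core\<close> is the predicate that defines it.\<close>
  define C where "C e = {x. \<forall>i\<in>{..T}. x + int_multiple (int i) u \<in> F e}" for e
  define core where "core e = (\<forall>i\<in>{..T}. P ((e 0 + int_multiple (int i) u) ## (\<lambda>i. e (Suc i))))" for e
  have finF: "finite (F e)" for e using Suc.prems(2) unfolding F_def .
  have C_core: "C e = {x. core (x ## e)}" for e unfolding C_def core_def F_def by simp
  have C_sub: "C e \<subseteq> F e" for e
  proof
    fix x assume "x \<in> C e"
    then have "x + int_multiple (int 0) u \<in> F e" unfolding C_def by blast
    then show "x \<in> F e" by simp
  qed
  have finC: "finite (C e)" for e by (rule finite_subset[OF C_sub finF])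
  have right_ends: "card (right_ends e) \<le> Suc m" "finite (right_ends e)" for e
    using Suc.prems(3)[of e] finF[of e] unfolding right_ends_def F_def by simp_all
  have Suc_mult: "int_multiple (int (Suc i)) u = u + int_multiple (int i) u" for i
    using int_multiple_Suc[of "int i" u] by (simp add: add.commute)
  have missing: "\<exists>i. i < T \<and> x + int_multiple (int i) u \<in> right_ends e"
    if x: "x \<in> F e" "x \<notin> C e" for x e
  proof -
    define i where "i = (LEAST i. x + int_multiple (int i) u \<notin> F e)"
    obtain i0 where i0: "i0 \<le> T" "x + int_multiple (int i0) u \<notin> F e" using x(2) unfolding C_def by auto
    have i: "x + int_multiple (int i) u \<notin> F e" unfolding i_def by (rule LeastI[of _ i0]) (rule i0(2))
    have "i \<le> i0" unfolding i_def by (rule Least_le) (rule i0(2))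
    have "i \<noteq> 0" using i x(1) by (metis add_0_right int_multiple_0 of_nat_0)
    then obtain k where k: "i = Suc k" by (cases i) auto
    have "x + int_multiple (int k) u \<in> F e" using not_less_Least[of k "\<lambda>i. x + int_multiple (int i) u \<notin> F e"] k unfolding i_def by simp
    moreover have "x + int_multiple (int k) u + u \<notin> F e" using i unfolding k Suc_mult by (simp add: add_ac)
    ultimately show ?thesis using k \<open>i \<le> i0\<close> i0(1) unfolding right_ends_def by (intro exI[of _ k]) simp
  qed
  have "card {x. core (x ## e) \<and> \<not> core ((x + u) ## e)} \<le> m" for e
  proof -
    define RC where "RC = {x \<in> C e. x + u \<notin> C e}"
    have shift: "x + int_multiple (int T) u \<in> right_ends e" if x: "x \<in> RC" for x
    proof -
      have inC: "\<And>i. i \<le> T \<Longrightarrow> x + int_multiple (int i) u \<in> F e" using x unfolding RC_def C_def by simp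
      obtain i where i: "i \<le> T" "x + u + int_multiple (int i) u \<notin> F e" using x unfolding RC_def C_def by auto
      have "x + int_multiple (int (Suc i)) u \<notin> F e" using i(2) unfolding Suc_mult by (simp add: add.assoc)
      then have "\<not> Suc i \<le> T" using inC by blast
      then have "i = T" using i(1) by simp
      then show ?thesis using inC[of T] i(2) unfolding right_ends_def by (simp add: add_ac)
    qed
    have inj: "inj_on (\<lambda>x. x + int_multiple (int T) u) RC" by (rule inj_onI) simp
    \<comment> \<open>The first or the last run of the fibre is so short that its right end is not hit.\<close>
    have missed: "\<exists>y\<in>right_ends e. y \<notin> (\<lambda>x. x + int_multiple (int T) u) ` RC" if ne: "RC \<noteq> {}"
    proof -
      have F: "F e \<noteq> {}" using ne C_sub[of e] unfolding RC_def by blast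
      define l r where "l = Min (F e)" and "r = Max (F e)"
      have lr: "l \<in> F e" "r \<in> F e" unfolding l_def r_def using finF F by simp_all
      have "\<not> ((\<forall>i\<le>T. P ((l + int_multiple (int i) u) ## e)) \<and> (\<forall>i\<le>T. P ((r - int_multiple (int i) u) ## e)))"
      proof
        assume "(\<forall>i\<le>T. P ((l + int_multiple (int i) u) ## e)) \<and> (\<forall>i\<le>T. P ((r - int_multiple (int i) u) ## e))"
        then have "int_multiple (int T) u \<in> lengths P"
          by (intro multiple_in_lengths[of l P e r T] finF[of e, unfolded F_def] F[unfolded F_def]
              l_def[unfolded F_def] r_def[unfolded F_def]) blast+
        then show False using T by blast
      qed
      then have "(\<exists>i\<le>T. r - int_multiple (int i) u \<notin> F e) \<or> l \<notin> C e"
        unfolding C_def F_def by simp blast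
      then consider i where "i \<le> T" "r - int_multiple (int i) u \<notin> F e" | "l \<notin> C e" by blast
      then show ?thesis
      proof cases
        case 1
        have "r + u \<notin> F e"
        proof
          assume "r + u \<in> F e"
          with finF have "r + u \<le> Max (F e)" by (rule Max_ge)
          then have "r + u \<le> r" unfolding r_def .
          then show False using u by simp
        qed
        then have "r \<in> right_ends e" using lr unfolding right_ends_def by simp
        moreover have "r \<notin> (\<lambda>x. x + int_multiple (int T) u) ` RC"
        proof
          assume "r \<in> (\<lambda>x. x + int_multiple (int T) u) ` RC"
          then obtain x where x: "x \<in> RC" "r = x + int_multiple (int T) u" by blast
          have "r - int_multiple (int i) u = x + int_multiple (int (T - i)) u"
            unfolding x(2) using 1(1) by (simp add: of_nat_diff zmod.scale_left_diff_distrib)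
          then show False using 1(2) x(1) unfolding RC_def C_def by simp
        qed
        ultimately show ?thesis by blast
      next
        case 2
        obtain i where i: "i < T" "l + int_multiple (int i) u \<in> right_ends e" using missing[OF lr(1) 2] by blast
        moreover have "l + int_multiple (int i) u \<notin> (\<lambda>x. x + int_multiple (int T) u) ` RC"
        proof
          assume "l + int_multiple (int i) u \<in> (\<lambda>x. x + int_multiple (int T) u) ` RC"
          then obtain x where x: "x \<in> RC" "l + int_multiple (int i) u = x + int_multiple (int T) u" by blast
          have "x \<in> F e" using x(1) C_sub[of e] unfolding RC_def by blast
          then have "l \<le> x" unfolding l_def using finF by simp
          moreover have "int_multiple (int i) u < int_multiple (int T) u"
            using int_multiple_mono_left(1)[OF u] i(1) by simp
          ultimately have "l + int_multiple (int i) u < x + int_multiple (int T) u" by (rule add_le_less_mono)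
          then show False using x(2) by simp
        qed
        ultimately show ?thesis by blast
      qed
    qed
    have "card RC \<le> m"
    proof (cases "RC = {}")
      case False
      then have "(\<lambda>x. x + int_multiple (int T) u) ` RC \<subset> right_ends e"
        using missed[OF False] shift by blast
      then have "card ((\<lambda>x. x + int_multiple (int T) u) ` RC) < card (right_ends e)"
        by (rule psubset_card_mono[OF right_ends(2)])
      then show ?thesis using right_ends(1)[of e] card_image[OF inj] by simp
    qed simp
    moreover have "{x. core (x ## e) \<and> \<not> core ((x + u) ## e)} = RC" unfolding RC_def C_core by simp
    ultimately show ?thesis by simp
  qed
  moreover have "definable_rel core"
    unfolding core_def[abs_def]
    by (intro formula_ball formula_subst[OF Suc.prems(1)] closure_rules finite_atMost)
  moreover have "finite {x. core (x ## e)}" for e using finC[of e] unfolding C_core .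
  ultimately have "\<exists>K. \<forall>e. card {x. core (x ## e)} \<le> K" by (intro Suc.IH)
  then obtain K where K: "\<And>e. card {x. core (x ## e)} \<le> K" by blast
  have "card (F e) \<le> K + Suc m * Suc T" for e
  proof -
    define G where "G = (\<lambda>(y, i). y - int_multiple (int i) u) ` (right_ends e \<times> {..T})"
    have "F e \<subseteq> C e \<union> G"
    proof
      fix x assume x: "x \<in> F e"
      show "x \<in> C e \<union> G"
      proof (cases "x \<in> C e")
        case False
        obtain i where i: "i < T" "x + int_multiple (int i) u \<in> right_ends e" using missing[OF x False] by blast
        have "x \<in> G" unfolding G_def
          by (rule image_eqI[of _ _ "(x + int_multiple (int i) u, i)"]) (use i in simp_all)
        then show ?thesis by (rule UnI2)
      qed simp
    qed
    moreover have "finite G" unfolding G_def using right_ends(2) by simp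
    ultimately have "card (F e) \<le> card (C e \<union> G)" using finC by (intro card_mono) simp_all
    also have "\<dots> \<le> card (C e) + card G" by (rule card_Un_le)
    also have "card G \<le> card (right_ends e \<times> {..T})" unfolding G_def using right_ends(2) by (intro card_image_le) simp
    also have "card (right_ends e \<times> {..T}) \<le> Suc m * Suc T"
      using right_ends(1)[of e] by (simp only: card_cartesian_product card_atMost mult_le_mono1)
    also have "card (C e) \<le> K" using K[of e] unfolding C_core .
    finally show ?thesis by simp
  qed
  then show ?case unfolding F_def by blast
qed

end

text \<open>
  In a dense group no two points of a finite set share a position relative to the cuts. In a discrete
  group this holds for the right ends of runs, and \<open>runs_bounded\<close> applies.
\<close>

lemma finite_fibres_bounded:
  assumes P: "definable_rel P" and fin: "\<And>e. finite {x. P (x ## e)}"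
    and ctrl: "\<And>e. \<exists>\<U>. finite \<U> \<and> card \<U> \<le> m \<and> (\<forall>U\<in>\<U>. cut U) \<and> controls 1 \<U> {x. P (x ## e)}"
  shows "\<exists>K. \<forall>e. card {x. P (x ## e)} \<le> K"
proof (cases "\<exists>u>0. \<forall>x>0. u \<le> (x :: 'a)")
  case True
  then obtain u :: 'a where u: "0 < u" "\<And>x. 0 < x \<Longrightarrow> u \<le> x" by blast
  have "card {x. P (x ## e) \<and> \<not> P ((x + u) ## e)} \<le> 2 ^ m" for e
  proof -
    obtain \<U> where U: "finite \<U>" "card \<U> \<le> m" "\<forall>U\<in>\<U>. cut U" "controls 1 \<U> {x. P (x ## e)}"
      using ctrl by blast
    show ?thesis
    proof (rule card_le_regions[OF U(1,2)])
      fix x y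
      assume xy: "x \<in> {x. P (x ## e) \<and> \<not> P ((x + u) ## e)}" "x < y" "\<forall>U\<in>\<U>. (x \<in> U) = (y \<in> U)"
      have "x + u \<le> y" using u(2)[of "y - x"] xy(2) by (simp add: le_diff_eq add.commute)
      moreover have "x \<le> x + u" using u(1) by simp
      ultimately have "\<forall>U\<in>\<U>. (x \<in> U) = (x + u \<in> U)" using region_convex[OF U(3) xy(3)] by blast
      then have "P (x ## e) = P ((x + u) ## e)" using U(4) unfolding controls_def by simp
      then show False using xy(1) by simp
    qed
  qed
  then show ?thesis using runs_bounded[OF u P fin] by blast
next
  case dense: False
  have "card {x. P (x ## e)} \<le> 2 ^ m" for e
  proof -
    obtain \<U> where U: "finite \<U>" "card \<U> \<le> m" "\<forall>U\<in>\<U>. cut U" "controls 1 \<U> {x. P (x ## e)}"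
      using ctrl by blast
    show ?thesis
    proof (rule card_le_regions[OF U(1,2)])
      fix x y
      assume xy: "x \<in> {x. P (x ## e)}" "y \<in> {x. P (x ## e)}" "x < y" "\<forall>U\<in>\<U>. (x \<in> U) = (y \<in> U)"
      define B where "B = {z. P (z ## e) \<and> x < z \<and> z \<le> y}"
      have "finite B" unfolding B_def by (rule finite_subset[OF _ fin[of e]]) blast
      have "y \<in> B" using xy unfolding B_def by simp
      then have "Min B \<in> B" using \<open>finite B\<close> by (intro Min_in) auto
      then have "0 < Min B - x" "Min B \<le> y" unfolding B_def by simp_all
      then obtain w where w: "0 < w" "w < Min B - x" using dense by (meson not_less)
      have "x + w < Min B" using w(2) by (simp add: less_diff_eq add.commute)
      then have "x + w \<le> y" using \<open>Min B \<le> y\<close> by simp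
      moreover have "x \<le> x + w" using w(1) by simp
      ultimately have "\<forall>U\<in>\<U>. (x \<in> U) = (x + w \<in> U)" using region_convex[OF U(3) xy(4)] by blast
      then have "P (x ## e) = P ((x + w) ## e)" using U(4) unfolding controls_def by simp
      then have "x + w \<in> B" unfolding B_def using xy(1) w(1) \<open>x + w \<le> y\<close> by simp
      then have "Min B \<le> x + w" using \<open>finite B\<close> by simp
      then show False using \<open>x + w < Min B\<close> by simp
    qed
  qed
  then show ?thesis by blast
qed

text \<open>
  On a fixed coset the fibre is pulled back to a set \<open>D\<close>. A jump of \<open>D\<close> would
  contradict (2), so \<open>D\<close> is finite or cofinite. In both cases the symmetric difference of
  \<open>D\<close> and a translate is finite, and for a suitable translate it contains \<open>D\<close> or
  its complement, whichever is finite.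
\<close>

lemma uniform:
  assumes P: "definable_rel P"
  shows "uniformly_coset_like P"
proof -
  obtain n m where n: "1 \<le> n" and ctrl: "\<And>e. \<exists>\<U>. finite \<U> \<and> card \<U> \<le> m \<and> (\<forall>U\<in>\<U>. cut U) \<and>
      controls n \<U> {x. P (x ## e)}" using controlled[OF P] by blast
  define D where "D r e = {x. P ((r + int_multiple n x) ## e)}" for r e
  have ctrlD: "\<exists>\<U>. finite \<U> \<and> card \<U> \<le> m \<and> (\<forall>U\<in>\<U>. cut U) \<and> controls 1 \<U> (D r e)" for r e
  proof -
    obtain \<U> where U: "finite \<U>" "card \<U> \<le> m" "\<forall>U\<in>\<U>. cut U" "controls n \<U> {x. P (x ## e)}"
      using ctrl by blast
    let ?V = "(\<lambda>U. {x. r + int_multiple n x \<in> U}) ` \<U>"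
    have "controls 1 ?V (D r e)" using controls_affine[OF U(4) n] unfolding D_def mem_Collect_eq .
    moreover have "card ?V \<le> m" using card_image_le[OF U(1)] U(2) by (rule order_trans)
    moreover have "\<forall>U\<in>?V. cut U" using U(3) cut_affine[OF _ n] by blast
    ultimately show ?thesis using U(1) by (intro exI[of _ ?V]) simp
  qed
  have mult: "same_term (enriched id M) (enriched id M) f f \<Longrightarrow>
      same_term (enriched id M) (enriched id M) (\<lambda>e. int_multiple n (f e)) (\<lambda>e. int_multiple n (f e))" for f
    by (rule term_mult) (rule term_plus n | assumption)+
  have D_dfn: "definable_rel (\<lambda>e. e 0 \<in> D r e0)" for r e0
    unfolding D_def mem_Collect_eq by (intro formula_subst[OF P] closure_rules mult)
  have fin_cofin: "finite (D r e) \<or> finite (- D r e)" for r e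
  proof (rule ccontr)
    assume "\<not> (finite (D r e) \<or> finite (- D r e))"
    then obtain D' V W where "finite (D r e - D')" "finite (D' - D r e)" "jump D' V W"
      using exists_jump ctrlD[of r e] by meson
    then show False using jump_not_coset_like[OF index g] unary[OF D_dfn] by blast
  qed
  \<comment> \<open>The symmetric difference of \<open>D\<close> and its translate, in the variables \<open>x\<close>, \<open>c\<close>, \<open>r\<close>.\<close>
  define Q where "Q e = (P ((e 2 + int_multiple n (e 0)) ## (\<lambda>i. e (i + 3))) \<noteq>
      P ((e 2 + int_multiple n (e 0 + e 1)) ## (\<lambda>i. e (i + 3))))" for e
  have Q: "{x. Q (x ## c ## r ## e)} = {x. (x \<in> D r e) \<noteq> (x + c \<in> D r e)}" for c r e
    unfolding Q_def D_def by (simp add: numeral_2_eq_2 numeral_3_eq_3)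
  have env: "e = e 0 ## e 1 ## (\<lambda>i. e (i + 2))" for e :: "nat \<Rightarrow> 'a"
    by (rule ext) (simp split: nat.split)
  have "definable_rel Q" unfolding Q_def[abs_def]
    by (intro formula_not formula_iff formula_subst[OF P] closure_rules mult)
  moreover have "finite {x. Q (x ## e)}" for e
  proof -
    let ?D = "D (e 1) (\<lambda>i. e (i + 2))" and ?c = "e 0"
    have *: "finite {x. x + ?c \<in> A}" if "finite A" for A
      using finite_vimageI[OF that, of "\<lambda>x. x + ?c"] by (simp add: inj_def vimage_def)
    have "finite {x. (x \<in> ?D) \<noteq> (x + ?c \<in> ?D)}"
      using fin_cofin[of "e 1" "\<lambda>i. e (i + 2)"]
    proof
      assume "finite ?D"
      then have "finite (?D \<union> {x. x + ?c \<in> ?D})" using * by simp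
      then show ?thesis by (rule rev_finite_subset) blast
    next
      assume "finite (- ?D)"
      then have "finite (- ?D \<union> {x. x + ?c \<in> - ?D})" using *[of "- ?D"] by blast
      then show ?thesis by (rule rev_finite_subset) blast
    qed
    then show ?thesis by (subst env[of e]) (simp only: Q)
  qed
  moreover have "\<exists>\<U>. finite \<U> \<and> card \<U> \<le> m + m \<and> (\<forall>U\<in>\<U>. cut U) \<and> controls 1 \<U> {x. Q (x ## e)}" for e
  proof -
    let ?D = "D (e 1) (\<lambda>i. e (i + 2))" and ?c = "e 0"
    obtain \<U> where U: "finite \<U>" "card \<U> \<le> m" "\<forall>U\<in>\<U>. cut U" "controls 1 \<U> ?D" using ctrlD by blast
    let ?V = "(\<lambda>U. {x. x + ?c \<in> U}) ` \<U>"
    have "card (\<U> \<union> ?V) \<le> m + m"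
      using card_Un_le[of \<U> ?V] card_image_le[OF U(1), of "\<lambda>U. {x. x + ?c \<in> U}"] U(2) by simp
    moreover have "\<forall>U\<in>\<U> \<union> ?V. cut U" using U(3) cut_translate by blast
    moreover have "controls 1 (\<U> \<union> ?V) {x. (x \<in> ?D) \<noteq> (x + ?c \<in> ?D)}"
      unfolding controls_def
    proof (intro allI impI)
      fix x x' assume *: "cgr 1 x x' \<and> (\<forall>U\<in>\<U> \<union> ?V. (x \<in> U) = (x' \<in> U))"
      have D: "y \<in> ?D \<longleftrightarrow> y' \<in> ?D" if "\<forall>U\<in>\<U>. (y \<in> U) = (y' \<in> U)" for y y'
        using U(4) that unfolding controls_def by simp
      have "x \<in> ?D \<longleftrightarrow> x' \<in> ?D" by (rule D) (use * in simp)
      moreover have "\<forall>U\<in>\<U>. (x + ?c \<in> U) = (x' + ?c \<in> U)"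
      proof
        fix U assume "U \<in> \<U>"
        then have "{x. x + ?c \<in> U} \<in> \<U> \<union> ?V" by (intro UnI2 imageI)
        with conjunct2[OF *] have "(x \<in> {x. x + ?c \<in> U}) = (x' \<in> {x. x + ?c \<in> U})" by (rule bspec)
        then show "(x + ?c \<in> U) = (x' + ?c \<in> U)" by simp
      qed
      then have "x + ?c \<in> ?D \<longleftrightarrow> x' + ?c \<in> ?D" by (rule D)
      ultimately show "(x \<in> {x. (x \<in> ?D) \<noteq> (x + ?c \<in> ?D)}) = (x' \<in> {x. (x \<in> ?D) \<noteq> (x + ?c \<in> ?D)})" by simp
    qed
    moreover have "{x. Q (x ## e)} = {x. (x \<in> ?D) \<noteq> (x + ?c \<in> ?D)}"
      by (subst env[of e]) (simp only: Q)
    ultimately show ?thesis using U(1) by (intro exI[of _ "\<U> \<union> ?V"]) simp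
  qed
  ultimately obtain K where K: "\<And>e. finite {x. Q (x ## e)} \<and> card {x. Q (x ## e)} \<le> K"
    using finite_fibres_bounded[of Q "m + m"] by meson
  have "covered (=) K (\<lambda>x. cgr n x r \<and> P (x ## e)) \<or> covered (=) K (\<lambda>x. cgr n x r \<and> \<not> P (x ## e))" for e r
  proof -
    have few: "card A \<le> K" if A: "finite A" "A = D r e \<or> A = - D r e" for A
    proof -
      obtain c where c: "\<forall>x\<in>A. x + c \<notin> A" using exists_disjoint_translate[OF A(1) g] by blast
      have "A \<subseteq> {x. (x \<in> D r e) \<noteq> (x + c \<in> D r e)}"
        using A(2) by (elim disjE) (use c in auto)
      then have "A \<subseteq> {x. Q (x ## c ## r ## e)}" unfolding Q .
      then have "card A \<le> card {x. Q (x ## c ## r ## e)}" using K by (intro card_mono) blast+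
      also have "\<dots> \<le> K" using K by blast
      finally show ?thesis .
    qed
    have cov: "covered (=) K (\<lambda>x. cgr n x r \<and> B x)" if A: "finite A" "card A \<le> K" "A = {x. B (r + int_multiple n x)}" for A B
    proof -
      let ?R = "(\<lambda>x. r + int_multiple n x) ` A"
      have sub: "{x. cgr n x r \<and> B x} \<subseteq> ?R"
      proof
        fix y assume "y \<in> {x. cgr n x r \<and> B x}"
        then obtain z where "y = r + int_multiple n z" "B y" unfolding cgr_def by blast
        then show "y \<in> ?R" unfolding A(3) by (intro image_eqI[of _ _ z]) simp_all
      qed
      have fin: "finite ?R" using A(1) by simp
      have "card ?R \<le> K" using card_image_le[OF A(1)] A(2) by (rule order_trans)
      with card_mono[OF fin sub] have "card {x. cgr n x r \<and> B x} \<le> K" by (rule order_trans)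
      then show ?thesis unfolding covered_eq using finite_subset[OF sub fin] by (rule conjI[rotated])
    qed
    show ?thesis using fin_cofin[of r e]
    proof
      assume f: "finite (D r e)"
      have "covered (=) K (\<lambda>x. cgr n x r \<and> P (x ## e))"
        by (rule cov[OF f few[OF f disjI1[OF refl]] D_def])
      then show ?thesis ..
    next
      assume f: "finite (- D r e)"
      have "covered (=) K (\<lambda>x. cgr n x r \<and> \<not> P (x ## e))"
        by (rule cov[OF f few[OF f disjI2[OF refl]]]) (simp only: D_def Collect_neg_eq)
      then show ?thesis ..
    qed
  qed
  then show ?thesis unfolding uniformly_coset_like_def using n by blast
qed

end

section \<open>Ladders and Ramsey\<close>

text \<open>
  Only pairs of different indices are constrained, so that subsequences and reversed sequences of ladders
  are ladders. The predicate \<open>\<Omega>\<close> records further information that holds for all these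
  pairs.
\<close>

definition ladders :: "('x \<Rightarrow> 'y \<Rightarrow> bool) \<Rightarrow> ('x \<Rightarrow> 'y \<Rightarrow> bool) \<Rightarrow> bool" where
  "ladders \<Omega> \<Phi> \<longleftrightarrow> (\<forall>L. \<exists>(a :: nat \<Rightarrow> 'x) b. \<forall>i<L. \<forall>j<L. i \<noteq> j \<longrightarrow> \<Omega> (a i) (b j) \<and> (\<Phi> (a i) (b j) \<longleftrightarrow> i < j))"

lemma laddersI:
  assumes "\<And>L. \<exists>(a :: nat \<Rightarrow> 'x) b. \<forall>i<L. \<forall>j<L. i \<noteq> j \<longrightarrow> \<Omega> (a i) (b j) \<and> (\<Phi> (a i) (b j) \<longleftrightarrow> i < j)"
  shows "ladders \<Omega> \<Phi>"
  unfolding ladders_def by (intro allI assms)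

lemma laddersD:
  assumes "ladders \<Omega> \<Phi>"
  shows "\<exists>(a :: nat \<Rightarrow> _) b. \<forall>i<L. \<forall>j<L. i \<noteq> j \<longrightarrow> \<Omega> (a i) (b j) \<and> (\<Phi> (a i) (b j) \<longleftrightarrow> i < j)"
  using assms unfolding ladders_def by (rule spec)

lemma ramsey_pairs:
  "\<exists>N. \<forall>C :: nat \<Rightarrow> nat \<Rightarrow> bool. \<exists>f. strict_mono_on {..<L :: nat} f \<and> f ` {..<L} \<subseteq> {..<N} \<and>
     (\<exists>c. \<forall>i<L. \<forall>j<L. i < j \<longrightarrow> C (f i) (f j) = c)"
proof -
  from ramsey2[where 'a = nat, of L L] obtain N where N: "\<forall>(V :: nat set) E. finite V \<and> card V \<ge> N \<longrightarrow>
      (\<exists>R \<subseteq> V. card R = L \<and> clique R E \<or> card R = L \<and> indep R E)"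
    by (elim exE conjE) (rule that, assumption+)
  have "\<exists>f. strict_mono_on {..<L} f \<and> f ` {..<L} \<subseteq> {..<N} \<and> (\<exists>c. \<forall>i<L. \<forall>j<L. i < j \<longrightarrow> C (f i) (f j) = c)"
    for C :: "nat \<Rightarrow> nat \<Rightarrow> bool"
  proof -
    \<comment> \<open>A predicate of increasing pairs as a graph, which is what Ramsey's theorem is about.\<close>
    define E where "E = {{i, j} |i j. i < j \<and> C i j}"
    obtain R where R: "R \<subseteq> {..<N}" "card R = L" "clique R E \<or> indep R E"
      using N[rule_format, of "{..<N}" E] by auto
    have "finite R" using R(1) finite_subset by blast
    define f where "f = (!) (sorted_list_of_set R)"
    have len: "length (sorted_list_of_set R) = L" using R(2) by simp
    have sorted: "sorted_wrt (<) (sorted_list_of_set R)" by (rule strict_sorted_list_of_set)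
    have mono: "f i < f j" if "i < j" "j < L" for i j
      unfolding f_def using sorted_wrt_nth_less[OF sorted that(1)] that(2) len by simp
    have mem: "f i \<in> R" if "i < L" for i
      unfolding f_def using nth_mem[of i "sorted_list_of_set R"] that len \<open>finite R\<close> by simp
    have E_iff: "{x, y} \<in> E \<longleftrightarrow> C x y" if "x < y" for x y
      unfolding E_def using that by (auto simp: doubleton_eq_iff)
    have "\<exists>c. \<forall>i<L. \<forall>j<L. i < j \<longrightarrow> C (f i) (f j) = c"
      using R(3)
    proof
      assume cl: "clique R E"
      have "C (f i) (f j) = True" if "i < L" "j < L" "i < j" for i j
        using cl mem[OF that(1)] mem[OF that(2)] mono[OF that(3,2)] E_iff[OF mono[OF that(3,2)]]
        unfolding clique_def by (metis less_irrefl)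
      then show ?thesis by blast
    next
      assume ind: "indep R E"
      have "C (f i) (f j) = False" if "i < L" "j < L" "i < j" for i j
        using ind mem[OF that(1)] mem[OF that(2)] mono[OF that(3,2)] E_iff[OF mono[OF that(3,2)]]
        unfolding indep_def by (metis less_irrefl)
      then show ?thesis by blast
    qed
    moreover have "strict_mono_on {..<L} f" using mono by (intro strict_mono_onI) simp
    moreover have "f ` {..<L} \<subseteq> {..<N}" using mem R(1) by blast
    ultimately show ?thesis by (intro exI[of _ f] conjI)
  qed
  then show ?thesis by (intro exI[of _ N] allI)
qed

lemma finite_pigeonhole_lengths:
  assumes "finite C" "\<And>L :: nat. \<exists>c\<in>C. Q c L" "\<And>c L L'. L \<le> L' \<Longrightarrow> Q c L' \<Longrightarrow> Q c L"
  shows "\<exists>c\<in>C. \<forall>L. Q c L"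
proof (rule ccontr)
  assume "\<not> ?thesis"
  then have "\<forall>c\<in>C. \<exists>L. \<not> Q c L" by blast
  then obtain l where l: "\<And>c. c \<in> C \<Longrightarrow> \<not> Q c (l c)" by metis
  obtain c where c: "c \<in> C" "Q c (Max (l ` C))" using assms(2) by blast
  have "l c \<le> Max (l ` C)" using assms(1) c(1) by simp
  then have "Q c (l c)" using c(2) by (rule assms(3))
  then show False using l[OF c(1)] by blast
qed

text \<open>
  Ramsey's theorem is applied once to the pairs \<open>i < j\<close> and once to the pairs \<open>i >
  j\<close>.
\<close>

lemma ladders_homogeneous:
  assumes "ladders \<Omega> \<Phi>"
  shows "\<exists>\<alpha> \<beta>. \<forall>L. \<exists>(a :: nat \<Rightarrow> 'x) (b :: nat \<Rightarrow> 'y). \<forall>i<L. \<forall>j<L. i \<noteq> j \<longrightarrow>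
     \<Omega> (a i) (b j) \<and> (\<Phi> (a i) (b j) \<longleftrightarrow> i < j) \<and> (\<Psi> (a i) (b j) \<longleftrightarrow> (if i < j then \<alpha> else \<beta>))"
proof -
  define good where "good \<alpha>\<beta> L \<longleftrightarrow> (\<exists>(a :: nat \<Rightarrow> 'x) (b :: nat \<Rightarrow> 'y). \<forall>i<L. \<forall>j<L. i \<noteq> j \<longrightarrow>
     \<Omega> (a i) (b j) \<and> (\<Phi> (a i) (b j) \<longleftrightarrow> i < j) \<and> (\<Psi> (a i) (b j) \<longleftrightarrow> (if i < j then fst \<alpha>\<beta> else snd \<alpha>\<beta>)))"
    for \<alpha>\<beta> :: "bool \<times> bool" and L
  have "\<exists>c\<in>UNIV. good c L" for L
  proof -
    from ramsey_pairs[of L] obtain N1 where N1: "\<forall>C :: nat \<Rightarrow> nat \<Rightarrow> bool. \<exists>f. strict_mono_on {..<L} f \<and>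
      f ` {..<L} \<subseteq> {..<N1} \<and> (\<exists>c. \<forall>i<L. \<forall>j<L. i < j \<longrightarrow> C (f i) (f j) = c)" ..
    from ramsey_pairs[of N1] obtain N2 where N2: "\<forall>C :: nat \<Rightarrow> nat \<Rightarrow> bool. \<exists>f. strict_mono_on {..<N1} f \<and>
      f ` {..<N1} \<subseteq> {..<N2} \<and> (\<exists>c. \<forall>i<N1. \<forall>j<N1. i < j \<longrightarrow> C (f i) (f j) = c)" ..
    from laddersD[OF assms, of N2] obtain a b where
      ab: "\<forall>i<N2. \<forall>j<N2. i \<noteq> j \<longrightarrow> \<Omega> (a i) (b j) \<and> (\<Phi> (a i) (b j) \<longleftrightarrow> i < j)" by (elim exE) (rule that, assumption)
    from N2[THEN spec, of "\<lambda>i j. \<Psi> (a i) (b j)"] obtain f \<alpha> where f: "strict_mono_on {..<N1} f"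
      "f ` {..<N1} \<subseteq> {..<N2}" "\<forall>i<N1. \<forall>j<N1. i < j \<longrightarrow> \<Psi> (a (f i)) (b (f j)) = \<alpha>" by (elim exE conjE) (rule that, assumption+)
    from N1[THEN spec, of "\<lambda>i j. \<Psi> (a (f j)) (b (f i))"] obtain h \<beta> where h: "strict_mono_on {..<L} h"
      "h ` {..<L} \<subseteq> {..<N1}" "\<forall>i<L. \<forall>j<L. i < j \<longrightarrow> \<Psi> (a (f (h j))) (b (f (h i))) = \<beta>" by (elim exE conjE) (rule that, assumption+)
    have "good (\<alpha>, \<beta>) L"
      unfolding good_def
    proof (rule exI[of _ "\<lambda>i. a (f (h i))"], rule exI[of _ "\<lambda>i. b (f (h i))"], intro allI impI)
      fix i j assume ij: "i < L" "j < L" "i \<noteq> j"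
      have hN: "h i < N1" "h j < N1" using h(2) ij by blast+
      have fN: "f (h i) < N2" "f (h j) < N2" using f(2) hN by blast+
      have less: "h x < h y" "f (h x) < f (h y)" if "x < y" "x < L" "y < L" for x y
      proof -
        show "h x < h y" using strict_mono_onD[OF h(1)] that by simp
        moreover have "h x < N1" "h y < N1" using h(2) that by blast+
        ultimately show "f (h x) < f (h y)" using strict_mono_onD[OF f(1)] by simp
      qed
      have ord: "f (h i) < f (h j) \<longleftrightarrow> i < j" "f (h i) \<noteq> f (h j)"
        using less(2)[of i j] less(2)[of j i] ij by (cases "i < j"; simp)+
      have "\<Psi> (a (f (h i))) (b (f (h j))) \<longleftrightarrow> (if i < j then \<alpha> else \<beta>)"
      proof (cases "i < j")
        case True
        then show ?thesis using f(3)[rule_format, OF hN less(1)[OF True ij(1,2)]] by simp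
      next
        case False
        then have "j < i" using ij(3) by simp
        then show ?thesis using h(3)[rule_format, OF ij(2,1)] by simp
      qed
      then show "\<Omega> (a (f (h i))) (b (f (h j))) \<and> (\<Phi> (a (f (h i))) (b (f (h j))) \<longleftrightarrow> i < j) \<and>
          (\<Psi> (a (f (h i))) (b (f (h j))) \<longleftrightarrow> (if i < j then fst (\<alpha>, \<beta>) else snd (\<alpha>, \<beta>)))"
        using ab[rule_format, OF fN ord(2)] ord(1) by simp
    qed
    then show ?thesis by (rule bexI) simp
  qed
  moreover have "good c L" if le: "L \<le> L'" and "good c L'" for c L L'
  proof -
    from that(2) obtain a b where ab: "\<forall>i<L'. \<forall>j<L'. i \<noteq> j \<longrightarrow> \<Omega> (a i) (b j) \<and> (\<Phi> (a i) (b j) \<longleftrightarrow> i < j) \<and>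
        (\<Psi> (a i) (b j) \<longleftrightarrow> (if i < j then fst c else snd c))" unfolding good_def by (elim exE) (rule that, assumption)
    show ?thesis unfolding good_def
      by (rule exI[of _ a], rule exI[of _ b], intro allI impI, rule ab[rule_format]) (use le in simp_all)
  qed
  ultimately have "\<exists>c\<in>UNIV. \<forall>L. good c L" by (intro finite_pigeonhole_lengths) simp_all
  then obtain c where c: "\<forall>L. good c L" by blast
  show ?thesis by (rule exI[of _ "fst c"], rule exI[of _ "snd c"], rule c[unfolded good_def])
qed

lemma ladders_not:
  assumes "ladders \<Omega> \<Phi>" shows "ladders (\<lambda>_ _. True) (\<lambda>x y. \<not> \<Phi> x y)"
proof (rule laddersI)
  fix L :: nat
  from laddersD[OF assms, of L] obtain a b where
    ab: "\<forall>i<L. \<forall>j<L. i \<noteq> j \<longrightarrow> \<Omega> (a i) (b j) \<and> (\<Phi> (a i) (b j) \<longleftrightarrow> i < j)" by (elim exE) (rule that, assumption)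
  have "True \<and> (\<not> \<Phi> (a (L - 1 - i)) (b (L - 1 - j)) \<longleftrightarrow> i < j)" if "i < L" "j < L" "i \<noteq> j" for i j
  proof -
    have "L - 1 - i < L" "L - 1 - j < L" "L - 1 - i \<noteq> L - 1 - j" using that by linarith+
    note ab[rule_format, OF this]
    moreover have "L - 1 - i < L - 1 - j \<longleftrightarrow> j < i" using that by linarith
    moreover have "(\<not> j < i) = (i < j)" using that(3) by linarith
    ultimately show ?thesis by simp
  qed
  then have "\<forall>i<L. \<forall>j<L. i \<noteq> j \<longrightarrow> True \<and> (\<not> \<Phi> (a (L - 1 - i)) (b (L - 1 - j)) \<longleftrightarrow> i < j)"
    by (intro allI impI)
  then show "\<exists>a b. \<forall>i<L. \<forall>j<L. i \<noteq> j \<longrightarrow> True \<and> (\<not> \<Phi> (a i) (b j) \<longleftrightarrow> i < j)"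
    by (intro exI)
qed

text \<open>
  If the two truth values of \<open>\<Psi>\<close> in homogeneous ladders differ, then
  \<open>\<Psi>\<close> or its negation has ladders itself, and reversing these replaces the negation by
  \<open>\<Psi>\<close>.
\<close>

lemma ladders_trichotomy:
  assumes "ladders \<Omega> \<Phi>"
  shows "ladders (\<lambda>_ _. True) \<Psi> \<or> ladders (\<lambda>x y. \<Omega> x y \<and> \<Psi> x y) \<Phi> \<or> ladders (\<lambda>x y. \<Omega> x y \<and> \<not> \<Psi> x y) \<Phi>"
proof -
  from ladders_homogeneous[OF assms, of \<Psi>] obtain \<alpha> \<beta> where h: "\<forall>L. \<exists>(a :: nat \<Rightarrow> _) b. \<forall>i<L. \<forall>j<L. i \<noteq> j \<longrightarrow>
     \<Omega> (a i) (b j) \<and> (\<Phi> (a i) (b j) \<longleftrightarrow> i < j) \<and> (\<Psi> (a i) (b j) \<longleftrightarrow> (if i < j then \<alpha> else \<beta>))"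
    by (elim exE) (rule that, assumption)
  have transport: "ladders \<Omega>' \<Phi>'"
    if "\<And>x y i j. i \<noteq> j \<Longrightarrow> \<Omega> x y \<Longrightarrow> \<Phi> x y \<longleftrightarrow> i < j \<Longrightarrow> \<Psi> x y \<longleftrightarrow> (if i < j then \<alpha> else \<beta>) \<Longrightarrow>
      \<Omega>' x y \<and> (\<Phi>' x y \<longleftrightarrow> i < (j :: nat))" for \<Omega>' \<Phi>'
  proof (rule laddersI)
    fix L :: nat
    from h[THEN spec, of L] obtain a b where ab: "\<forall>i<L. \<forall>j<L. i \<noteq> j \<longrightarrow>
     \<Omega> (a i) (b j) \<and> (\<Phi> (a i) (b j) \<longleftrightarrow> i < j) \<and> (\<Psi> (a i) (b j) \<longleftrightarrow> (if i < j then \<alpha> else \<beta>))" by (elim exE) (rule that, assumption)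
    have "\<Omega>' (a i) (b j) \<and> (\<Phi>' (a i) (b j) \<longleftrightarrow> i < j)" if "i < L" "j < L" "i \<noteq> j" for i j
      using ab[rule_format, OF that] by (intro \<open>\<And>x y i j. _ \<Longrightarrow> _ \<Longrightarrow> _ \<Longrightarrow> _ \<Longrightarrow> \<Omega>' x y \<and> (\<Phi>' x y \<longleftrightarrow> i < j)\<close> that) simp_all
    then show "\<exists>a b. \<forall>i<L. \<forall>j<L. i \<noteq> j \<longrightarrow> \<Omega>' (a i) (b j) \<and> (\<Phi>' (a i) (b j) \<longleftrightarrow> i < j)"
      by (intro exI[of _ a] exI[of _ b] allI impI)
  qed
  show ?thesis
  proof (cases "\<alpha> = \<beta>")
    case True
    have "ladders (\<lambda>x y. \<Omega> x y \<and> (\<Psi> x y = \<alpha>)) \<Phi>" by (rule transport) (use True in simp)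
    then show ?thesis by (cases \<alpha>) simp_all
  next
    case False
    then have "ladders (\<lambda>_ _. True) (\<lambda>x y. \<Psi> x y = \<alpha>)" by (intro transport) (simp split: if_splits)
    then show ?thesis using ladders_not[of "\<lambda>_ _. True" "\<lambda>x y. \<not> \<Psi> x y"] by (cases \<alpha>) simp_all
  qed
qed

lemma not_ladders_left:
  assumes "\<And>x y y'. \<Phi> x y \<longleftrightarrow> \<Phi> x y'" shows "\<not> ladders \<Omega> \<Phi>"
proof
  assume "ladders \<Omega> \<Phi>"
  from laddersD[OF this, of 3] obtain a b where
    ab: "\<forall>i<3 :: nat. \<forall>j<3. i \<noteq> j \<longrightarrow> \<Omega> (a i) (b j) \<and> (\<Phi> (a i) (b j) \<longleftrightarrow> i < j)" by (elim exE) (rule that, assumption)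
  have "\<Phi> (a 1) (b 2)" "\<not> \<Phi> (a 1) (b 0)"
    using ab[rule_format, of 1 2] ab[rule_format, of 1 0] by simp_all
  then show False using assms[of "a 1" "b 2" "b 0"] by simp
qed

lemma not_ladders_right:
  assumes "\<And>x x' y. \<Phi> x y \<longleftrightarrow> \<Phi> x' y" shows "\<not> ladders \<Omega> \<Phi>"
proof
  assume "ladders \<Omega> \<Phi>"
  from laddersD[OF this, of 3] obtain a b where
    ab: "\<forall>i<3 :: nat. \<forall>j<3. i \<noteq> j \<longrightarrow> \<Omega> (a i) (b j) \<and> (\<Phi> (a i) (b j) \<longleftrightarrow> i < j)" by (elim exE) (rule that, assumption)
  have "\<Phi> (a 0) (b 1)" "\<not> \<Phi> (a 2) (b 1)"
    using ab[rule_format, of 0 1] ab[rule_format, of 2 1] by simp_all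
  then show False using assms[of "a 0" "b 1" "a 2"] by simp
qed

text \<open>
  A predicate of the left element alone has no ladders, so that \<open>ladders_trichotomy\<close> decides
  it.
\<close>

lemma ladders_class:
  assumes "ladders \<Omega> \<Phi>" "finite R" "\<And>x. \<exists>r\<in>R. rel x r"
  shows "\<exists>r\<in>R. ladders (\<lambda>x y. \<Omega> x y \<and> rel x r) \<Phi>"
proof (rule ccontr)
  assume none: "\<not> ?thesis"
  have "ladders (\<lambda>x y. \<Omega> x y \<and> (\<forall>r\<in>S. \<not> rel x r)) \<Phi>" if "finite S" "S \<subseteq> R" for S
    using that
  proof (induction S rule: finite_induct)
    case empty
    then show ?case using assms(1) by simp
  next
    case (insert r S)
    have "ladders (\<lambda>x y. \<Omega> x y \<and> (\<forall>r\<in>S. \<not> rel x r)) \<Phi>" using insert by simp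
    from ladders_trichotomy[OF this, of "\<lambda>x y. rel x r"] consider
      "ladders (\<lambda>_ _. True) (\<lambda>x (y :: 'b). rel x r)" |
      "ladders (\<lambda>x y. (\<Omega> x y \<and> (\<forall>r\<in>S. \<not> rel x r)) \<and> rel x r) \<Phi>" |
      "ladders (\<lambda>x y. (\<Omega> x y \<and> (\<forall>r\<in>S. \<not> rel x r)) \<and> \<not> rel x r) \<Phi>" by blast
    then show ?case
    proof cases
      case 1
      moreover have "\<not> ladders (\<lambda>_ _. True) (\<lambda>x (y :: 'b). rel x r)" by (rule not_ladders_left) (rule refl)
      ultimately show ?thesis by blast
    next
      case 2
      have "ladders (\<lambda>x y. \<Omega> x y \<and> rel x r) \<Phi>"
      proof (rule laddersI)
        fix L :: nat
        from laddersD[OF 2, of L] obtain a b where ab: "\<forall>i<L. \<forall>j<L. i \<noteq> j \<longrightarrow>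
          ((\<Omega> (a i) (b j) \<and> (\<forall>r\<in>S. \<not> rel (a i) r)) \<and> rel (a i) r) \<and> (\<Phi> (a i) (b j) \<longleftrightarrow> i < j)" by (elim exE) (rule that, assumption)
        show "\<exists>a b. \<forall>i<L. \<forall>j<L. i \<noteq> j \<longrightarrow> (\<Omega> (a i) (b j) \<and> rel (a i) r) \<and> (\<Phi> (a i) (b j) \<longleftrightarrow> i < j)"
          by (rule exI[of _ a], rule exI[of _ b]) (use ab in simp)
      qed
      then show ?thesis using none insert.prems by blast
    next
      case 3
      then show ?thesis by (simp add: conj_ac)
    qed
  qed
  from laddersD[OF this[OF assms(2) subset_refl], of 2] obtain a b where
    "\<forall>i<2 :: nat. \<forall>j<2. i \<noteq> j \<longrightarrow> (\<Omega> (a i) (b j) \<and> (\<forall>r\<in>R. \<not> rel (a i) r)) \<and> (\<Phi> (a i) (b j) \<longleftrightarrow> i < j)"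
    by (elim exE) (rule that, assumption)
  from this[rule_format, of 0 1] have "\<forall>r\<in>R. \<not> rel (a 0) r" by simp
  then show False using assms(3)[of "a 0"] by blast
qed

section \<open>Stability from uniform bounds\<close>

lemma ladders_cong:
  assumes "ladders \<Omega> \<Phi>" and "\<And>x y. \<Omega> x y \<Longrightarrow> \<Omega>' x y \<and> (\<Phi> x y \<longleftrightarrow> \<Phi>' x y)"
  shows "ladders \<Omega>' \<Phi>'"
proof (rule laddersI)
  fix L :: nat
  from laddersD[OF assms(1), of L] obtain a b where
    ab: "\<forall>i<L. \<forall>j<L. i \<noteq> j \<longrightarrow> \<Omega> (a i) (b j) \<and> (\<Phi> (a i) (b j) \<longleftrightarrow> i < j)" by (elim exE) (rule that, assumption)
  have "\<Omega>' (a i) (b j) \<and> (\<Phi>' (a i) (b j) \<longleftrightarrow> i < j)" if "i < L" "j < L" "i \<noteq> j" for i j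
    using ab[rule_format, OF that] assms(2)[of "a i" "b j"] by simp
  then show "\<exists>a b. \<forall>i<L. \<forall>j<L. i \<noteq> j \<longrightarrow> \<Omega>' (a i) (b j) \<and> (\<Phi>' (a i) (b j) \<longleftrightarrow> i < j)"
    by (intro exI[of _ a] exI[of _ b] allI impI)
qed

definition split_rel :: "nat \<Rightarrow> ((nat \<Rightarrow> 'a) \<Rightarrow> bool) \<Rightarrow> (nat \<Rightarrow> 'a) \<Rightarrow> (nat \<Rightarrow> 'a) \<Rightarrow> bool" where
  "split_rel k P a b = P (\<lambda>i. if i < k then a i else b i)"

lemma split_Suc: "(\<lambda>i. if i < Suc k then a i else b i) = (\<lambda>i. if i < k then a i else b i)(k := a k)"
  by (rule ext) (simp add: less_Suc_eq)

lemma split_rel_Suc: "split_rel (Suc k) P a b = P ((\<lambda>i. if i < k then a i else b i)(k := a k))"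
  unfolding split_rel_def split_Suc ..

locale uniform_structure =
  fixes M :: "('f, 'r, 'a::linordered_ab_group_add) fo_struct"
  assumes index: "small_index TYPE('a)"
    and uniform: "same_formula (enriched id M) (enriched id M) P P \<Longrightarrow> uniformly_coset_like P"
begin

abbreviation definable_rel :: "((nat \<Rightarrow> 'a) \<Rightarrow> bool) \<Rightarrow> bool" where
  "definable_rel P \<equiv> same_formula (enriched id M) (enriched id M) P P"

lemma definable_upd: "definable_rel P \<Longrightarrow> definable_rel (\<lambda>e. P ((\<lambda>i. e (Suc i))(k := e 0)))"
  by (rule formula_subst, assumption) (intro term_fun_upd term_var)

lemma uniform_at:
  assumes "definable_rel P"
  shows "\<exists>n\<ge>1. \<exists>K. \<forall>e r. covered (=) K (\<lambda>x. cgr n x r \<and> P (e(k := x))) \<or>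
     covered (=) K (\<lambda>x. cgr n x r \<and> \<not> P (e(k := x)))"
  using uniform[OF definable_upd[OF assms, of k]] unfolding uniformly_coset_like_def nat.case .

text \<open>
  The last member \<open>b\<^sub>L\<close> of a long ladder is kept as an additional parameter; it gives a
  set \<open>B\<close> of at most \<open>K\<close> candidates for \<open>x\<close> that holds the
  \<open>x\<close> of every earlier index. Whether \<open>B\<close> is contained in the set given by
  \<open>b\<^sub>j\<close> is a question without \<open>x\<close>. If the answer is always yes, the ladder
  is violated; if it is always no, then the intersection of the two sets has fewer than \<open>K\<close>
  elements.
\<close>

lemma no_ladders_algebraic:
  assumes IH: "\<And>P. definable_rel P \<Longrightarrow> \<not> ladders (\<lambda>_ _. True) (split_rel k P)"
    and "definable_rel \<theta>" "\<And>e. covered (=) K (\<lambda>x. \<theta> (e(k := x)))"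
  shows "\<not> ladders (\<lambda>_ _. True) (split_rel (Suc k) \<theta>)"
  using assms(2,3)
proof (induction K arbitrary: \<theta>)
  case 0
  show ?case
  proof
    assume "ladders (\<lambda>_ _. True) (split_rel (Suc k) \<theta>)"
    from laddersD[OF this, of 2] obtain a b where
      "\<forall>i<2 :: nat. \<forall>j<2. i \<noteq> j \<longrightarrow> True \<and> (split_rel (Suc k) \<theta> (a i) (b j) \<longleftrightarrow> i < j)"
      by (elim exE) (rule that, assumption)
    from this[rule_format, of 0 1] have "split_rel (Suc k) \<theta> (a 0) (b 1)" by simp
    then show False using 0(2) unfolding split_rel_Suc covered_0 by blast
  qed
next
  case (Suc K)
  show ?case
  proof
    assume lad: "ladders (\<lambda>_ _. True) (split_rel (Suc k) \<theta>)"
    \<comment> \<open>The parameters \<open>b\<^sub>j\<close> and \<open>b\<^sub>L\<close> are interleaved behind the variables up to \<open>k\<close>.\<close>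
    define \<theta>1 where "\<theta>1 e = \<theta> (\<lambda>i. if i < Suc k then e i else e (Suc k + 2 * i))" for e
    define \<theta>2 where "\<theta>2 e = \<theta> (\<lambda>i. if i < Suc k then e i else e (Suc k + (2 * i + 1)))" for e
    define \<chi> where "\<chi> e = (\<forall>x. \<theta>2 (e(k := x)) \<longrightarrow> \<theta>1 (e(k := x)))" for e
    have dfn12: "definable_rel \<theta>1" "definable_rel \<theta>2"
      unfolding \<theta>1_def[abs_def] \<theta>2_def[abs_def] by (rule formula_subst[OF Suc.prems(1)], intro term_if term_var)+
    have dfn_\<chi>: "definable_rel \<chi>"
      unfolding \<chi>_def[abs_def] by (rule formula_all, rule formula_imp) (rule definable_upd, rule dfn12)+
    have \<chi>_upd: "\<chi> (e(k := y)) = \<chi> e" for e y unfolding \<chi>_def fun_upd_upd ..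
    have covered2: "covered (=) (Suc K) (\<lambda>x. \<theta>2 (e(k := x)))" for e
    proof -
      have "(\<lambda>i. if i < Suc k then (e(k := x)) i else (e(k := x)) (Suc k + (2 * i + 1))) =
          (\<lambda>i. if i < Suc k then e i else e (Suc k + (2 * i + 1)))(k := x)" for x
        by (rule ext) simp
      then show ?thesis unfolding \<theta>2_def by (simp only: Suc.prems(2))
    qed
    have lad12: "ladders (split_rel (Suc k) \<theta>2) (split_rel (Suc k) \<theta>1)"
    proof (rule laddersI)
      fix L :: nat
      from laddersD[OF lad, of "Suc L"] obtain a b where
        ab: "\<forall>i<Suc L. \<forall>j<Suc L. i \<noteq> j \<longrightarrow> True \<and> (split_rel (Suc k) \<theta> (a i) (b j) \<longleftrightarrow> i < j)"
        by (elim exE) (rule that, assumption)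
      define b' where "b' j t = (if even (t - Suc k) then b j ((t - Suc k) div 2) else b L ((t - Suc k) div 2))" for j t
      have eq: "split_rel (Suc k) \<theta>1 (a i) (b' j) = split_rel (Suc k) \<theta> (a i) (b j)"
        "split_rel (Suc k) \<theta>2 (a i) (b' j) = split_rel (Suc k) \<theta> (a i) (b L)" for i j
        unfolding split_rel_def \<theta>1_def \<theta>2_def by (rule arg_cong[where f = \<theta>], rule ext, simp add: b'_def)+
      have "split_rel (Suc k) \<theta>2 (a i) (b' j) \<and> (split_rel (Suc k) \<theta>1 (a i) (b' j) \<longleftrightarrow> i < j)"
        if "i < L" "j < L" "i \<noteq> j" for i j
        unfolding eq using ab[rule_format, of i L] ab[rule_format, of i j] that by simp
      then show "\<exists>a b. \<forall>i<L. \<forall>j<L. i \<noteq> j \<longrightarrow>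
          split_rel (Suc k) \<theta>2 (a i) (b j) \<and> (split_rel (Suc k) \<theta>1 (a i) (b j) \<longleftrightarrow> i < j)"
        by (intro exI[of _ a] exI[of _ b'] allI impI)
    qed
    have "\<not> ladders (\<lambda>a b. split_rel (Suc k) \<theta>2 a b \<and> split_rel k \<chi> a b) (split_rel (Suc k) \<theta>1)"
    proof
      assume "ladders (\<lambda>a b. split_rel (Suc k) \<theta>2 a b \<and> split_rel k \<chi> a b) (split_rel (Suc k) \<theta>1)"
      from laddersD[OF this, of 2] obtain a b where
        ab: "\<forall>i<2 :: nat. \<forall>j<2. i \<noteq> j \<longrightarrow> (split_rel (Suc k) \<theta>2 (a i) (b j) \<and> split_rel k \<chi> (a i) (b j)) \<and>
          (split_rel (Suc k) \<theta>1 (a i) (b j) \<longleftrightarrow> i < j)" by (elim exE) (rule that, assumption)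
      from ab[rule_format, of 1 0] have "split_rel (Suc k) \<theta>2 (a 1) (b 0)" "split_rel k \<chi> (a 1) (b 0)"
        "\<not> split_rel (Suc k) \<theta>1 (a 1) (b 0)" by simp_all
      then show False unfolding split_rel_Suc split_rel_def[of k] \<chi>_def by blast
    qed
    moreover have "\<not> ladders (\<lambda>_ _. True) (split_rel k \<chi>)" by (rule IH[OF dfn_\<chi>])
    ultimately have lad': "ladders (\<lambda>a b. split_rel (Suc k) \<theta>2 a b \<and> \<not> split_rel k \<chi> a b) (split_rel (Suc k) \<theta>1)"
      using ladders_trichotomy[OF lad12, of "split_rel k \<chi>"] by blast
    define \<theta>' where "\<theta>' e = (\<theta>1 e \<and> \<theta>2 e \<and> \<not> \<chi> e)" for e
    have "definable_rel \<theta>'" unfolding \<theta>'_def[abs_def] by (intro formula_conj formula_not dfn12 dfn_\<chi>)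
    moreover have "covered (=) K (\<lambda>x. \<theta>' (e(k := x)))" for e
    proof (cases "\<chi> e")
      case True
      then show ?thesis unfolding \<theta>'_def \<chi>_upd covered_eq by simp
    next
      case False
      then obtain x0 where x0: "\<theta>2 (e(k := x0))" "\<not> \<theta>1 (e(k := x0))" unfolding \<chi>_def by blast
      let ?A = "{x. \<theta>2 (e(k := x))}"
      have A: "finite ?A" "card ?A \<le> Suc K" using covered2[of e] unfolding covered_eq by blast+
      have sub: "{x. \<theta>' (e(k := x))} \<subseteq> ?A - {x0}" unfolding \<theta>'_def using x0(2) by blast
      have "card (?A - {x0}) \<le> K" using A x0(1) by simp
      moreover have "card {x. \<theta>' (e(k := x))} \<le> card (?A - {x0})" by (rule card_mono[OF _ sub]) (use A in simp)
      moreover have "finite {x. \<theta>' (e(k := x))}" by (rule finite_subset[OF sub]) (use A in simp)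
      ultimately show ?thesis unfolding covered_eq by simp
    qed
    ultimately have "\<not> ladders (\<lambda>_ _. True) (split_rel (Suc k) \<theta>')" by (rule Suc.IH)
    moreover have "ladders (\<lambda>_ _. True) (split_rel (Suc k) \<theta>')"
      by (rule ladders_cong[OF lad']) (simp add: split_rel_Suc split_rel_def[of k] \<theta>'_def \<chi>_upd)
    ultimately show False by blast
  qed
qed

text \<open>
  The predicate \<open>Gen\<close> expresses that \<open>P\<close> fails for few \<open>x\<close> in the
  coset only, and it does not involve the variable \<open>k\<close>. Since it has no ladders by the
  induction hypothesis, it may be assumed constant, and then \<open>x\<close> is exceptional for all pairs
  of one order type.
\<close>

lemma no_ladders:
  assumes "definable_rel P" shows "\<not> ladders (\<lambda>_ _. True) (split_rel k P)"
  using assms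
proof (induction k arbitrary: P)
  case 0
  show ?case by (rule not_ladders_right) (simp add: split_rel_def)
next
  case (Suc k)
  show ?case
  proof
    assume lad: "ladders (\<lambda>_ _. True) (split_rel (Suc k) P)"
    obtain n K where n: "1 \<le> n" and U: "\<And>e r. covered (=) K (\<lambda>x. cgr n x r \<and> P (e(k := x))) \<or>
        covered (=) K (\<lambda>x. cgr n x r \<and> \<not> P (e(k := x)))" using uniform_at[OF Suc.prems, of k] by blast
    obtain R :: "'a set" where R: "finite R" "\<And>x. \<exists>r\<in>R. cgr n x r"
      using index n unfolding small_index_def by blast
    obtain r where lad_r: "ladders (\<lambda>a b. True \<and> cgr n (a k) r) (split_rel (Suc k) P)"
      using ladders_class[OF lad R(1), of "\<lambda>a r. cgr n (a k) r"] R(2) by blast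
    define Gen where "Gen e = covered (=) K (\<lambda>x. cgr n x r \<and> \<not> P (e(k := x)))" for e
    have cgr: "definable_rel (\<lambda>e. cgr n (e m) r)" for m
      by (rule formula_cgr) (rule term_plus term_var term_id n | assumption)+
    have dfn_Gen: "definable_rel Gen"
      unfolding Gen_def[abs_def]
      by (rule formula_covered, intro formula_eq term_var) (intro formula_conj formula_not cgr definable_upd Suc.prems)
    have Gen_upd: "Gen (e(k := y)) = Gen e" for e y unfolding Gen_def fun_upd_upd ..
    have "\<not> ladders (\<lambda>_ _. True) (split_rel k Gen)" by (rule Suc.IH[OF dfn_Gen])
    then consider
      "ladders (\<lambda>a b. (True \<and> cgr n (a k) r) \<and> split_rel k Gen a b) (split_rel (Suc k) P)" |
      "ladders (\<lambda>a b. (True \<and> cgr n (a k) r) \<and> \<not> split_rel k Gen a b) (split_rel (Suc k) P)"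
      using ladders_trichotomy[OF lad_r, of "split_rel k Gen"] by blast
    then show False
    proof cases
      case 1
      define \<theta> where "\<theta> e = (cgr n (e k) r \<and> \<not> P e \<and> Gen e)" for e
      have "definable_rel \<theta>" unfolding \<theta>_def[abs_def] by (intro formula_conj formula_not cgr dfn_Gen Suc.prems)
      moreover have "covered (=) K (\<lambda>x. \<theta> (e(k := x)))" for e
      proof (cases "Gen e")
        case True
        then show ?thesis unfolding \<theta>_def Gen_upd by (simp add: Gen_def)
      next
        case False
        then show ?thesis unfolding \<theta>_def Gen_upd covered_eq by simp
      qed
      ultimately have "\<not> ladders (\<lambda>_ _. True) (split_rel (Suc k) \<theta>)"
        by (intro no_ladders_algebraic[where K = K]) (assumption | rule Suc.IH | simp only:)+
      moreover have "ladders (\<lambda>_ _. True) (\<lambda>a b. \<not> split_rel (Suc k) \<theta> a b)"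
        by (rule ladders_cong[OF 1]) (simp add: split_rel_Suc split_rel_def[of k] \<theta>_def Gen_upd)
      from ladders_not[OF this] have "ladders (\<lambda>_ _. True) (split_rel (Suc k) \<theta>)" by simp
      ultimately show False by blast
    next
      case 2
      define \<theta> where "\<theta> e = (cgr n (e k) r \<and> P e \<and> \<not> Gen e)" for e
      have "definable_rel \<theta>" unfolding \<theta>_def[abs_def] by (intro formula_conj formula_not cgr dfn_Gen Suc.prems)
      moreover have "covered (=) K (\<lambda>x. \<theta> (e(k := x)))" for e
      proof (cases "Gen e")
        case True
        then show ?thesis unfolding \<theta>_def Gen_upd covered_eq by simp
      next
        case False
        then show ?thesis using U[of r e] unfolding \<theta>_def Gen_upd by (simp add: Gen_def)
      qed
      ultimately have "\<not> ladders (\<lambda>_ _. True) (split_rel (Suc k) \<theta>)"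
        by (intro no_ladders_algebraic[where K = K]) (assumption | rule Suc.IH | simp only:)+
      moreover have "ladders (\<lambda>_ _. True) (split_rel (Suc k) \<theta>)"
        by (rule ladders_cong[OF 2]) (simp add: split_rel_Suc split_rel_def[of k] \<theta>_def Gen_upd)
      ultimately show False by blast
    qed
  qed
qed

lemma stable: "is_stable M"
  unfolding is_stable_def
proof (intro allI impI notI)
  fix k l \<phi> assume \<phi>: "is_formula M (k + l) \<phi>" and op: "order_property M k l \<phi>"
  have "definable_rel (\<lambda>e. sat M e \<phi>)"
    using formula_wf[OF interprets_enriched_self] \<phi> unfolding is_formula_def by blast
  moreover have "ladders (\<lambda>_ _. True) (split_rel k (\<lambda>e. sat M e \<phi>))"
  proof (rule laddersI)
    fix L :: nat
    obtain a b where ab: "\<forall>i<L. length (a i) = k \<and> length (b i) = l"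
      "\<forall>i<L. \<forall>j<L. holds M \<phi> (a i @ b j) \<longleftrightarrow> i < j"
      using op[unfolded order_property_def, THEN spec, of L] by (elim exE conjE) (rule that, assumption+)
    have eq: "split_rel k (\<lambda>e. sat M e \<phi>) (nth (a i)) (\<lambda>t. b j ! (t - k)) = holds M \<phi> (a i @ b j)" if "i < L" for i j
    proof -
      have "(\<lambda>t. if t < k then a i ! t else b j ! (t - k)) = nth (a i @ b j)"
        using ab(1) that by (intro ext) (simp add: nth_append)
      then show ?thesis unfolding split_rel_def holds_def by simp
    qed
    have "True \<and> (split_rel k (\<lambda>e. sat M e \<phi>) (nth (a i)) (\<lambda>t. b j ! (t - k)) \<longleftrightarrow> i < j)"
      if "i < L" "j < L" for i j
      using eq[OF that(1)] ab(2) that by simp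
    then show "\<exists>a b. \<forall>i<L. \<forall>j<L. i \<noteq> j \<longrightarrow> True \<and> (split_rel k (\<lambda>e. sat M e \<phi>) (a i) (b j) \<longleftrightarrow> i < j)"
      by (intro exI[of _ "\<lambda>i. nth (a i)"] exI[of _ "\<lambda>j t. b j ! (t - k)"] allI impI)
  qed
  ultimately show False using no_ladders by blast
qed

end

section \<open>The equivalence\<close>

lemma formula_fst: "same_formula B B' P P' \<Longrightarrow> same_formula B B P P"
  unfolding same_formula_def by (elim exE conjE) (rule exI, intro conjI, assumption+)

lemma interprets_fst: "interprets M M' B B' \<Longrightarrow> interprets M M B B"
  unfolding interprets_def using formula_fst by (metis (no_types, lifting))

context elimination
begin

lemma formula_imp_qf:
  assumes fn: "\<And>f ts. fn_arity B f = Some (length ts) \<Longrightarrow> \<forall>t\<in>set ts. lin t \<Longrightarrow>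
      lin (\<lambda>e. fn_int B f (map (\<lambda>t. t e) ts))"
    and eq: "\<And>s t. lin s \<Longrightarrow> lin t \<Longrightarrow> qf cl (\<lambda>e. s e = t e)"
    and rel: "\<And>r ts. rel_arity B r = Some (length ts) \<Longrightarrow> \<forall>t\<in>set ts. lin t \<Longrightarrow>
      qf cl (\<lambda>e. rel_int B r (map (\<lambda>t. t e) ts))"
    and "same_formula B B P P"
  shows "qf cl P"
proof -
  from assms(4) obtain \<phi> where \<phi>: "wf_formula B \<phi>" "P = (\<lambda>e. sat B e \<phi>)"
    unfolding same_formula_def by auto
  have lin: "lin (\<lambda>e. eval B e t)" if "wf_term B t" for t
    using that
  proof (induction t)
    case (Var i)
    show ?case unfolding eval.simps by (rule lin_var)
  next
    case (App f ts)
    have "\<forall>t\<in>set (map (\<lambda>t e. eval B e t) ts). lin t" using App by simp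
    moreover have "fn_arity B f = Some (length (map (\<lambda>t e. eval B e t) ts))" using App.prems by simp
    ultimately have "lin (\<lambda>e. fn_int B f (map (\<lambda>t. t e) (map (\<lambda>t e. eval B e t) ts)))" by (intro fn)
    then show ?case by (simp add: o_def)
  qed
  show ?thesis unfolding \<phi>(2) using \<phi>(1)
  proof (induction \<phi>)
    case (Eq s t)
    then show ?case by (simp add: eq lin)
  next
    case (Rel r ts)
    have "\<forall>t\<in>set (map (\<lambda>t e. eval B e t) ts). lin t" using Rel lin by simp
    moreover have "rel_arity B r = Some (length (map (\<lambda>t e. eval B e t) ts))" using Rel by simp
    ultimately have "qf cl (\<lambda>e. rel_int B r (map (\<lambda>t. t e) (map (\<lambda>t e. eval B e t) ts)))" by (intro rel)
    then show ?case by (simp add: o_def)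
  next
    case (Neg \<phi>)
    then show ?case by (simp add: qf_not)
  next
    case (Conj \<phi> \<psi>)
    then show ?case by (simp add: qf_conj)
  next
    case (Ex i \<phi>)
    then have "qf cl (\<lambda>e. sat B e \<phi>)" by simp
    from qf_ex[OF this] show ?case by simp
  qed
qed

end

lemma length_2_conv: "length ts = 2 \<longleftrightarrow> (\<exists>s t. ts = [s, t])"
  by (auto simp: length_Suc_conv numeral_2_eq_2)

lemma lin_enriched:
  fixes S :: "(plus_symbol, less_symbol, 'a::ab_group_add) fo_struct"
  assumes S: "fn_arity S = [Plus \<mapsto> 2]" "fn_int S = plus_int"
    and f: "fn_arity (enriched id S) f = Some (length ts)" and ts: "\<forall>t\<in>set ts. lin t"
  shows "lin (\<lambda>e. fn_int (enriched id S) f (map (\<lambda>t. t e) ts))"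
proof (cases f)
  case None
  then have "length ts = 2" using f by simp
  then obtain s t where "ts = [s, t]" unfolding length_2_conv by blast
  then show ?thesis using ts None by (simp add: lin_add)
next
  case (Some h)
  show ?thesis
  proof (cases h)
    case (Inl p)
    then have "p = Plus" by (cases p) simp
    then have "length ts = 2" using f Some Inl by (simp add: S)
    then obtain s t where "ts = [s, t]" unfolding length_2_conv by blast
    then show ?thesis using ts Some Inl \<open>p = Plus\<close> by (simp add: lin_add S)
  next
    case (Inr c)
    then show ?thesis using Some by (simp add: lin_const)
  qed
qed

lemma ordered_group_formula_imp_qf:
  fixes P :: "(nat \<Rightarrow> 'a::linordered_ab_group_add) \<Rightarrow> bool"
  assumes "small_index TYPE('a)" "regular_group TYPE('a)" "0 < (g :: 'a)"
    and P: "same_formula (enriched id ordered_group_struct) (enriched id ordered_group_struct) P P"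
  shows "qf order_class P"
proof -
  interpret elimination "order_class :: 'a \<Rightarrow> _" "\<lambda>(a, b). (b, a)" by (rule elimination_order[OF assms(1-3)])
  show ?thesis
  proof (rule formula_imp_qf[OF _ _ _ P])
    fix f and ts :: "((nat \<Rightarrow> 'a) \<Rightarrow> 'a) list"
    assume "fn_arity (enriched id (ordered_group_struct :: (_, _, 'a) fo_struct)) f = Some (length ts)" "\<forall>t\<in>set ts. lin t"
    then show "lin (\<lambda>e. fn_int (enriched id ordered_group_struct) f (map (\<lambda>t. t e) ts))"
      by (intro lin_enriched) (simp_all add: ordered_group_struct_def)
  next
    fix s t :: "(nat \<Rightarrow> 'a) \<Rightarrow> 'a" assume "lin s" "lin t"
    then have "qf order_class (\<lambda>e. order_class (s e - t e) = (False, False))" by (intro qf_cl lin_diff)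
    then show "qf order_class (\<lambda>e. s e = t e)" unfolding order_class_simps .
  next
    fix r and ts :: "((nat \<Rightarrow> 'a) \<Rightarrow> 'a) list"
    assume r: "rel_arity (enriched id (ordered_group_struct :: (_, _, 'a) fo_struct)) r = Some (length ts)" and ts: "\<forall>t\<in>set ts. lin t"
    have "r = Less" by (cases r) simp
    then have "length ts = 2" using r by (simp add: ordered_group_struct_def)
    then obtain s t where "ts = [s, t]" unfolding length_2_conv by blast
    then show "qf order_class (\<lambda>e. rel_int (enriched id ordered_group_struct) r (map (\<lambda>t. t e) ts))"
      using ts \<open>r = Less\<close> by (simp add: ordered_group_struct_def qf_less)
  qed
qed

lemma group_formula_imp_qf:
  fixes P :: "(nat \<Rightarrow> 'a::linordered_ab_group_add) \<Rightarrow> bool"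
  assumes "small_index TYPE('a)" "0 < (g :: 'a)" and P: "same_formula (enriched id group_struct) (enriched id group_struct) P P"
  shows "qf (\<lambda>v. v = 0) P"
proof -
  interpret elimination "\<lambda>v :: 'a. v = 0" id by (rule elimination_equality[OF assms(1,2)])
  show ?thesis
  proof (rule formula_imp_qf[OF _ _ _ P])
    fix f and ts :: "((nat \<Rightarrow> 'a) \<Rightarrow> 'a) list"
    assume "fn_arity (enriched id (group_struct :: (_, _, 'a) fo_struct)) f = Some (length ts)" "\<forall>t\<in>set ts. lin t"
    then show "lin (\<lambda>e. fn_int (enriched id group_struct) f (map (\<lambda>t. t e) ts))"
      by (intro lin_enriched) (simp_all add: group_struct_def)
  next
    fix s t :: "(nat \<Rightarrow> 'a) \<Rightarrow> 'a" assume "lin s" "lin t"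
    then have "qf (\<lambda>v. v = 0) (\<lambda>e. ((s e - t e) = 0) = True)"
      by (intro qf_cl[where cl = "\<lambda>v. v = 0" and t = "\<lambda>e. s e - t e"] lin_diff)
    then show "qf (\<lambda>v. v = 0) (\<lambda>e. s e = t e)" by simp
  next
    fix r and ts :: "((nat \<Rightarrow> 'a) \<Rightarrow> 'a) list"
    assume "rel_arity (enriched id (group_struct :: (_, _, 'a) fo_struct)) r = Some (length ts)"
    then show "qf (\<lambda>v. v = 0) (\<lambda>e. rel_int (enriched id group_struct) r (map (\<lambda>t. t e) ts))"
      by (simp add: group_struct_def)
  qed
qed

lemma trivial_group_finite:
  assumes "\<not> (\<exists>g :: 'a::linordered_ab_group_add. 0 < g)" shows "(UNIV :: 'a set) = {0}"
proof -
  have "x = 0" for x :: 'a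
  proof (rule ccontr)
    assume "x \<noteq> 0"
    then have "0 < x \<or> 0 < - x" by (simp add: neg_0_less_iff_less) (metis linorder_neqE neg_0_less_iff_less)
    then show False using assms by blast
  qed
  then show ?thesis by auto
qed

lemma coset_like_if_trivial:
  assumes "\<not> (\<exists>g :: 'a::linordered_ab_group_add. 0 < g)" shows "coset_like (D :: 'a set)"
proof -
  have "finite (A :: 'a set)" for A
    by (rule finite_subset[OF subset_UNIV]) (simp add: trivial_group_finite[OF assms])
  then show ?thesis unfolding coset_like_def by (intro exI[of _ 1]) simp
qed

lemma uniformly_coset_like_if_trivial:
  assumes "\<not> (\<exists>g :: 'a::linordered_ab_group_add. 0 < g)"
  shows "uniformly_coset_like (P :: (nat \<Rightarrow> 'a) \<Rightarrow> bool)"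
proof -
  have "covered (=) (Suc 0) A" for A :: "'a \<Rightarrow> bool"
    unfolding covered_def
  proof (intro exI[of _ "{0}"] conjI allI impI)
    show "\<exists>r\<in>{0}. x = r" for x :: 'a using trivial_group_finite[OF assms] by blast
  qed simp_all
  then show ?thesis unfolding uniformly_coset_like_def by (intro exI[where x = "1 :: int"] conjI exI[where x = "Suc 0"]) simp_all
qed

text \<open>
  If both parts of a coset were infinite, they would contain congruent nonexceptional elements.
\<close>

lemma definable_unary_imp_coset_like:
  assumes index: "small_index TYPE('a::linordered_ab_group_add)"
    and D: "definable_unary (group_struct :: (plus_symbol, less_symbol, 'a) fo_struct) D"
  shows "coset_like D"
proof (cases "\<exists>g :: 'a. 0 < g")
  case True
  then obtain g :: 'a where g: "0 < g" ..
  obtain n E where n: "1 \<le> n" "finite E" "\<And>x x'. cgr n x x' \<and> x \<notin> E \<and> x' \<notin> E \<Longrightarrow> x \<in> D \<longleftrightarrow> x' \<in> D"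
    using qf_equality_periodic[OF group_formula_imp_qf[OF index g definable_unary_imp_formula[OF D]], where i = 0]
    unfolding fun_upd_same by blast
  have "finite {x \<in> D. cgr n x r} \<or> finite {x. x \<notin> D \<and> cgr n x r}" for r
  proof (rule ccontr)
    assume "\<not> ?thesis"
    then have inf: "infinite ({x \<in> D. cgr n x r} - E)" "infinite ({x. x \<notin> D \<and> cgr n x r} - E)"
      using n(2) by simp_all
    obtain x where x: "x \<in> {x \<in> D. cgr n x r} - E" using inf(1) by (metis ex_in_conv finite.emptyI)
    obtain x' where x': "x' \<in> {x. x \<notin> D \<and> cgr n x r} - E" using inf(2) by (metis ex_in_conv finite.emptyI)
    have "cgr n x x'" using cgr_trans[OF _ cgr_sym, of n x r x'] x x' by simp
    then show False using n(3)[of x x'] x x' by simp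
  qed
  then show ?thesis unfolding coset_like_def using n(1) by blast
qed (rule coset_like_if_trivial)

text \<open>
  The set is a finite union of cosets, changed on the finite sets \<open>A\<close> and \<open>B\<close>.
\<close>

lemma coset_like_imp_definable_unary:
  assumes index: "small_index TYPE('a::ab_group_add)" and "coset_like D"
  shows "definable_unary (group_struct :: (plus_symbol, less_symbol, 'a) fo_struct) D"
proof -
  obtain n where n: "1 \<le> n" and D: "\<And>r. finite {x \<in> D. cgr n x r} \<or> finite {x. x \<notin> D \<and> cgr n x r}"
    using assms(2) unfolding coset_like_def by blast
  obtain R :: "'a set" where R: "finite R" "\<And>x. \<exists>r\<in>R. cgr n x r"
    using index n unfolding small_index_def by blast
  define S where "S = {r \<in> R. finite {x \<in> D. cgr n x r}}"
  define A where "A = (\<Union>r\<in>S. {x \<in> D. cgr n x r})"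
  define B where "B = (\<Union>r\<in>R - S. {x. x \<notin> D \<and> cgr n x r})"
  have fin: "finite S" "finite (R - S)" using R(1) unfolding S_def by simp_all
  have "finite A" unfolding A_def using fin(1) by (rule finite_UN_I) (simp add: S_def)
  have "finite B" unfolding B_def using fin(2) by (rule finite_UN_I) (use D in \<open>auto simp: S_def\<close>)
  have D_iff: "x \<in> D \<longleftrightarrow> \<not> (\<forall>a\<in>A. \<not> x = a) \<or> (\<not> (\<forall>r\<in>R - S. \<not> cgr n x r) \<and> (\<forall>b\<in>B. \<not> x = b))" for x
  proof
    assume x: "x \<in> D"
    obtain r where r: "r \<in> R" "cgr n x r" using R(2) by blast
    show "\<not> (\<forall>a\<in>A. \<not> x = a) \<or> (\<not> (\<forall>r\<in>R - S. \<not> cgr n x r) \<and> (\<forall>b\<in>B. \<not> x = b))"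
    proof (cases "r \<in> S")
      case True
      then have "x \<in> A" unfolding A_def using x r(2) by blast
      then show ?thesis by blast
    next
      case False
      moreover have "x \<notin> B" unfolding B_def using x by blast
      ultimately show ?thesis using r by blast
    qed
  next
    assume "\<not> (\<forall>a\<in>A. \<not> x = a) \<or> (\<not> (\<forall>r\<in>R - S. \<not> cgr n x r) \<and> (\<forall>b\<in>B. \<not> x = b))"
    then show "x \<in> D"
    proof
      assume "\<not> (\<forall>a\<in>A. \<not> x = a)"
      then show ?thesis unfolding A_def by blast
    next
      assume "\<not> (\<forall>r\<in>R - S. \<not> cgr n x r) \<and> (\<forall>b\<in>B. \<not> x = b)"
      then show ?thesis unfolding B_def by blast
    qed
  qed
  define G :: "(plus_symbol, less_symbol, 'a) fo_struct" where "G = group_struct"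
  have cgr: "same_formula (enriched id G) (enriched id G) (\<lambda>e. cgr n (e 0) r) (\<lambda>e. cgr n (e 0) r)" for r
    by (rule formula_cgr) (rule term_plus term_var term_id n | assumption)+
  have "same_formula (enriched id G) (enriched id G) (\<lambda>e. e 0 \<in> D) (\<lambda>e. e 0 \<in> D)"
    unfolding D_iff
    by (intro formula_disj formula_conj formula_not formula_ball formula_eq term_var term_id cgr \<open>finite A\<close> \<open>finite B\<close> fin(2))
  then show ?thesis unfolding G_def by (rule formula_imp_definable_unary[OF expands_refl])
qed

lemma coset_like_uniform:
  assumes index: "small_index TYPE('a::ab_group_add)" and "coset_like (D :: 'a set)"
  shows "\<exists>n\<ge>1. \<exists>K. \<forall>r. covered (=) K (\<lambda>x. cgr n x r \<and> x \<in> D) \<or> covered (=) K (\<lambda>x. cgr n x r \<and> x \<notin> D)"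
proof -
  obtain n where n: "1 \<le> n" and D: "\<And>r. finite {x \<in> D. cgr n x r} \<or> finite {x. x \<notin> D \<and> cgr n x r}"
    using assms(2) unfolding coset_like_def by blast
  obtain R :: "'a set" where R: "finite R" "\<And>x. \<exists>r\<in>R. cgr n x r"
    using index n unfolding small_index_def by blast
  define f where "f r = card {x. cgr n x r \<and> x \<in> D} + card {x. cgr n x r \<and> x \<notin> D}" for r
  define K where "K = (\<Sum>r\<in>R. f r)"
  have "covered (=) K (\<lambda>x. cgr n x r \<and> x \<in> D) \<or> covered (=) K (\<lambda>x. cgr n x r \<and> x \<notin> D)" for r
  proof -
    obtain r0 where r0: "r0 \<in> R" "cgr n r r0" using R(2) by blast
    have same: "cgr n x r \<longleftrightarrow> cgr n x r0" for x
      using cgr_trans[OF _ r0(2)] cgr_trans[OF _ cgr_sym[OF r0(2)]] by blast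
    have "f r0 \<le> K" unfolding K_def using r0(1) R(1) by (intro member_le_sum) simp_all
    then show ?thesis using D[of r0] unfolding same covered_eq f_def by (auto simp: conj_commute)
  qed
  then show ?thesis using n by blast
qed

lemma wf_same_arity: "fn_arity M = fn_arity M' \<Longrightarrow> rel_arity M = rel_arity M' \<Longrightarrow> wf_formula M \<phi> = wf_formula M' \<phi>"
proof -
  assume arity: "fn_arity M = fn_arity M'" "rel_arity M = rel_arity M'"
  have "wf_term M t = wf_term M' t" for t by (induction t) (simp_all add: arity)
  then show ?thesis by (induction \<phi>) (simp_all add: arity)
qed

lemma elementarily_equivalent_sym:
  assumes "elementarily_equivalent M M'" shows "elementarily_equivalent M' M"
proof -
  have arity: "fn_arity M = fn_arity M'" "rel_arity M = rel_arity M'"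
    using assms unfolding elementarily_equivalent_def same_language_def by blast+
  have "is_formula M 0 \<phi> = is_formula M' 0 \<phi>" for \<phi>
    unfolding is_formula_def wf_same_arity[OF arity] ..
  then show ?thesis using assms unfolding elementarily_equivalent_def same_language_def by simp
qed

text \<open>
  The parameters of the set with a jump are appended to the right tuples of the ladder.
\<close>

lemma stable_imp_coset_like:
  fixes M :: "('f, 'r, 'a::linordered_ab_group_add) fo_struct"
  assumes "tame M g" and stable: "is_stable M"
    and expands: "expands M (group_struct :: (plus_symbol, less_symbol, 'a) fo_struct)"
    and D: "same_formula (enriched id M) (enriched id M) (\<lambda>e. e 0 \<in> D) (\<lambda>e. e 0 \<in> D)"
  shows "coset_like D"
proof (rule ccontr)
  assume not: "\<not> coset_like D"
  interpret tame M g by (rule assms(1))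
  obtain D' V W where D': "definable_rel (\<lambda>e. e 0 \<in> D')" and jump: "jump D' V W"
    using exists_jump_affine[OF D not] by blast
  \<comment> \<open>Negating the formula, if necessary, makes the lower piece the one where it holds.\<close>
  define pos where "pos = (W - V \<subseteq> D')"
  have sides: "x \<in> W - V \<Longrightarrow> (x \<in> D') = pos" "x \<in> V \<Longrightarrow> (x \<in> D') = (\<not> pos)" for x
  proof -
    have "infinite (W - V)" using jump unfolding jump_def by blast
    then obtain w where "w \<in> W - V" by (metis ex_in_conv finite.emptyI)
    have "V \<subseteq> D' \<and> (W - V) \<inter> D' = {} \<or> V \<inter> D' = {} \<and> W - V \<subseteq> D'" using jump unfolding jump_def by simp
    then consider "V \<subseteq> D'" "(W - V) \<inter> D' = {}" "\<not> pos" | "V \<inter> D' = {}" "W - V \<subseteq> D'" "pos"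
      using \<open>w \<in> W - V\<close> unfolding pos_def by (elim disjE conjE) blast+
    then show "x \<in> W - V \<Longrightarrow> (x \<in> D') = pos" "x \<in> V \<Longrightarrow> (x \<in> D') = (\<not> pos)"
      by (cases; blast)+
  qed
  define P where "P e \<longleftrightarrow> (e 0 + e 1 \<in> D') = pos" for e :: "nat \<Rightarrow> 'a"
  have "definable_rel (\<lambda>e. (\<lambda>i. e 0 + e 1) 0 \<in> D')"
    by (rule formula_subst[OF D']) (intro term_plus term_var)
  then have "definable_rel P" unfolding P_def[abs_def] by (intro formula_iff formula_const)
  moreover have "interprets (enriched id M) (enriched id M) (with_constants id M) (with_constants id M)"
    using group_plus_formula[OF expands] term_with_constants[of id M id M]
    by (intro interprets_enriched interprets_with_constants_self) simp_all
  ultimately have P: "same_formula (with_constants id M) (with_constants id M) P P" by (rule interprets_formula[rotated])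
  have dep: "\<forall>e e'. (\<forall>i<2. e i = e' i) \<longrightarrow> P e = P e'" unfolding P_def by simp
  from constants_to_parameters[OF P dep dep] obtain \<phi> cs where \<phi>: "is_formula M (2 + length cs) \<phi>"
    "\<forall>as. length as = 2 \<longrightarrow> (P (nth as) \<longleftrightarrow> holds M \<phi> (as @ map id cs))"
    by (elim exE conjE) (rule that, assumption+)
  have "order_property M 1 (1 + length cs) \<phi>"
    unfolding order_property_def
  proof
    fix n :: nat
    from jump_ladder[OF regular jump, of n] obtain a b where
      ab: "\<forall>i<n. \<forall>j<n. if i < j then a i + b j \<in> W - V else a i + b j \<in> V"
      by (elim exE) (rule that, assumption)
    have "holds M \<phi> ([a i] @ (b j # cs)) \<longleftrightarrow> i < j" if "i < n" "j < n" for i j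
    proof -
      have "holds M \<phi> ([a i] @ (b j # cs)) \<longleftrightarrow> (a i + b j \<in> D') = pos"
        using \<phi>(2)[rule_format, of "[a i, b j]"] unfolding P_def by simp
      also have "\<dots> \<longleftrightarrow> i < j"
        using ab[rule_format, OF that] sides[of "a i + b j"] by (cases "i < j") simp_all
      finally show ?thesis .
    qed
    then show "\<exists>a b. (\<forall>i<n. length (a i) = 1 \<and> length (b i) = 1 + length cs) \<and>
        (\<forall>i<n. \<forall>i'<n. holds M \<phi> (a i @ b i') \<longleftrightarrow> i < i')"
      by (intro exI[of _ "\<lambda>i. [a i]"] exI[of _ "\<lambda>j. b j # cs"]) (simp del: append.simps)
  qed
  moreover have "is_formula M (1 + (1 + length cs)) \<phi>" using \<phi>(1) by simp
  then have "\<not> order_property M 1 (1 + length cs) \<phi>"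
    by (rule stable[unfolded is_stable_def, rule_format])
  ultimately show False by simp
qed

text \<open>
  The form of uniformity for one value of the parameters; it is expressed by a formula.
\<close>

definition coset_like_bound :: "int \<Rightarrow> nat \<Rightarrow> ((nat \<Rightarrow> 'a::ab_group_add) \<Rightarrow> bool) \<Rightarrow> (nat \<Rightarrow> 'a) \<Rightarrow> bool" where
  "coset_like_bound n K P e \<longleftrightarrow>
     (\<forall>r. covered (=) K (\<lambda>x. cgr n x r \<and> P (x ## e)) \<or> covered (=) K (\<lambda>x. cgr n x r \<and> \<not> P (x ## e)))"

lemma formula_coset_like_bound:
  assumes P: "same_formula (enriched \<kappa> M) (enriched \<kappa>' M') P P'" and n: "1 \<le> n"
  shows "same_formula (enriched \<kappa> M) (enriched \<kappa>' M') (coset_like_bound n K P) (coset_like_bound n K P')"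
proof -
  have cgr: "same_formula (enriched \<kappa> M) (enriched \<kappa>' M') (\<lambda>e. cgr n (e 0) (e (Suc 0))) (\<lambda>e. cgr n (e 0) (e (Suc 0)))"
    by (rule formula_cgr) (rule term_plus term_var n | assumption)+
  have P2: "same_formula (enriched \<kappa> M) (enriched \<kappa>' M') (\<lambda>e. P (e 0 ## (\<lambda>i. e (Suc (Suc i))))) (\<lambda>e. P' (e 0 ## (\<lambda>i. e (Suc (Suc i)))))"
    by (rule formula_subst[OF P]) (intro term_case_nat term_var)
  have eq: "same_formula (enriched \<kappa> M) (enriched \<kappa>' M') (\<lambda>e. e 0 = e 1) (\<lambda>e. e 0 = e 1)"
    by (intro formula_eq term_var)
  show ?thesis unfolding coset_like_bound_def[abs_def]
  proof (rule formula_all, rule formula_disj)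
    show "same_formula (enriched \<kappa> M) (enriched \<kappa>' M')
        (\<lambda>e. covered (=) K (\<lambda>x. cgr n x (e 0) \<and> P (x ## (\<lambda>i. e (Suc i)))))
        (\<lambda>e. covered (=) K (\<lambda>x. cgr n x (e 0) \<and> P' (x ## (\<lambda>i. e (Suc i)))))"
      by (rule formula_covered[OF eq]) (intro formula_conj cgr P2)
    show "same_formula (enriched \<kappa> M) (enriched \<kappa>' M')
        (\<lambda>e. covered (=) K (\<lambda>x. cgr n x (e 0) \<and> \<not> P (x ## (\<lambda>i. e (Suc i)))))
        (\<lambda>e. covered (=) K (\<lambda>x. cgr n x (e 0) \<and> \<not> P' (x ## (\<lambda>i. e (Suc i)))))"
      by (rule formula_covered[OF eq]) (intro formula_conj formula_not cgr P2)
  qed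
qed

lemma coset_like_bound_imp_coset_like:
  assumes "coset_like_bound n K P e" "1 \<le> n" shows "coset_like {x. P (x ## e)}"
proof -
  have "finite {x \<in> {x. P (x ## e)}. cgr n x r} \<or> finite {x. x \<notin> {x. P (x ## e)} \<and> cgr n x r}" for r
    using assms(1)[unfolded coset_like_bound_def, THEN spec, of r] unfolding covered_eq
    by (auto simp: conj_commute)
  then show ?thesis unfolding coset_like_def using assms(2) by blast
qed

lemma definable_unaryE:
  assumes "definable_unary M D"
  obtains \<phi> bs where "is_formula M (1 + length bs) \<phi>" "D = {x. sat M (x ## nth bs) \<phi>}"
proof -
  obtain \<phi> bs where \<phi>: "is_formula M (1 + length bs) \<phi>" "(\<lambda>x. [x]) ` D = solutions M 1 \<phi> bs"
    using assms unfolding definable_unary_def definable_def by blast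
  have "x \<in> D \<longleftrightarrow> sat M (x ## nth bs) \<phi>" for x
  proof -
    have "x \<in> D \<longleftrightarrow> [x] \<in> (\<lambda>x. [x]) ` D" by (simp add: image_iff)
    also have "\<dots> \<longleftrightarrow> sat M (nth (x # bs)) \<phi>" unfolding \<phi>(2) solutions_def holds_def by simp
    also have "nth (x # bs) = x ## nth bs" by (rule ext) (simp add: nth_Cons)
    finally show ?thesis .
  qed
  then show thesis using that[OF \<phi>(1)] by blast
qed

lemma definable_unaryI:
  assumes "is_formula M (1 + length bs) \<phi>"
  shows "definable_unary M {x. sat M (x ## nth bs) \<phi>}"
proof -
  have nth: "nth (x # bs) = x ## nth bs" for x by (rule ext) (simp add: nth_Cons)
  have "(\<lambda>x. [x]) ` {x. sat M (x ## nth bs) \<phi>} = solutions M 1 \<phi> bs"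
  proof (rule set_eqI)
    fix as show "as \<in> (\<lambda>x. [x]) ` {x. sat M (x ## nth bs) \<phi>} \<longleftrightarrow> as \<in> solutions M 1 \<phi> bs"
    proof (cases "length as = 1")
      case True
      then obtain x where "as = [x]" by (auto simp: length_Suc_conv)
      then show ?thesis by (simp add: solutions_def holds_def nth image_iff)
    qed (auto simp: solutions_def)
  qed
  then show ?thesis using assms unfolding definable_unary_def definable_def by blast
qed

theorem proposition5p4:
  fixes M :: "('f, 'r, 'a::linordered_ab_group_add) fo_struct"
    and MM :: "('f, 'r, 'b::linordered_ab_group_add) fo_struct"
    and N :: "(plus_symbol, less_symbol, 'a) fo_struct"
    and NN :: "(plus_symbol, less_symbol, 'b) fo_struct"
    and H :: "(plus_symbol, less_symbol, 'h::linordered_ab_group_add) fo_struct"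
    and j :: "'a \<Rightarrow> 'b" and \<kappa> :: "'k rel"
  assumes N_def: "N = ordered_group_struct"
    and NN_def: "NN = ordered_group_struct"
    and H_def: "H = ordered_group_struct"
    and "archimedean_group TYPE('h)" and "small_quotients TYPE('h)"
    and "elementarily_equivalent N H"
    and "reduct M N" and "expands M (group_struct :: (plus_symbol, less_symbol, 'a) fo_struct)"
    and "exceeds_size \<kappa> M" and "monster_model \<kappa> j N NN"
    and "extended_reduct M N j NN MM"
  shows
    "(is_stable M \<longleftrightarrow>
       (\<forall>D :: 'a set. definable_unary M D \<longrightarrow>
          definable_unary (group_struct :: (plus_symbol, less_symbol, 'a) fo_struct) D)) \<and>
     (is_stable M \<longleftrightarrow>
       (\<forall>D :: 'b set. definable_unary MM D \<longrightarrow>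
          definable_unary (group_struct :: (plus_symbol, less_symbol, 'b) fo_struct) D))"
proof -
  note equiv = assms(6) and expands = assms(8) and extended = assms(11)
  have emb: "elementary_embedding j N NN" using assms(10) unfolding monster_model_def by blast
  have index: "small_index TYPE('a)"
    by (rule small_index_transfer[OF H_def N_def equiv small_quotients_imp_small_index[OF assms(5)]])
  have regular: "regular_group TYPE('a)"
    by (rule regular_group_transfer[OF H_def N_def equiv archimedean_imp_regular[OF assms(4)]])
  have index': "small_index TYPE('b)"
    by (rule small_index_transfer[OF N_def NN_def elementarily_equivalent_sym[OF
          elementary_embedding_imp_equivalent[OF emb]] index])
  note int = extended_reduct_interprets[OF extended]
  have intE: "interprets (enriched id M) (enriched id M) (enriched id N) (enriched id N)"
  proof (rule interprets_enriched[OF interprets_fst[OF int] term_const])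
    show "same_formula (enriched id N) (enriched id N) (\<lambda>e. e 0 = e 1 + e 2) (\<lambda>e. e 0 = e 1 + e 2)"
      by (intro formula_eq term_plus term_var)
  qed
  have tame: "tame M g" if g: "0 < g" for g
  proof
    show "small_index TYPE('a)" "regular_group TYPE('a)" "0 < g" by (fact index, fact regular, fact g)
    fix P assume "same_formula (enriched id M) (enriched id M) P P"
    from interprets_formula[OF intE this]
    have "qf order_class P" unfolding N_def by (rule ordered_group_formula_imp_qf[OF index regular g])
    from qf_controlled[OF this, of 0] obtain n m where n: "1 \<le> n" and ctrl: "\<And>e. \<exists>\<U>. finite \<U> \<and> card \<U> \<le> m \<and>
        (\<forall>U\<in>\<U>. cut U) \<and> controls n \<U> {x. P (e(0 := x))}" by blast
    have "(0 ## e)(0 := x) = x ## e" for e :: "nat \<Rightarrow> 'a" and x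
      by (rule ext) (simp split: nat.split)
    then have "\<forall>e. \<exists>\<U>. finite \<U> \<and> card \<U> \<le> m \<and> (\<forall>U\<in>\<U>. cut U) \<and> controls n \<U> {x. P (x ## e)}"
      using ctrl[of "0 ## _"] by simp
    then show "\<exists>n\<ge>1. \<exists>m. \<forall>e. \<exists>\<U>. finite \<U> \<and> card \<U> \<le> m \<and> (\<forall>U\<in>\<U>. cut U) \<and> controls n \<U> {x. P (x ## e)}"
      by (intro exI[where x = n] conjI exI[where x = m] n)
  qed
  let ?unary = "\<forall>D :: 'a set. definable_unary M D \<longrightarrow>
      definable_unary (group_struct :: (plus_symbol, less_symbol, 'a) fo_struct) D"
  let ?unary' = "\<forall>D :: 'b set. definable_unary MM D \<longrightarrow>
      definable_unary (group_struct :: (plus_symbol, less_symbol, 'b) fo_struct) D"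
  let ?uniform = "\<forall>P. same_formula (enriched id M) (enriched id M) P P \<longrightarrow> uniformly_coset_like P"
  have arity: "fn_arity M = fn_arity MM" "rel_arity M = rel_arity MM"
    using extended unfolding extended_reduct_def same_language_def by blast+
  have pair: "same_formula (enriched id N) (enriched j NN) (\<lambda>e. sat M e \<phi>) (\<lambda>e. sat MM e \<phi>)" if "wf_formula M \<phi>" for \<phi>
    by (rule formula_wf[OF int that])
  have stable_unary: ?unary if stable: "is_stable M"
  proof (intro allI impI)
    fix D :: "'a set" assume "definable_unary M D"
    then have D: "same_formula (enriched id M) (enriched id M) (\<lambda>e. e 0 \<in> D) (\<lambda>e. e 0 \<in> D)"
      by (rule definable_unary_imp_formula)
    have "coset_like D"
    proof (cases "\<exists>g :: 'a. 0 < g")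
      case True
      then obtain g :: 'a where "0 < g" ..
      from stable_imp_coset_like[OF tame[OF this] stable expands D] show ?thesis .
    qed (rule coset_like_if_trivial)
    then show "definable_unary (group_struct :: (plus_symbol, less_symbol, 'a) fo_struct) D"
      by (rule coset_like_imp_definable_unary[OF index])
  qed
  have unary_uniform: ?uniform if unary: ?unary
  proof (intro allI impI)
    fix P :: "(nat \<Rightarrow> 'a) \<Rightarrow> bool" assume P: "same_formula (enriched id M) (enriched id M) P P"
    show "uniformly_coset_like P"
    proof (cases "\<exists>g :: 'a. 0 < g")
      case True
      then obtain g :: 'a where g: "0 < g" ..
      interpret tame M g by (rule tame[OF g])
      interpret tame_coset_like M g
      proof
        fix D :: "'a set" assume "definable_rel (\<lambda>e. e 0 \<in> D)"
        from formula_imp_definable_unary[OF expands this]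
        have "definable_unary (group_struct :: (plus_symbol, less_symbol, 'a) fo_struct) D"
          using unary by blast
        then show "coset_like D" by (rule definable_unary_imp_coset_like[OF index])
      qed
      from P show ?thesis by (rule uniform)
    qed (rule uniformly_coset_like_if_trivial)
  qed
  have uniform_stable: "is_stable M" if uniform: ?uniform
  proof -
    interpret uniform_structure M by standard (use index uniform in blast)+
    show ?thesis by (rule stable)
  qed
  have uniform_unary': ?unary' if uniform: ?uniform
  proof (intro allI impI)
    fix D :: "'b set" assume "definable_unary MM D"
    then obtain \<phi> bs where \<phi>: "is_formula MM (1 + length bs) \<phi>" and D: "D = {x. sat MM (x ## nth bs) \<phi>}"
      by (rule definable_unaryE)
    have wf: "wf_formula M \<phi>" using \<phi> wf_same_arity[OF arity] unfolding is_formula_def by blast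
    have "uniformly_coset_like (\<lambda>e. sat M e \<phi>)"
      using uniform formula_wf[OF interprets_enriched_self wf] by blast
    then obtain n K where n: "1 \<le> n" and bound: "\<And>e. coset_like_bound n K (\<lambda>e. sat M e \<phi>) e"
      unfolding uniformly_coset_like_def coset_like_bound_def by blast
    have "same_formula (enriched id N) (enriched j NN) (\<lambda>e. \<not> coset_like_bound n K (\<lambda>e. sat M e \<phi>) (\<lambda>i. e (Suc i)))
        (\<lambda>e. \<not> coset_like_bound n K (\<lambda>e. sat MM e \<phi>) (\<lambda>i. e (Suc i)))"
      by (intro formula_not formula_subst[OF formula_coset_like_bound[OF pair[OF wf] n]] term_var)
    from embedding_transfer[OF N_def NN_def emb formula_ex_env[OF this], of "\<lambda>_. 0"]
    have "coset_like_bound n K (\<lambda>e. sat MM e \<phi>) e'" for e' using bound by simp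
    from coset_like_bound_imp_coset_like[OF this n] have "coset_like D" unfolding D .
    then show "definable_unary (group_struct :: (plus_symbol, less_symbol, 'b) fo_struct) D"
      by (rule coset_like_imp_definable_unary[OF index'])
  qed
  have unary'_unary: ?unary if unary': ?unary'
  proof (intro allI impI)
    fix D :: "'a set" assume "definable_unary M D"
    then obtain \<phi> bs where \<phi>: "is_formula M (1 + length bs) \<phi>" and D: "D = {x. sat M (x ## nth bs) \<phi>}"
      by (rule definable_unaryE)
    have wf: "wf_formula M \<phi>" using \<phi> unfolding is_formula_def by blast
    have "is_formula MM (1 + length (map j bs)) \<phi>"
      using \<phi> wf_same_arity[OF arity] unfolding is_formula_def by simp
    from definable_unaryI[OF this]
    have "definable_unary (group_struct :: (plus_symbol, less_symbol, 'b) fo_struct) {x. sat MM (x ## nth (map j bs)) \<phi>}"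
      using unary' by blast
    then have "coset_like {x. sat MM (x ## nth (map j bs)) \<phi>}"
      by (rule definable_unary_imp_coset_like[OF index'])
    moreover have "sat MM (x ## nth (map j bs)) \<phi> \<longleftrightarrow> sat MM (x ## (\<lambda>i. j (bs ! i))) \<phi>" for x
    proof (rule sat_cong)
      fix i assume "i \<in> fv \<phi>"
      then have "i < Suc (length bs)" using \<phi> unfolding is_formula_def by auto
      then show "(x ## nth (map j bs)) i = (x ## (\<lambda>i. j (bs ! i))) i" by (simp split: nat.split)
    qed
    ultimately have "coset_like {x. sat MM (x ## (\<lambda>i. j (bs ! i))) \<phi>}" by simp
    from coset_like_uniform[OF index' this] obtain n K where n: "1 \<le> n" and
      "coset_like_bound n K (\<lambda>e. sat MM e \<phi>) (\<lambda>i. j (bs ! i))"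
      unfolding coset_like_bound_def mem_Collect_eq by blast
    then have "coset_like_bound n K (\<lambda>e. sat M e \<phi>) (nth bs)"
      using embedding_transfer[OF N_def NN_def emb formula_coset_like_bound[OF pair[OF wf] n], of K "nth bs"] by simp
    from coset_like_bound_imp_coset_like[OF this n] have "coset_like D" unfolding D .
    then show "definable_unary (group_struct :: (plus_symbol, less_symbol, 'a) fo_struct) D"
      by (rule coset_like_imp_definable_unary[OF index])
  qed
  show ?thesis
    using stable_unary unary_uniform uniform_stable uniform_unary' unary'_unary by blast
qed

end
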